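(* Let $X=V(f)\subseteq\mathbb{P}^n$ be a hypersurface of degree $d$ over $\mathbb{C}$ with at most isolated singularities. Assume that either $d=3$ and $n\geq5$, or $d\geq4$ and $n\geq3$. Suppose that $$\tau(X)<(d-2)(d-1)^{n-1}$$ and that there exists a hyperplane $H'$ with $H'\cap\operatorname{Sing}(X)=\emptyset$ such that $W=X\cap H'$ has exactly $n$ nodes in general linear position in $H'\simeq\mathbb{P}^{n-1}$. Then the hyperplane-section map $$\Phi(f):\mathbb{P}^{n*}\dashrightarrow\mathcal{M}(d,n-1)$$ is generically finite onto its image.
   Context: $f\in\mathbb{C}[x_0,\ldots,x_n]$ is a homogeneous polynomial of degree $d$ defining $X$. "$W$ has exactly $n$ nodes" means that the singular locus of $W$ consists of exactly $n$ points, each an ordinary double point (node) of $W$. The $n$ nodes are in general linear position in $\mathbb{P}^{n-1}$ if they are linearly independent, i.e. not contained in any hyperplane of $\mathbb{P}^{n-1}$. Tjurina number: for $p\in\operatorname{Sing}(X)$, with local coordinates $y_1,\ldots,y_n$ at $p$ and a local equation $h$ of $X$ at $p$, $\tau(X,p)=\dim_{\mathbb{C}}\mathcal{O}_{\mathbb{P}^n,p}/(h,\partial h/\partial y_1,\ldots,\partial h/\partial y_n)$, and $\tau(X)=\sum_{p\in\operatorname{Sing}(X)}\tau(X,p)$. $\mathcal{M}(d,n-1)$ is the coarse moduli space of smooth degree $d$ hypersurfaces in $\mathbb{P}^{n-1}$, i.e. the geometric (GIT) quotient by $PGL_n(\mathbb{C})$ of the open subset of $\mathbb{P}(\mathbb{C}[x_1,\ldots,x_n]_d)$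 parametrizing smooth hypersurfaces. $U_f=\{H\in\mathbb{P}^{n*}\mid X\cap H\text{ is smooth}\}$ is nonempty and Zariski open, and $\Phi(f)$ is the rational map given on $U_f$ by $H\mapsto[X\cap H]$, where $X\cap H\subseteq H\simeq\mathbb{P}^{n-1}$. It is generically finite onto its image if the general fiber of $\mathbb{P}^{n*}\dashrightarrow\operatorname{Im}\Phi(f)$ is finite, equivalently $\dim\operatorname{Im}\Phi(f)=n$. *)

theory Defs
  imports
    "HOL-Analysis.Analysis"
    "HOL-Library.Poly_Mapping"
    "HOL-Library.Extended_Nat"
    "HOL-Computational_Algebra.Fraction_Field"
begin

section \<open>Polynomials\<close>

text \<open>
  Complex polynomials in variables indexed by \<open>'i\<close>, as finitely supported maps from exponent
  vectors to coefficients; \<open>*\<close> is the convolution product of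
  \<^theory>\<open>HOL-Library.Poly_Mapping\<close>.  The number of variables is not part of the type: it is
  bounded by an explicit finite index set \<open>I\<close>.  Projective \<open>m\<close>-space has \<open>I = {..m}\<close> inside
  \<^typ>\<open>nat\<close>, and the projective space of forms of a given degree has the relevant monomials as
  indices.
\<close>

type_synonym 'i mpoly = "('i \<Rightarrow>\<^sub>0 nat) \<Rightarrow>\<^sub>0 complex"

definition Const :: "complex \<Rightarrow> 'i mpoly" where
  "Const c = Poly_Mapping.single 0 c"

definition Var :: "'i \<Rightarrow> 'i mpoly" where
  "Var i = Poly_Mapping.single (Poly_Mapping.single i 1) 1"

definition polys :: "'i set \<Rightarrow> 'i mpoly set" where
  "polys I = {p. \<forall>m\<in>Poly_Mapping.keys p. Poly_Mapping.keys m \<subseteq> I}"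

definition monomials :: "'i set \<Rightarrow> nat \<Rightarrow> ('i \<Rightarrow>\<^sub>0 nat) set" where
  "monomials I d = {m. Poly_Mapping.keys m \<subseteq> I \<and>
     (\<Sum>i\<in>Poly_Mapping.keys m. Poly_Mapping.lookup m i) = d}"

text \<open>The zero polynomial is a form of every degree.\<close>

definition forms :: "'i set \<Rightarrow> nat \<Rightarrow> 'i mpoly set" where
  "forms I d = {p. Poly_Mapping.keys p \<subseteq> monomials I d}"

definition eval_poly :: "'i mpoly \<Rightarrow> ('i \<Rightarrow> complex) \<Rightarrow> complex" where
  "eval_poly p v = (\<Sum>m\<in>Poly_Mapping.keys p. Poly_Mapping.lookup p m *
     (\<Prod>i\<in>Poly_Mapping.keys m. v i ^ Poly_Mapping.lookup m i))"

definition subst_poly :: "('i \<Rightarrow> 'j mpoly) \<Rightarrow> 'i mpoly \<Rightarrow> 'j mpoly" where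
  "subst_poly \<sigma> p = (\<Sum>m\<in>Poly_Mapping.keys p. Const (Poly_Mapping.lookup p m) *
     (\<Prod>i\<in>Poly_Mapping.keys m. \<sigma> i ^ Poly_Mapping.lookup m i))"

text \<open>
  Formal partial derivative.  If the variable \<open>i\<close> does not occur in the monomial \<open>m\<close>, the truncated
  subtraction is harmless because the coefficient vanishes.
\<close>

definition pd :: "'i \<Rightarrow> 'i mpoly \<Rightarrow> 'i mpoly" where
  "pd i p = (\<Sum>m\<in>Poly_Mapping.keys p. Poly_Mapping.single (m - Poly_Mapping.single i 1)
     (of_nat (Poly_Mapping.lookup m i) * Poly_Mapping.lookup p m))"


section \<open>Projective spaces\<close>

definition cspace :: "'i set \<Rightarrow> ('i \<Rightarrow> complex) set" where
  "cspace I = {v. \<forall>i. i \<notin> I \<longrightarrow> v i = 0}"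

text \<open>A point of projective space is the set of all its vectors of homogeneous coordinates.\<close>

definition proj_pt :: "('i \<Rightarrow> complex) \<Rightarrow> ('i \<Rightarrow> complex) set" where
  "proj_pt v = {(\<lambda>i. c * v i) | c. c \<noteq> 0}"

definition proj :: "'i set \<Rightarrow> ('i \<Rightarrow> complex) set set" where
  "proj I = proj_pt ` (cspace I - {\<lambda>_. 0})"

definition coords :: "('i \<Rightarrow> complex) set \<Rightarrow> 'i \<Rightarrow> complex" where
  "coords P = (SOME v. v \<in> P)"

definition principal_open :: "'i set \<Rightarrow> 'i mpoly \<Rightarrow> ('i \<Rightarrow> complex) set set" where
  "principal_open I F = {P \<in> proj I. \<forall>v\<in>P. eval_poly F v \<noteq> 0}"

definition zariski :: "'i set \<Rightarrow> ('i \<Rightarrow> complex) set topology" where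
  "zariski I = topology_generated_by {principal_open I F | F d. F \<in> forms I d}"

text \<open>
  A point \<open>L\<close> of the dual projective space is a nonzero linear form up to scaling, given by its
  coefficients.  The first set is the cone over the hyperplane.
\<close>

definition hyperplane_cone :: "'i set \<Rightarrow> ('i \<Rightarrow> complex) set \<Rightarrow> ('i \<Rightarrow> complex) set" where
  "hyperplane_cone I L = {v \<in> cspace I. \<forall>l\<in>L. (\<Sum>i\<in>I. l i * v i) = 0}"

definition hyperplane :: "'i set \<Rightarrow> ('i \<Rightarrow> complex) set \<Rightarrow> ('i \<Rightarrow> complex) set set" where
  "hyperplane I L = {P \<in> proj I. P \<subseteq> hyperplane_cone I L}"

definition general_linear_position :: "'i set \<Rightarrow> ('i \<Rightarrow> complex) set set \<Rightarrow> bool" where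
  "general_linear_position I S \<longleftrightarrow> \<not> (\<exists>L\<in>proj I. S \<subseteq> hyperplane I L)"


section \<open>Hypersurfaces and their singularities\<close>

definition hypersurface :: "'i set \<Rightarrow> nat \<Rightarrow> 'i mpoly \<Rightarrow> bool" where
  "hypersurface I d F \<longleftrightarrow> F \<in> forms I d \<and> F \<noteq> 0"

definition Sing :: "'i set \<Rightarrow> 'i mpoly \<Rightarrow> ('i \<Rightarrow> complex) set set" where
  "Sing I F = {P \<in> proj I. \<forall>v\<in>P. eval_poly F v = 0 \<and> (\<forall>i\<in>I. eval_poly (pd i F) v = 0)}"

definition at_most_isolated_singularities :: "'i set \<Rightarrow> 'i mpoly \<Rightarrow> bool" where
  "at_most_isolated_singularities I F \<longleftrightarrow>
     (\<forall>P\<in>Sing I F. \<exists>U. openin (zariski I) U \<and> U \<inter> Sing I F = {P})"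

text \<open>
  Local data at a point \<open>P\<close>, in the first standard affine chart \<open>x\<^sub>i \<noteq> 0\<close> containing \<open>P\<close>.  The local
  coordinates are the remaining variables \<open>x\<^sub>j/x\<^sub>i\<close>, \<open>j \<in> chart_vars I P\<close> (translated to vanish at \<open>P\<close>,
  which does not change the partial derivatives), and the local equation is the dehomogenisation of \<open>F\<close>.
\<close>

definition chart :: "(nat \<Rightarrow> complex) set \<Rightarrow> nat" where
  "chart P = (LEAST i. coords P i \<noteq> 0)"

definition chart_vars :: "nat set \<Rightarrow> (nat \<Rightarrow> complex) set \<Rightarrow> nat set" where
  "chart_vars I P = I - {chart P}"

definition chart_pt :: "(nat \<Rightarrow> complex) set \<Rightarrow> nat \<Rightarrow> complex" where
  "chart_pt P = (\<lambda>j. coords P j / coords P (chart P))"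

definition local_eq :: "nat mpoly \<Rightarrow> (nat \<Rightarrow> complex) set \<Rightarrow> nat mpoly" where
  "local_eq F P = subst_poly (\<lambda>j. if j = chart P then 1 else Var j) F"

text \<open>
  The local ring of projective space at \<open>P\<close>, as a subring of the field of fractions of polynomials
  in the chart variables.
\<close>

definition local_ring :: "nat set \<Rightarrow> (nat \<Rightarrow> complex) set \<Rightarrow> nat mpoly fract set" where
  "local_ring I P = {Fract a b | a b. a \<in> polys (chart_vars I P) \<and> b \<in> polys (chart_vars I P) \<and>
     eval_poly b (chart_pt P) \<noteq> 0}"

definition tjurina_ideal :: "nat set \<Rightarrow> nat mpoly \<Rightarrow> (nat \<Rightarrow> complex) set \<Rightarrow> nat mpoly fract set" where
  "tjurina_ideal I F P =
     {a * Fract (local_eq F P) 1 + (\<Sum>j\<in>chart_vars I P. b j * Fract (pd j (local_eq F P)) 1) | a b.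
        a \<in> local_ring I P \<and> (\<forall>j. b j \<in> local_ring I P)}"

text \<open>
  Dimension of the complex vector space \<open>R / J\<close>: the largest size, possibly infinite, of a finite
  subset of \<open>R\<close> that is linearly independent modulo \<open>J\<close>.
\<close>

definition quotient_dim :: "nat mpoly fract set \<Rightarrow> nat mpoly fract set \<Rightarrow> enat" where
  "quotient_dim R J = Sup {enat (card B) | B. finite B \<and> B \<subseteq> R \<and>
     (\<forall>c :: nat mpoly fract \<Rightarrow> complex.
        (\<Sum>b\<in>B. Fract (Const (c b)) 1 * b) \<in> J \<longrightarrow> (\<forall>b\<in>B. c b = 0))}"

definition local_tjurina :: "nat set \<Rightarrow> nat mpoly \<Rightarrow> (nat \<Rightarrow> complex) set \<Rightarrow> enat" where
  "local_tjurina I F P = quotient_dim (local_ring I P) (tjurina_ideal I F P)"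

text \<open>Meaningful when the singularities are isolated, as the singular locus is then finite.\<close>

definition tjurina :: "nat set \<Rightarrow> nat mpoly \<Rightarrow> enat" where
  "tjurina I F = (\<Sum>P\<in>Sing I F. local_tjurina I F P)"

text \<open>
  Ordinary double point: a singular point at which the quadratic part of the local equation, i.e. its
  Hessian in the local coordinates, is nondegenerate.
\<close>

definition node :: "nat set \<Rightarrow> nat mpoly \<Rightarrow> (nat \<Rightarrow> complex) set \<Rightarrow> bool" where
  "node I F P \<longleftrightarrow> P \<in> Sing I F \<and>
     (\<forall>w\<in>cspace (chart_vars I P).
        (\<forall>j\<in>chart_vars I P.
           (\<Sum>k\<in>chart_vars I P. eval_poly (pd j (pd k (local_eq F P))) (chart_pt P) * w k) = 0)
        \<longrightarrow> w = (\<lambda>_. 0))"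

definition has_exactly_nodes :: "nat \<Rightarrow> nat set \<Rightarrow> nat mpoly \<Rightarrow> bool" where
  "has_exactly_nodes k I F \<longleftrightarrow>
     finite (Sing I F) \<and> card (Sing I F) = k \<and> (\<forall>P\<in>Sing I F. node I F P)"


section \<open>Linear substitutions and hyperplane sections\<close>

text \<open>Matrices act on \<open>\<complex>\<^sup>m\<^sup>+\<^sup>1\<close> (columns \<open>0, \<dots>, m\<close>) and forms are pulled back along this action.\<close>

definition lin_map :: "nat \<Rightarrow> (nat \<Rightarrow> nat \<Rightarrow> complex) \<Rightarrow> (nat \<Rightarrow> complex) \<Rightarrow> nat \<Rightarrow> complex" where
  "lin_map m A v = (\<lambda>j. \<Sum>k\<le>m. A j k * v k)"

definition pullback_form :: "nat \<Rightarrow> (nat \<Rightarrow> nat \<Rightarrow> complex) \<Rightarrow> nat mpoly \<Rightarrow> nat mpoly" where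
  "pullback_form m A F = subst_poly (\<lambda>j. \<Sum>k\<le>m. Const (A j k) * Var k) F"

definition hyperplane_iso :: "nat \<Rightarrow> (nat \<Rightarrow> complex) set \<Rightarrow> (nat \<Rightarrow> nat \<Rightarrow> complex) \<Rightarrow> bool" where
  "hyperplane_iso n H A \<longleftrightarrow> bij_betw (lin_map (n - 1) A) (cspace {..n - 1}) (hyperplane_cone {..n} H)"

text \<open>
  The equation of \<open>V(f) \<inter> H\<close> in \<open>H \<simeq> \<P>\<^sup>n\<^sup>-\<^sup>1\<close>.  Two identifications of \<open>H\<close> with projective
  space differ by a linear automorphism, so nothing below depends on the choice.
\<close>

definition hyperplane_section :: "nat \<Rightarrow> nat mpoly \<Rightarrow> (nat \<Rightarrow> complex) set \<Rightarrow> nat mpoly" where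
  "hyperplane_section n f H = pullback_form (n - 1) (SOME A. hyperplane_iso n H A) f"


section \<open>The moduli space of smooth hypersurfaces\<close>

definition form_pt :: "nat mpoly \<Rightarrow> ((nat \<Rightarrow>\<^sub>0 nat) \<Rightarrow> complex) set" where
  "form_pt g = proj_pt (Poly_Mapping.lookup g)"

definition smooth_hypersurfaces :: "nat \<Rightarrow> nat \<Rightarrow> ((nat \<Rightarrow>\<^sub>0 nat) \<Rightarrow> complex) set set" where
  "smooth_hypersurfaces d m = {form_pt g | g. hypersurface {..m} d g \<and> Sing {..m} g = {}}"

text \<open>Scalar matrices fix every point, so orbits under \<open>GL\<close> and \<open>PGL\<close> agree.\<close>

definition PGL_orbit ::
  "nat \<Rightarrow> nat \<Rightarrow> ((nat \<Rightarrow>\<^sub>0 nat) \<Rightarrow> complex) set \<Rightarrow> ((nat \<Rightarrow>\<^sub>0 nat) \<Rightarrow> complex) set set" where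
  "PGL_orbit d m P = {form_pt (pullback_form m A g) | g A.
     g \<in> forms {..m} d \<and> form_pt g = P \<and> bij_betw (lin_map m A) (cspace {..m}) (cspace {..m})}"

definition quotient_topology :: "'a topology \<Rightarrow> ('a \<Rightarrow> 'b) \<Rightarrow> 'b topology" where
  "quotient_topology X q =
     topology (\<lambda>U. U \<subseteq> q ` topspace X \<and> openin X {x \<in> topspace X. q x \<in> U})"

lemma openin_quotient_topology:
  "openin (quotient_topology X q) U \<longleftrightarrow>
     U \<subseteq> q ` topspace X \<and> openin X {x \<in> topspace X. q x \<in> U}"
proof -
  have "istopology (\<lambda>U. U \<subseteq> q ` topspace X \<and> openin X {x \<in> topspace X. q x \<in> U})"
    unfolding istopology_def
  proof (intro conjI allI impI)
    fix S T
    assume "S \<subseteq> q ` topspace X \<and> openin X {x \<in> topspace X. q x \<in> S}"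
      and "T \<subseteq> q ` topspace X \<and> openin X {x \<in> topspace X. q x \<in> T}"
    moreover have "{x \<in> topspace X. q x \<in> S \<inter> T} =
        {x \<in> topspace X. q x \<in> S} \<inter> {x \<in> topspace X. q x \<in> T}"
      by auto
    ultimately show "S \<inter> T \<subseteq> q ` topspace X" "openin X {x \<in> topspace X. q x \<in> S \<inter> T}"
      by (auto intro: openin_Int)
  next
    fix K
    assume K: "\<forall>S\<in>K. S \<subseteq> q ` topspace X \<and> openin X {x \<in> topspace X. q x \<in> S}"
    have "{x \<in> topspace X. q x \<in> \<Union>K} = (\<Union>S\<in>K. {x \<in> topspace X. q x \<in> S})"
      by auto
    then show "openin X {x \<in> topspace X. q x \<in> \<Union>K}"
      using K by (auto intro: openin_Union)
    show "\<Union>K \<subseteq> q ` topspace X"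
      using K by blast
  qed
  then show ?thesis
    by (simp add: quotient_topology_def topology_inverse')
qed

text \<open>
  The coarse moduli space of smooth hypersurfaces of degree \<open>d\<close> in projective \<open>m\<close>-space, as a
  topological space.  A geometric quotient is, topologically, the orbit space with the quotient of the
  Zariski topology; its structure sheaf plays no role for fibres of maps.
\<close>

definition moduli :: "nat \<Rightarrow> nat \<Rightarrow> ((nat \<Rightarrow>\<^sub>0 nat) \<Rightarrow> complex) set set topology" where
  "moduli d m = quotient_topology
     (subtopology (zariski (monomials {..m} d)) (smooth_hypersurfaces d m)) (PGL_orbit d m)"

definition smooth_sections :: "nat \<Rightarrow> nat mpoly \<Rightarrow> (nat \<Rightarrow> complex) set set" where
  "smooth_sections n f = {H \<in> proj {..n}. Sing {..n - 1} (hyperplane_section n f H) = {}}"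

definition hyperplane_section_map ::
  "nat \<Rightarrow> nat \<Rightarrow> nat mpoly \<Rightarrow> (nat \<Rightarrow> complex) set \<Rightarrow> ((nat \<Rightarrow>\<^sub>0 nat) \<Rightarrow> complex) set set" where
  "hyperplane_section_map d n f H = PGL_orbit d (n - 1) (form_pt (hyperplane_section n f H))"

text \<open>
  The map \<open>\<phi>\<close>, defined on the nonempty set \<open>U\<close>, has finite fibres over all points of some dense open
  subset of its image.
\<close>

definition generically_finite :: "'a set \<Rightarrow> 'b topology \<Rightarrow> ('a \<Rightarrow> 'b) \<Rightarrow> bool" where
  "generically_finite U Y \<phi> \<longleftrightarrow> U \<noteq> {} \<and> \<phi> ` U \<subseteq> topspace Y \<and>
     (\<exists>V. openin (subtopology Y (\<phi> ` U)) V \<and>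
        subtopology Y (\<phi> ` U) closure_of V = \<phi> ` U \<and>
        (\<forall>y\<in>V. finite {x \<in> U. \<phi> x = y}))"

end

theory Submission
  imports Defs "HOL-Computational_Algebra.Polynomial"
begin

text \<open>
  A section \<open>X \<inter> H\<close> has equation \<open>f(Bx)\<close>, where the columns of the \<open>(n + 1) \<times> n\<close> matrix \<open>B\<close> span \<open>H\<close>.
  Composing \<open>B\<close> with \<open>GL\<^sub>n\<close> is absorbed into \<open>B\<close>, so \<open>\<Phi>(f)\<close> is generically finite as soon as the
  polynomial map \<open>\<Psi> : B \<mapsto> f \<circ> B\<close> into the space of forms has finite fibres over a principal open set that
  meets its image, and for this one point with injective differential is enough: in suitable linear
  combinations of its coordinates \<open>\<Psi>\<close> is the identity to first order, so these are algebraically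
  independent, and counting monomials makes every matrix entry algebraic over them.

  The point is the nodal section \<open>W\<close>.  If \<open>\<nabla>f(Bx) \<cdot> Cx = 0\<close> for all \<open>x\<close>, evaluating at a node \<open>p\<close>, where
  \<open>\<nabla>f(Bp)\<close> is a nonzero multiple of the equation of \<open>H'\<close>, shows that \<open>C\<close> maps the nodes, hence everything,
  into \<open>H'\<close>, i.e. \<open>C = BA\<close>.  So \<open>A\<close> is an infinitesimal symmetry of the equation of \<open>W\<close>; it fixes every node,
  \<open>A p\<^sub>i = a\<^sub>i p\<^sub>i\<close>, and scales the nondegenerate Hessian at \<open>p\<^sub>i\<close>.  Taking a trace there gives
  \<open>(n - 1)(d - 2) a\<^sub>i + 2 \<Sum>\<^sub>j\<^sub>\<noteq>\<^sub>i a\<^sub>j = 0\<close> for all \<open>i\<close>, whence \<open>A = 0\<close>.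

  Smooth sections exist close to \<open>W\<close>: a first order perturbation of \<open>H'\<close> that moves off every node has no
  singular points near the nodes, and by compactness none elsewhere.
\<close>

section \<open>Polynomials and their evaluation\<close>

text \<open>It can still serve as the base point: algebraic independence concerns the polynomial map
  \<Psi> as a whole and may be tested at any one matrix. The trace equations have diagonal entries
  (n - 1)(d - 2) and all other entries 2. For d at least 3 they are singular exactly when (n - 1)(d
  - 2) = 2. Plane cubics with n = d = 3 show what goes wrong there: xyz has its nodes at the
  coordinate points and admits all diagonal matrices of trace zero as infinitesimal symmetries. The
  degrees and dimensions of the theorem keep (n - 1)(d - 2) at least 4. Two mismatches shape the
  passage to the moduli space. Sections are known only up to a scalar c, which is absorbed by
  scaling B with a d-th root of c. The polynomial that controls the fibres is not homogeneous, so
  one of its homogeneous parts has to define the open set, and that set must still be saturated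
  under the group.\<close>

abbreviation "lookup \<equiv> Poly_Mapping.lookup"
abbreviation "keys \<equiv> Poly_Mapping.keys"
abbreviation "single \<equiv> Poly_Mapping.single"

definition mon :: "('i \<Rightarrow> complex) \<Rightarrow> ('i \<Rightarrow>\<^sub>0 nat) \<Rightarrow> complex" where
  "mon v m = (\<Prod>i\<in>keys m. v i ^ lookup m i)"

lemma mon_superset:
  assumes "finite A" "keys m \<subseteq> A"
  shows "mon v m = (\<Prod>i\<in>A. v i ^ lookup m i)"
  unfolding mon_def using assms
  by (intro prod.mono_neutral_left) (auto simp: in_keys_iff)

lemma mon_zero [simp]: "mon v 0 = 1"
  by (simp add: mon_def)

lemma mon_add: "mon v (m + m') = mon v m * mon v m'"
proof -
  let ?A = "keys m \<union> keys m'"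
  have "keys (m + m') \<subseteq> ?A" by (rule Poly_Mapping.keys_add)
  then show ?thesis
    by (simp add: mon_superset[of ?A] lookup_add power_add prod.distrib)
qed

lemma mon_single [simp]: "mon v (single i k) = v i ^ k"
  by (simp add: mon_def)

lemma eval_poly_superset:
  assumes "finite A" "keys p \<subseteq> A"
  shows "eval_poly p v = (\<Sum>m\<in>A. lookup p m * mon v m)"
  unfolding eval_poly_def mon_def[symmetric] using assms
  by (intro sum.mono_neutral_left) (auto simp: in_keys_iff)

lemma eval_poly_add: "eval_poly (p + q) v = eval_poly p v + eval_poly q v"
proof -
  let ?A = "keys p \<union> keys q"
  have "keys (p + q) \<subseteq> ?A" by (rule Poly_Mapping.keys_add)
  then show ?thesis
    by (simp add: eval_poly_superset[of ?A] lookup_add algebra_simps sum.distrib)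
qed

lemma eval_poly_single [simp]: "eval_poly (single m c) v = c * mon v m"
  by (simp add: eval_poly_superset[of "{m}"])

lemma eval_poly_0 [simp]: "eval_poly 0 v = 0"
  by (simp add: eval_poly_def)

lemma eval_poly_sum: "eval_poly (\<Sum>x\<in>A. p x) v = (\<Sum>x\<in>A. eval_poly (p x) v)"
  by (induction A rule: infinite_finite_induct) (auto simp: eval_poly_add)

lemma poly_mapping_sum_monomials:
  fixes p :: "'a \<Rightarrow>\<^sub>0 'b :: comm_monoid_add"
  shows "(\<Sum>m\<in>keys p. single m (lookup p m)) = p"
  by (rule poly_mapping_eqI) (auto simp: lookup_sum lookup_single when_def in_keys_iff)

lemma poly_mapping_expand:
  fixes p :: "'i mpoly"
  shows "p = (\<Sum>m\<in>keys p. single m (lookup p m))"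
  by (rule poly_mapping_sum_monomials[symmetric])


lemma eval_poly_mult: "eval_poly (p * q) v = eval_poly p v * eval_poly q v"
proof -
  have "p * q = (\<Sum>m\<in>keys p. \<Sum>m'\<in>keys q.
      single (m + m') (lookup p m * lookup q m'))"
    by (subst (1) poly_mapping_expand[of p], subst (1) poly_mapping_expand[of q])
      (simp add: sum_product mult_single)
  then show ?thesis
    by (simp add: eval_poly_sum eval_poly_def[of p] eval_poly_def[of q] mon_def[symmetric]
        sum_product mon_add algebra_simps)
qed

lemma eval_poly_Const [simp]: "eval_poly (Const c) v = c"
  by (simp add: Const_def)

lemma eval_poly_1 [simp]: "eval_poly 1 v = 1"
  using eval_poly_Const[of 1 v] by (simp add: Const_def)

lemma eval_poly_Var [simp]: "eval_poly (Var i) v = v i"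
  by (simp add: Var_def)

lemma eval_poly_prod: "eval_poly (\<Prod>x\<in>A. p x) v = (\<Prod>x\<in>A. eval_poly (p x) v)"
  by (induction A rule: infinite_finite_induct) (auto simp: eval_poly_mult)

lemma eval_poly_power: "eval_poly (p ^ k) v = eval_poly p v ^ k"
  by (induction k) (auto simp: eval_poly_mult)

lemma eval_subst_poly: "eval_poly (subst_poly \<sigma> p) v = eval_poly p (\<lambda>i. eval_poly (\<sigma> i) v)"
  by (simp add: subst_poly_def eval_poly_sum eval_poly_mult eval_poly_prod eval_poly_power
      eval_poly_def[of p])

lemma eval_poly_cong:
  assumes "p \<in> polys I" "\<And>i. i \<in> I \<Longrightarrow> v i = w i"
  shows "eval_poly p v = eval_poly p w"
  unfolding eval_poly_def using assms
  by (intro sum.cong prod.cong arg_cong2[of _ _ _ _ "(*)"] refl) (force simp: polys_def)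

section \<open>Polynomials in a prescribed set of variables\<close>

lemma Const_in_polys [simp]: "Const c \<in> polys I"
  by (auto simp: polys_def Const_def)

lemma Var_in_polys: "i \<in> I \<Longrightarrow> Var i \<in> polys I"
  by (auto simp: polys_def Var_def)

lemma zero_in_polys [simp]: "0 \<in> polys I"
  by (auto simp: polys_def)

lemma one_in_polys [simp]: "1 \<in> polys I"
  using Const_in_polys[of 1 I] by (simp add: Const_def)

lemma add_in_polys: "p \<in> polys I \<Longrightarrow> q \<in> polys I \<Longrightarrow> p + q \<in> polys I"
  using Poly_Mapping.keys_add[of p q] by (auto simp: polys_def)

lemma mult_in_polys: "p \<in> polys I \<Longrightarrow> q \<in> polys I \<Longrightarrow> p * q \<in> polys I"
proof -
  assume a: "p \<in> polys I" "q \<in> polys I"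
  show ?thesis
    unfolding polys_def
  proof (intro CollectI ballI)
    fix m assume "m \<in> keys (p * q)"
    then obtain x y where "m = x + y" "x \<in> keys p" "y \<in> keys q"
      using keys_mult[of p q] by blast
    then show "keys m \<subseteq> I"
      using a Poly_Mapping.keys_add[of x y] by (fastforce simp: polys_def)
  qed
qed

lemma sum_in_polys: "(\<And>x. x \<in> A \<Longrightarrow> p x \<in> polys I) \<Longrightarrow> (\<Sum>x\<in>A. p x) \<in> polys I"
  by (induction A rule: infinite_finite_induct) (auto simp: add_in_polys)

lemma prod_in_polys: "(\<And>x. x \<in> A \<Longrightarrow> p x \<in> polys I) \<Longrightarrow> (\<Prod>x\<in>A. p x) \<in> polys I"
  by (induction A rule: infinite_finite_induct) (auto simp: mult_in_polys)

lemma power_in_polys: "p \<in> polys I \<Longrightarrow> p ^ k \<in> polys I"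
  by (induction k) (auto simp: mult_in_polys)

lemma subst_in_polys:
  assumes "p \<in> polys I" "\<And>i. i \<in> I \<Longrightarrow> \<sigma> i \<in> polys J"
  shows "subst_poly \<sigma> p \<in> polys J"
  unfolding subst_poly_def using assms
  by (intro sum_in_polys mult_in_polys prod_in_polys power_in_polys) (auto simp: polys_def[of I])

text \<open>Constants and variables generate \<open>polys I\<close> under sums and products, so a
  property of evaluation reduces to a sum rule and a product rule. The chain rule and the continuity
  of evaluation are proved this way.\<close>

lemma polys_induct [consumes 1, case_names Const Var add mult]:
  assumes p: "p \<in> polys I"
    and C: "\<And>c. Q (Const c)" and V: "\<And>i. i \<in> I \<Longrightarrow> Q (Var i)"
    and A: "\<And>p q. p \<in> polys I \<Longrightarrow> q \<in> polys I \<Longrightarrow> Q p \<Longrightarrow> Q q \<Longrightarrow> Q (p + q)"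
    and M: "\<And>p q. p \<in> polys I \<Longrightarrow> q \<in> polys I \<Longrightarrow> Q p \<Longrightarrow> Q q \<Longrightarrow> Q (p * q)"
  shows "Q p"
proof -
  \<comment> \<open>Membership travels with \<open>Q\<close>, since the premises for sums and
    products demand both.\<close>
  define R where "R p \<longleftrightarrow> p \<in> polys I \<and> Q p" for p
  have R0: "R 0" "R 1" using C[of 0] C[of 1] by (auto simp: R_def Const_def)
  have Ra: "R p \<Longrightarrow> R q \<Longrightarrow> R (p + q)" and Rm: "R p \<Longrightarrow> R q \<Longrightarrow> R (p * q)" for p q
    by (auto simp: R_def add_in_polys mult_in_polys A M)
  have Rp: "R p \<Longrightarrow> R (p ^ k)" for p k by (induction k) (auto simp: R0 Rm)
  have mono: "single m c = Const c * (\<Prod>i\<in>keys m. Var i ^ lookup m i)"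
    for m :: "'a \<Rightarrow>\<^sub>0 nat" and c
  proof -
    have V: "Var i ^ k = single (single i k) 1" for i :: 'a and k
      by (induction k) (auto simp: Var_def mult_single single_add[symmetric] simp flip: single_one)
    have "(\<Prod>i\<in>A. Var i ^ lookup m i)
        = single (\<Sum>i\<in>A. single i (lookup m i)) 1" for A
      by (induction A rule: infinite_finite_induct) (auto simp: V mult_single)
    then show ?thesis
      by (simp add: poly_mapping_sum_monomials Const_def mult_single)
  qed
  have "R (single m c)" if "keys m \<subseteq> I" for m c
  proof -
    have "R (\<Prod>i\<in>A. Var i ^ lookup m i)" if "A \<subseteq> I" for A
      using that
      by (induction A rule: infinite_finite_induct)
        (auto simp: R0 intro!: Rm Rp, auto simp: R_def V Var_in_polys)
    moreover have "R (Const c)" by (simp add: R_def C)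
    ultimately show ?thesis using that by (subst mono) (auto intro!: Rm)
  qed
  then have "R (\<Sum>m\<in>A. single m (lookup p m))"
    if "A \<subseteq> keys p" for A
    using that p
    by (induction A rule: infinite_finite_induct) (auto simp: R0 polys_def intro!: Ra)
  from this[of "keys p"] show ?thesis
    by (simp add: poly_mapping_sum_monomials R_def)
qed

section \<open>Formal partial derivatives and homogeneity\<close>

lemma lookup_pd: "lookup (pd i p) m =
   of_nat (lookup m i + 1) * lookup p (m + single i 1)"
proof -
  let ?e = "single i (1::nat)"
  have l: "lookup (single (m' - ?e) (of_nat (lookup m' i) * lookup p m')) m
     = (if m' = m + ?e then of_nat (lookup m i + 1) * lookup p (m + ?e) else 0)" for m'
  proof (cases "m' = m + ?e")
    case True
    then show ?thesis by (simp add: lookup_add)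
  next
    case False
    \<comment> \<open>Truncated subtraction can send a wrong \<open>m'\<close> to \<open>m\<close>
      only if \<open>i\<close> does not occur in \<open>m'\<close>, and then the coefficient factor
      is zero.\<close>
    then have "m' - ?e \<noteq> m \<or> lookup m' i = 0"
    proof (rule_tac ccontr)
      assume c: "\<not> (m' - ?e \<noteq> m \<or> lookup m' i = 0)"
      have "m' = m + ?e"
      proof (rule poly_mapping_eqI)
        fix k
        have "lookup m k = lookup m' k - lookup ?e k"
          using c by (metis lookup_minus)
        then show "lookup m' k = lookup (m + ?e) k"
          using c by (cases "k = i") (auto simp: lookup_add lookup_single when_def)
      qed
      then show False using False by simp
    qed
    then show ?thesis using False by (auto simp: lookup_single when_def)
  qed
  show ?thesis
    unfolding pd_def lookup_sum l by (auto simp: in_keys_iff)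
qed

lemma pd_add: "pd i (p + q) = pd i p + pd i q"
  by (rule poly_mapping_eqI) (simp add: lookup_pd lookup_add algebra_simps)

lemma pd_zero [simp]: "pd i 0 = 0"
  by (rule poly_mapping_eqI) (simp add: lookup_pd)

lemma pd_sum: "pd i (\<Sum>x\<in>A. p x) = (\<Sum>x\<in>A. pd i (p x))"
  by (induction A rule: infinite_finite_induct) (auto simp: pd_add)

lemma pd_commute: "pd i (pd j p) = pd j (pd i p)"
  by (rule poly_mapping_eqI) (auto simp: lookup_pd lookup_add lookup_single when_def algebra_simps)

lemma pd_Const [simp]: "pd i (Const c) = 0"
  by (simp add: pd_def Const_def)

lemma pd_Var: "pd i (Var j) = (if i = j then 1 else 0)"
  by (auto simp: pd_def Var_def lookup_single when_def simp flip: single_one)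

lemma pd_mult: "pd i (p * q) = pd i p * q + p * pd i q"
proof -
  let ?e = "single i (1::nat)"
  \<comment> \<open>Truncated subtraction passes through the sum only if \<open>i\<close> occurs in
    \<open>x\<close>; otherwise the scalar factor of the term is zero.\<close>
  have shift: "x + y - ?e = (x - ?e) + y" if "lookup x i > 0" for x y :: "'a \<Rightarrow>\<^sub>0 nat"
    using that by (intro poly_mapping_eqI) (auto simp: lookup_add lookup_minus lookup_single when_def)
  have S: "pd i (single m a) = single (m - ?e) (of_nat (lookup m i) * a)" for m a
    by (cases "a = 0") (auto simp: pd_def)
  have *: "pd i (single (m + m') (a * b)) =
      pd i (single m a) * single m' b
      + single m a * pd i (single m' b)" for m m' a b
  proof -
    have "single (m + m' - ?e) (of_nat (lookup m i) * (a * b))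
      = single ((m - ?e) + m') (of_nat (lookup m i) * (a * b))"
      by (cases "lookup m i = 0") (simp_all only: shift neq0_conv of_nat_0 mult_zero_left single_zero)
    moreover have "single (m + m' - ?e) (of_nat (lookup m' i) * (a * b))
      = single (m + (m' - ?e)) (of_nat (lookup m' i) * (a * b))"
      by (cases "lookup m' i = 0")
        (simp_all only: shift[of m' m, unfolded add.commute[of _ m]] neq0_conv of_nat_0 mult_zero_left single_zero)
    ultimately show ?thesis
      by (simp add: S mult_single lookup_add distrib_right single_add algebra_simps)
  qed
  have "p * q = (\<Sum>m\<in>keys p. \<Sum>m'\<in>keys q.
      single (m + m') (lookup p m * lookup q m'))"
    by (subst (1) poly_mapping_expand[of p], subst (1) poly_mapping_expand[of q])
      (simp add: sum_product mult_single)
  then have "pd i (p * q) = (\<Sum>m\<in>keys p. \<Sum>m'\<in>keys q.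
      pd i (single m (lookup p m)) * single m' (lookup q m')
      + single m (lookup p m) * pd i (single m' (lookup q m')))"
    by (simp add: pd_sum *)
  also have "\<dots> = pd i (\<Sum>m\<in>keys p. single m (lookup p m))
        * (\<Sum>m\<in>keys q. single m (lookup q m))
      + (\<Sum>m\<in>keys p. single m (lookup p m))
        * pd i (\<Sum>m\<in>keys q. single m (lookup q m))"
    by (simp only: pd_sum sum.distrib sum_product)
  finally show ?thesis by (simp only: poly_mapping_sum_monomials)
qed

lemma pd_in_polys: "p \<in> polys I \<Longrightarrow> pd i p \<in> polys I"
proof -
  assume p: "p \<in> polys I"
  show ?thesis
    unfolding polys_def
  proof (intro CollectI ballI)
    fix m assume "m \<in> keys (pd i p)"
    then have "m + single i 1 \<in> keys p"
      by (auto simp: in_keys_iff lookup_pd)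
    then have "keys (m + single i 1) \<subseteq> I" using p by (auto simp: polys_def)
    moreover have "keys m \<subseteq> keys (m + single i 1)"
      by (auto simp: in_keys_iff lookup_add)
    ultimately show "keys m \<subseteq> I" by blast
  qed
qed

text \<open>For \<open>d = 0\<close> the truncated \<open>d - 1\<close> is harmless, because the
  derivative is then zero.\<close>

lemma pd_in_forms: "p \<in> forms I d \<Longrightarrow> pd i p \<in> forms I (d - 1)"
proof -
  assume p: "p \<in> forms I d"
  show ?thesis
    unfolding forms_def
  proof (intro CollectI subsetI)
    fix m assume "m \<in> keys (pd i p)"
    then have "m + single i 1 \<in> keys p" (is "?m \<in> _")
      by (auto simp: in_keys_iff lookup_pd)
    then have k: "?m \<in> monomials I d" using p by (auto simp: forms_def)
    have sub: "keys m \<subseteq> keys ?m"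
      by (auto simp: in_keys_iff lookup_add)
    have i: "i \<in> keys ?m" by (auto simp: in_keys_iff lookup_add)
    have "d = (\<Sum>j\<in>keys ?m. lookup ?m j)"
      using k by (auto simp: monomials_def)
    also have "\<dots> = (\<Sum>j\<in>keys ?m. lookup m j) + 1"
      using i by (simp add: lookup_add sum.distrib lookup_single when_def)
    also have "(\<Sum>j\<in>keys ?m. lookup m j) = (\<Sum>j\<in>keys m. lookup m j)"
      using sub by (intro sum.mono_neutral_right) (auto simp: in_keys_iff)
    finally have "(\<Sum>j\<in>keys m. lookup m j) = d - 1" by simp
    then show "m \<in> monomials I (d - 1)" using k sub by (auto simp: monomials_def)
  qed
qed

lemma forms_subset_polys: "forms I d \<subseteq> polys I"
  by (auto simp: forms_def polys_def monomials_def)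

lemma mon_scale: "mon (\<lambda>i. c * v i) m = c ^ (\<Sum>i\<in>keys m. lookup m i) * mon v m"
  by (simp add: mon_def power_mult_distrib prod.distrib power_sum)

lemma eval_forms_scale:
  assumes "p \<in> forms I d"
  shows "eval_poly p (\<lambda>i. c * v i) = c ^ d * eval_poly p v"
proof -
  have "lookup p m * mon (\<lambda>i. c * v i) m = c ^ d * (lookup p m * mon v m)"
    if "m \<in> keys p" for m
    using that assms by (auto simp: mon_scale forms_def monomials_def)
  then show ?thesis
    unfolding eval_poly_superset[OF finite_keys order_refl] sum_distrib_left by (intro sum.cong refl)
qed

section \<open>First-order expansions along a filter\<close>

text \<open>This says X = x + r x' + o(r). The filter and the scale \<open>r\<close> are left free
  because such expansions are needed both for t tending to 0 and along a sequence of moving singular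
  points.\<close>

definition dlim :: "'a filter \<Rightarrow> ('a \<Rightarrow> complex) \<Rightarrow> ('a \<Rightarrow> complex) \<Rightarrow> complex \<Rightarrow> complex \<Rightarrow> bool" where
  "dlim F r X x x' \<longleftrightarrow> ((\<lambda>k. (X k - x) / r k) \<longlongrightarrow> x') F"

locale infinitesimal =
  fixes F :: "'a filter" and r :: "'a \<Rightarrow> complex"
  assumes nz: "eventually (\<lambda>k. r k \<noteq> 0) F" and lim0: "(r \<longlongrightarrow> 0) F"
begin

lemma dlim_tendsto:
  assumes "dlim F r X x x'"
  shows "(X \<longlongrightarrow> x) F"
proof -
  have "((\<lambda>k. (X k - x) / r k * r k + x) \<longlongrightarrow> x' * 0 + x) F"
    using assms lim0 unfolding dlim_def by (intro tendsto_intros)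
  moreover have "eventually (\<lambda>k. (X k - x) / r k * r k + x = X k) F"
    using nz by eventually_elim auto
  ultimately show ?thesis by (auto simp: tendsto_cong)
qed

lemma dlim_const: "dlim F r (\<lambda>_. c) c 0"
  by (simp add: dlim_def)

lemma dlim_add:
  assumes "dlim F r X x x'" "dlim F r Y y y'"
  shows "dlim F r (\<lambda>k. X k + Y k) (x + y) (x' + y')"
  using tendsto_add[OF assms[unfolded dlim_def]]
  by (simp add: dlim_def add_divide_distrib[symmetric] algebra_simps)

lemma dlim_mult:
  assumes "dlim F r X x x'" "dlim F r Y y y'"
  shows "dlim F r (\<lambda>k. X k * Y k) (x * y) (x' * y + x * y')"
proof -
  have "((\<lambda>k. (X k - x) / r k * Y k + x * ((Y k - y) / r k)) \<longlongrightarrow> x' * y + x * y') F"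
    using assms dlim_tendsto[OF assms(2)] unfolding dlim_def by (intro tendsto_intros)
  moreover have "(X k - x) / r k * Y k + x * ((Y k - y) / r k) = (X k * Y k - x * y) / r k" for k
    by (simp add: diff_divide_distrib algebra_simps)
  ultimately show ?thesis by (simp add: dlim_def)
qed

lemma dlim_sum:
  assumes "\<And>i. i \<in> A \<Longrightarrow> dlim F r (X i) (x i) (x' i)"
  shows "dlim F r (\<lambda>k. \<Sum>i\<in>A. X i k) (\<Sum>i\<in>A. x i) (\<Sum>i\<in>A. x' i)"
  using assms by (induction A rule: infinite_finite_induct) (auto simp: dlim_const dlim_add)

lemma dlim_cmult:
  assumes "dlim F r X x x'"
  shows "dlim F r (\<lambda>k. c * X k) (c * x) (c * x')"
  using dlim_mult[OF dlim_const[of c] assms] by simp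

text \<open>The chain rule to first order, which ties the formal derivatives \<open>pd\<close> to
  limits of difference quotients.\<close>

lemma dlim_eval_poly:
  assumes I: "finite I" and p: "p \<in> polys I" and X: "\<And>i. i \<in> I \<Longrightarrow> dlim F r (X i) (x i) (x' i)"
  shows "dlim F r (\<lambda>k. eval_poly p (\<lambda>i. X i k)) (eval_poly p x) (\<Sum>i\<in>I. eval_poly (pd i p) x * x' i)"
  using p
proof (induction rule: polys_induct)
  case (Const c)
  then show ?case by (simp add: dlim_const)
next
  case (Var i)
  have "(\<Sum>j\<in>I. eval_poly (pd j (Var i)) x * x' j) = (\<Sum>j\<in>I. if j = i then x' j else 0)"
    by (intro sum.cong) (auto simp: pd_Var)
  also have "\<dots> = x' i" using Var I by simp
  finally show ?case using X[OF Var] by simp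
next
  case (add p q)
  show ?case using dlim_add[OF add(3,4)]
    by (simp add: eval_poly_add pd_add sum.distrib algebra_simps)
next
  case (mult p q)
  show ?case using dlim_mult[OF mult(3,4)]
    by (simp add: eval_poly_add eval_poly_mult pd_mult sum.distrib sum_distrib_left sum_distrib_right algebra_simps)
qed

lemma dlim_unique:
  assumes "F \<noteq> bot" "dlim F r X x x'" "dlim F r X x x''"
  shows "x' = x''"
  using assms tendsto_unique by (auto simp: dlim_def)

end

interpretation at0: infinitesimal "at (0::complex)" "\<lambda>t. t"
  by standard (auto simp: eventually_at_filter)

lemma dlim_line: "dlim (at 0) (\<lambda>t. t) (\<lambda>t. a + t * b) a b"
proof -
  have "eventually (\<lambda>t. (a + t * b - a) / t = b) (at (0::complex))"
    by (auto simp: eventually_at_filter)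
  then show ?thesis by (auto simp: dlim_def tendsto_cong)
qed

text \<open>Limits are unique, so a formal derivative can be computed from any first-order expansion
  in its variable. This replaces formal chain rules for substitutions.\<close>

lemma eval_pd_unique:
  assumes "finite I" "p \<in> polys I" "j \<in> I"
    and "dlim (at 0) (\<lambda>t. t) (\<lambda>t. eval_poly p (x(j := x j + t))) (eval_poly p x) D"
  shows "eval_poly (pd j p) x = D"
proof -
  let ?w = "\<lambda>i. if i = j then 1 else 0 :: complex"
  have "dlim (at 0) (\<lambda>t. t) (\<lambda>t. eval_poly p (\<lambda>i. x i + t * ?w i)) (eval_poly p x)
      (\<Sum>i\<in>I. eval_poly (pd i p) x * ?w i)"
    by (rule at0.dlim_eval_poly[OF assms(1,2)]) (rule dlim_line)
  moreover have "(\<lambda>i. x i + t * ?w i) = x(j := x j + t)" for t by auto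
  moreover have "(\<Sum>i\<in>I. eval_poly (pd i p) x * ?w i) = eval_poly (pd j p) x"
    using assms by (simp add: if_distrib[of "\<lambda>z. _ * z"] cong: if_cong)
  ultimately show ?thesis using at0.dlim_unique[OF _ _ assms(4)] by auto
qed

text \<open>Induction on the degree of the monomial: differentiating in a variable that occurs
  lowers the degree and multiplies the coefficient by a nonzero integer. The constant coefficient is
  the value at the origin.\<close>

lemma eval_poly_eq_0D:
  fixes p :: "'i mpoly"
  assumes "\<And>v. eval_poly p v = 0"
  shows "p = 0"
proof (rule poly_mapping_eqI)
  fix m :: "'i \<Rightarrow>\<^sub>0 nat"
  have "(\<forall>v. eval_poly p v = 0) \<longrightarrow> lookup p m = 0" for p :: "'i mpoly"
  proof (induction "\<Sum>i\<in>keys m. lookup m i" arbitrary: m p)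
    case 0
    then have "\<forall>i\<in>keys m. lookup m i = 0" by simp
    then have m: "m = 0" by (metis in_keys_iff keys_eq_empty ex_in_conv)
    have "eval_poly p (\<lambda>_. 0) = (\<Sum>m\<in>keys p. if m = 0 then lookup p 0 else 0)"
      unfolding eval_poly_superset[OF finite_keys order_refl]
    proof (intro sum.cong refl)
      fix m' assume "m' \<in> keys p"
      show "lookup p m' * mon (\<lambda>_. 0) m' = (if m' = 0 then lookup p 0 else 0)"
      proof (cases "m' = 0")
        case False
        then obtain i where "i \<in> keys m'" by (metis keys_eq_empty ex_in_conv)
        then have "mon (\<lambda>_. 0) m' = 0" unfolding mon_def by (subst prod_zero_iff) (auto simp: in_keys_iff)
        then show ?thesis using False by simp
      qed simp
    qed
    also have "\<dots> = lookup p 0" by (auto simp: in_keys_iff)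
    finally show ?case using m by auto
  next
    case (Suc k)
    then obtain i where i: "i \<in> keys m" by fastforce
    let ?e = "single i (1::nat)"
    define m' where "m' = m - ?e"
    have m: "m = m' + ?e"
      using i by (intro poly_mapping_eqI) (auto simp: m'_def lookup_add lookup_minus lookup_single when_def in_keys_iff)
    have sub: "keys m' \<subseteq> keys m" by (auto simp: m in_keys_iff lookup_add)
    have "Suc k = (\<Sum>j\<in>keys m. lookup m' j) + 1"
      unfolding Suc(2) using i by (subst m, simp add: lookup_add sum.distrib lookup_single when_def)
    also have "(\<Sum>j\<in>keys m. lookup m' j) = (\<Sum>j\<in>keys m'. lookup m' j)"
      using sub by (intro sum.mono_neutral_right) (auto simp: in_keys_iff)
    finally have k: "k = (\<Sum>j\<in>keys m'. lookup m' j)" by simp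
    show ?case
    proof
      assume z: "\<forall>v. eval_poly p v = 0"
      \<comment> \<open>The chain rule sums over a finite index set, so \<open>I\<close> collects
        the variables of \<open>p\<close> together with \<open>i\<close>.\<close>
      define I where "I = insert i (\<Union>m\<in>keys p. keys m)"
      have "finite I" "p \<in> polys I" "i \<in> I" by (auto simp: I_def polys_def)
      then have "eval_poly (pd i p) v = 0" for v
        using z by (intro eval_pd_unique[of I]) (auto simp: at0.dlim_const)
      then have "lookup (pd i p) m' = 0" using Suc(1)[OF k] by blast
      then show "lookup p m = 0" by (simp add: lookup_pd m del: of_nat_Suc)
    qed
  qed
  then show "lookup p m = lookup 0 m" using assms by simp
qed

lemma eval_poly_uminus: "eval_poly (- p) v = - eval_poly p v"
  by (simp add: eval_poly_def sum_negf)

lemma polys_eqI: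
  assumes "p \<in> polys I" "q \<in> polys I" "\<And>v. v \<in> cspace I \<Longrightarrow> eval_poly p v = eval_poly q v"
  shows "p = q"
proof -
  have "eval_poly (p + - q) v = 0" for v
  proof -
    let ?w = "\<lambda>i. if i \<in> I then v i else 0"
    have "eval_poly p v = eval_poly p ?w" "eval_poly q v = eval_poly q ?w"
      using assms by (auto intro!: eval_poly_cong)
    moreover have "?w \<in> cspace I" by (auto simp: cspace_def)
    ultimately show ?thesis using assms(3)[of ?w] by (metis add.right_inverse eval_poly_add eval_poly_uminus)
  qed
  then have "p + - q = 0" by (rule eval_poly_eq_0D)
  then show ?thesis by simp
qed

text \<open>Both sides are the derivative at t = 0 of p((1 + t) v) = (1 + t)^d p(v).\<close>

lemma euler:
  assumes "finite I" "p \<in> forms I d"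
  shows "(\<Sum>i\<in>I. eval_poly (pd i p) v * v i) = of_nat d * eval_poly p v"
proof -
  have p: "p \<in> polys I" using assms forms_subset_polys by blast
  have "dlim (at 0) (\<lambda>t. t) (\<lambda>t. eval_poly p (\<lambda>i. v i + t * v i)) (eval_poly p v)
      (\<Sum>i\<in>I. eval_poly (pd i p) v * v i)"
    by (rule at0.dlim_eval_poly[OF assms(1) p]) (rule dlim_line)
  moreover have "eval_poly p (\<lambda>i. v i + t * v i) = (1 + t) ^ d * eval_poly p v" for t
    using eval_forms_scale[OF assms(2), of "1 + t" v] by (simp add: algebra_simps)
  moreover have "((\<lambda>t. (1 + t) ^ d * eval_poly p v) has_field_derivative of_nat d * eval_poly p v) (at (0::complex))"
    by (auto intro!: derivative_eq_intros)
  then have "dlim (at 0) (\<lambda>t. t) (\<lambda>t. (1 + t) ^ d * eval_poly p v) (eval_poly p v) (of_nat d * eval_poly p v)"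
    by (simp add: has_field_derivative_iff dlim_def)
  ultimately show ?thesis using at0.dlim_unique by fastforce
qed

section \<open>Linear algebra over finite index sets\<close>

text \<open>Gaussian elimination: an equation with a nonzero coefficient is used to remove one
  unknown, and a trivial equation is dropped.\<close>

lemma nontrivial_kernel:
  fixes M :: "'i \<Rightarrow> 'j \<Rightarrow> complex"
  assumes "finite J" "finite I" "card J < card I"
  shows "\<exists>c. (\<exists>i\<in>I. c i \<noteq> 0) \<and> (\<forall>j\<in>J. (\<Sum>i\<in>I. c i * M i j) = 0)"
  using assms
proof (induction J arbitrary: I M rule: finite_induct)
  case empty
  then obtain i where "i \<in> I" by fastforce
  then show ?case by (intro exI[of _ "\<lambda>_. 1"]) auto
next
  case (insert j J)
  show ?case
  proof (cases "\<forall>i\<in>I. M i j = 0")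
    case True
    have "card J < card I" using insert by auto
    from insert.IH[OF insert.prems(1) this, of M] show ?thesis using True by auto
  next
    case False
    then obtain i0 where i0: "i0 \<in> I" "M i0 j \<noteq> 0" by blast
    let ?I = "I - {i0}"
    have "finite ?I" "card J < card ?I" using insert i0 by auto
    from insert.IH[OF this, of "\<lambda>i j'. M i j' - M i j / M i0 j * M i0 j'"] obtain c where
      c: "\<exists>i\<in>?I. c i \<noteq> 0" "\<forall>j'\<in>J. (\<Sum>i\<in>?I. c i * (M i j' - M i j / M i0 j * M i0 j')) = 0"
      by blast
    \<comment> \<open>The value at the pivot \<open>i0\<close> is the one that solves equation
      \<open>j\<close>.\<close>
    define c' where "c' = c(i0 := - (\<Sum>i\<in>?I. c i * M i j) / M i0 j)"
    have eq: "(\<Sum>i\<in>I. c' i * M i j') = (\<Sum>i\<in>?I. c i * (M i j' - M i j / M i0 j * M i0 j'))" for j'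
    proof -
      have "(\<Sum>i\<in>I. c' i * M i j') = c' i0 * M i0 j' + (\<Sum>i\<in>?I. c' i * M i j')"
        using insert.prems i0 by (simp add: sum.remove)
      also have "(\<Sum>i\<in>?I. c' i * M i j') = (\<Sum>i\<in>?I. c i * M i j')"
        by (intro sum.cong) (auto simp: c'_def)
      finally show ?thesis using i0
        by (simp add: c'_def algebra_simps sum_subtractf sum_distrib_left sum_divide_distrib)
    qed
    have "(\<Sum>i\<in>I. c' i * M i j') = 0" if "j' \<in> insert j J" for j'
      using that c i0 unfolding eq by auto
    moreover have "\<exists>i\<in>I. c' i \<noteq> 0" using c(1) by (auto simp: c'_def)
    ultimately show ?thesis by blast
  qed
qed

text \<open>Induction on the rows: if the new row does not already vanish on the common kernel of
  the old ones, subtracting a multiple of it makes the functional vanish there.\<close>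

lemma functional_in_row_span:
  fixes R :: "'i \<Rightarrow> 'j \<Rightarrow> complex"
  assumes "finite I" "finite J"
    and "\<And>w. w \<in> cspace J \<Longrightarrow> (\<forall>i\<in>I. (\<Sum>j\<in>J. R i j * w j) = 0) \<Longrightarrow> (\<Sum>j\<in>J. \<phi> j * w j) = 0"
  shows "\<exists>a. \<forall>j\<in>J. \<phi> j = (\<Sum>i\<in>I. a i * R i j)"
  using assms(1,3)
proof (induction I arbitrary: \<phi> rule: finite_induct)
  case empty
  have "\<phi> j = 0" if "j \<in> J" for j
  proof -
    have "(\<Sum>j'\<in>J. \<phi> j' * (if j' = j then 1 else 0)) = 0"
      by (rule empty) (use that in \<open>auto simp: cspace_def\<close>)
    moreover have "(\<Sum>j'\<in>J. \<phi> j' * (if j' = j then 1 else 0)) = (\<Sum>j'\<in>J. if j' = j then \<phi> j' else 0)"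
      by (intro sum.cong) auto
    ultimately show ?thesis using that assms(2) by simp
  qed
  then show ?case by simp
next
  case (insert i I)
  show ?case
  proof (cases "\<forall>w\<in>cspace J. (\<forall>i\<in>I. (\<Sum>j\<in>J. R i j * w j) = 0) \<longrightarrow> (\<Sum>j\<in>J. R i j * w j) = 0")
    case True
    then have "\<exists>a. \<forall>j\<in>J. \<phi> j = (\<Sum>i\<in>I. a i * R i j)"
      by (intro insert.IH insert.prems) auto
    then obtain a where "\<forall>j\<in>J. \<phi> j = (\<Sum>i\<in>I. a i * R i j)" by blast
    moreover have "(\<Sum>i'\<in>I. (a(i := 0)) i' * R i' j) = (\<Sum>i\<in>I. a i * R i j)" for j
      using insert(2) by (intro sum.cong) auto
    ultimately show ?thesis using insert(1,2) by (intro exI[of _ "a(i := 0)"]) simp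
  next
    case False
    then obtain w0 where w0: "w0 \<in> cspace J" "\<forall>i\<in>I. (\<Sum>j\<in>J. R i j * w0 j) = 0" "(\<Sum>j\<in>J. R i j * w0 j) \<noteq> 0"
      by blast
    \<comment> \<open>The multiple is forced, since the corrected functional has to vanish at
      \<open>w0\<close>, where all older rows vanish.\<close>
    define s where "s = (\<Sum>j\<in>J. \<phi> j * w0 j) / (\<Sum>j\<in>J. R i j * w0 j)"
    have "\<exists>a. \<forall>j\<in>J. \<phi> j - s * R i j = (\<Sum>i\<in>I. a i * R i j)"
    proof (rule insert.IH)
      fix w assume w: "w \<in> cspace J" "\<forall>i\<in>I. (\<Sum>j\<in>J. R i j * w j) = 0"
      define u where "u = (\<Sum>j\<in>J. R i j * w j) / (\<Sum>j\<in>J. R i j * w0 j)"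
      let ?w = "\<lambda>j. w j - u * w0 j"
      have lin: "(\<Sum>j\<in>J. g j * ?w j) = (\<Sum>j\<in>J. g j * w j) - u * (\<Sum>j\<in>J. g j * w0 j)" for g
        by (simp add: algebra_simps sum_subtractf sum_distrib_left)
      have "(\<Sum>j\<in>J. \<phi> j * ?w j) = 0"
      proof (rule insert.prems)
        show "?w \<in> cspace J" using w w0 by (auto simp: cspace_def)
        show "\<forall>i'\<in>insert i I. (\<Sum>j\<in>J. R i' j * ?w j) = 0"
          unfolding lin using w w0 by (auto simp: u_def)
      qed
      then have "(\<Sum>j\<in>J. \<phi> j * w j) = s * (\<Sum>j\<in>J. R i j * w j)"
        unfolding lin using w0 by (simp add: u_def s_def)
      then show "(\<Sum>j\<in>J. (\<phi> j - s * R i j) * w j) = 0"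
        by (simp add: algebra_simps sum_subtractf sum_distrib_left)
    qed
    then obtain a where a: "\<forall>j\<in>J. \<phi> j - s * R i j = (\<Sum>i\<in>I. a i * R i j)" by blast
    have "(\<Sum>i'\<in>I. (a(i := s)) i' * R i' j) = (\<Sum>i\<in>I. a i * R i j)" for j
      using insert(2) by (intro sum.cong) auto
    then show ?thesis using insert(1,2) a
      by (intro exI[of _ "a(i := s)"]) (simp add: algebra_simps)
  qed
qed

text \<open>A trivial kernel puts every coordinate functional into the span of the rows; the
  coefficients form the left inverse.\<close>

lemma left_inverse_exists:
  fixes R :: "'i \<Rightarrow> 'j \<Rightarrow> complex"
  assumes "finite I" "finite J"
    and "\<And>w. w \<in> cspace J \<Longrightarrow> (\<forall>i\<in>I. (\<Sum>j\<in>J. R i j * w j) = 0) \<Longrightarrow> w = (\<lambda>_. 0)"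
  shows "\<exists>a. \<forall>k\<in>J. \<forall>l\<in>J. (\<Sum>i\<in>I. a k i * R i l) = (if l = k then 1 else 0)"
proof -
  have "\<exists>a. \<forall>j\<in>J. (if j = k then 1 else 0) = (\<Sum>i\<in>I. a i * R i j)" for k
    by (rule functional_in_row_span[OF assms(1,2)]) (use assms(3) in fastforce)
  then obtain a where "\<And>k. \<forall>j\<in>J. (if j = k then 1 else 0) = (\<Sum>i\<in>I. a k i * R i j)" by metis
  then show ?thesis by (intro exI[of _ a]) auto
qed

text \<open>If \<open>w i\<close> is nonzero, counting gives a nonzero \<open>l\<close> that kills
  all the other vectors. The relation makes it kill the remaining one as well, against
  spanning.\<close>

lemma spanning_imp_independent:
  fixes p :: "'i \<Rightarrow> 'j \<Rightarrow> complex"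
  assumes "finite I" "finite J" "card I = card J"
    and span: "\<And>l. l \<in> cspace J \<Longrightarrow> (\<forall>i\<in>I. (\<Sum>j\<in>J. l j * p i j) = 0) \<Longrightarrow> l = (\<lambda>_. 0)"
    and w: "\<forall>j\<in>J. (\<Sum>i\<in>I. w i * p i j) = 0" and i: "i \<in> I"
  shows "w i = 0"
proof (rule ccontr)
  assume nz: "w i \<noteq> 0"
  let ?I = "I - {i}"
  have "card ?I < card J" using assms(1,3) i by (metis card_Diff1_less)
  from nontrivial_kernel[OF _ assms(2) this, of "\<lambda>j i. p i j"] assms(1) obtain c where
    c: "\<exists>j\<in>J. c j \<noteq> 0" "\<forall>k\<in>?I. (\<Sum>j\<in>J. c j * p k j) = 0" by auto
  define l where "l j = (if j \<in> J then c j else 0)" for j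
  have lc: "(\<Sum>j\<in>J. l j * p k j) = (\<Sum>j\<in>J. c j * p k j)" for k
    by (intro sum.cong) (auto simp: l_def)
  have "(\<Sum>k\<in>I. w k * (\<Sum>j\<in>J. l j * p k j)) = (\<Sum>k\<in>I. \<Sum>j\<in>J. l j * (w k * p k j))"
    by (simp add: sum_distrib_left algebra_simps)
  also have "\<dots> = (\<Sum>j\<in>J. \<Sum>k\<in>I. l j * (w k * p k j))" by (rule sum.swap)
  also have "\<dots> = (\<Sum>j\<in>J. l j * (\<Sum>k\<in>I. w k * p k j))"
    by (simp add: sum_distrib_left)
  also have "\<dots> = 0" using w by simp
  finally have 0: "(\<Sum>k\<in>I. w k * (\<Sum>j\<in>J. l j * p k j)) = 0" .
  have "(\<Sum>k\<in>I. w k * (\<Sum>j\<in>J. l j * p k j)) = w i * (\<Sum>j\<in>J. l j * p i j)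
      + (\<Sum>k\<in>?I. w k * (\<Sum>j\<in>J. l j * p k j))"
    using assms(1) i by (simp add: sum.remove)
  also have "(\<Sum>k\<in>?I. w k * (\<Sum>j\<in>J. l j * p k j)) = 0"
    using c(2) by (intro sum.neutral) (auto simp: lc)
  finally have "(\<Sum>j\<in>J. l j * p i j) = 0" using 0 nz by simp
  then have "l = (\<lambda>_. 0)" using c(2) by (intro span) (auto simp: lc l_def cspace_def)
  then show False using c(1) by (metis l_def)
qed

section \<open>Functions that are polynomial along lines\<close>

text \<open>Polynomials enter the counting argument only through their restrictions to lines and a
  degree bound. In this form a composite such as B -> f(Bx) needs no explicit expansion.\<close>

definition linepoly :: "nat \<Rightarrow> (('k \<Rightarrow> complex) \<Rightarrow> complex) \<Rightarrow> bool" where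
  "linepoly D F \<longleftrightarrow> (\<forall>a b. \<exists>p. degree p \<le> D \<and> (\<forall>t. F (\<lambda>k. a k + t * b k) = poly p t))"

lemma linepoly_mono: "linepoly D F \<Longrightarrow> D \<le> E \<Longrightarrow> linepoly E F"
  unfolding linepoly_def by (meson order_trans)

lemma linepoly_const: "linepoly D (\<lambda>_. c)"
  unfolding linepoly_def by (intro allI exI[of _ "[:c:]"]) auto

lemma linepoly_proj: "linepoly 1 (\<lambda>v. v k)"
  unfolding linepoly_def
proof (intro allI)
  fix a b :: "'a \<Rightarrow> complex"
  show "\<exists>p. degree p \<le> 1 \<and> (\<forall>t. a k + t * b k = poly p t)"
    by (intro exI[of _ "[:a k, b k:]"]) (auto intro: degree_pCons_le[THEN order_trans])
qed

lemma linepoly_add: "linepoly D F \<Longrightarrow> linepoly D G \<Longrightarrow> linepoly D (\<lambda>v. F v + G v)"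
  unfolding linepoly_def
proof (intro allI)
  fix a b :: "'a \<Rightarrow> complex"
  assume "\<forall>a b. \<exists>p. degree p \<le> D \<and> (\<forall>t. F (\<lambda>k. a k + t * b k) = poly p t)"
    "\<forall>a b. \<exists>p. degree p \<le> D \<and> (\<forall>t. G (\<lambda>k. a k + t * b k) = poly p t)"
  then obtain p q where "degree p \<le> D" "degree q \<le> D" "\<forall>t. F (\<lambda>k. a k + t * b k) = poly p t"
    "\<forall>t. G (\<lambda>k. a k + t * b k) = poly q t" by blast
  then show "\<exists>p. degree p \<le> D \<and> (\<forall>t. F (\<lambda>k. a k + t * b k) + G (\<lambda>k. a k + t * b k) = poly p t)"
    by (intro exI[of _ "p + q"]) (auto intro: degree_add_le)
qed

lemma linepoly_mult: "linepoly D F \<Longrightarrow> linepoly E G \<Longrightarrow> linepoly (D + E) (\<lambda>v. F v * G v)"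
  unfolding linepoly_def
proof (intro allI)
  fix a b :: "'a \<Rightarrow> complex"
  assume "\<forall>a b. \<exists>p. degree p \<le> D \<and> (\<forall>t. F (\<lambda>k. a k + t * b k) = poly p t)"
    "\<forall>a b. \<exists>p. degree p \<le> E \<and> (\<forall>t. G (\<lambda>k. a k + t * b k) = poly p t)"
  then obtain p q where "degree p \<le> D" "degree q \<le> E" "\<forall>t. F (\<lambda>k. a k + t * b k) = poly p t"
    "\<forall>t. G (\<lambda>k. a k + t * b k) = poly q t" by blast
  then show "\<exists>p. degree p \<le> D + E \<and> (\<forall>t. F (\<lambda>k. a k + t * b k) * G (\<lambda>k. a k + t * b k) = poly p t)"
    by (intro exI[of _ "p * q"]) (auto intro: degree_mult_le[THEN order_trans])
qed

lemma linepoly_cmult: "linepoly D F \<Longrightarrow> linepoly D (\<lambda>v. c * F v)"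
  using linepoly_mult[OF linepoly_const[of 0 c], of D F] by simp

lemma linepoly_sum: "(\<And>x. x \<in> A \<Longrightarrow> linepoly D (F x)) \<Longrightarrow> linepoly D (\<lambda>v. \<Sum>x\<in>A. F x v)"
  by (induction A rule: infinite_finite_induct) (auto intro: linepoly_const linepoly_add)

lemma linepoly_prod:
  "(\<And>x. x \<in> A \<Longrightarrow> linepoly (D x) (F x)) \<Longrightarrow> linepoly (\<Sum>x\<in>A. D x) (\<lambda>v. \<Prod>x\<in>A. F x v)"
  by (induction A rule: infinite_finite_induct) (auto intro: linepoly_const linepoly_mult)

lemma linepoly_power: "linepoly D F \<Longrightarrow> linepoly (k * D) (\<lambda>v. F v ^ k)"
  by (induction k) (auto intro: linepoly_const linepoly_mult)

lemma linepoly_comp_linear: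
  assumes "linepoly D F" "\<And>i a b t. T (\<lambda>k. a k + t * b k) i = T a i + t * T b i"
  shows "linepoly D (\<lambda>v. F (T v))"
  unfolding linepoly_def
proof (intro allI)
  fix a b
  have "T (\<lambda>k. a k + t * b k) = (\<lambda>i. T a i + t * T b i)" for t using assms(2) by auto
  then show "\<exists>p. degree p \<le> D \<and> (\<forall>t. F (T (\<lambda>k. a k + t * b k)) = poly p t)"
    using assms(1)[unfolded linepoly_def, rule_format, of "T a" "T b"] by simp
qed

lemma linepoly_eval_comp:
  assumes "p \<in> polys I" "\<And>i. i \<in> I \<Longrightarrow> \<exists>E. linepoly E (G i)"
  shows "\<exists>E. linepoly E (\<lambda>v. eval_poly p (\<lambda>i. G i v))"
  using assms(1)
proof (induction rule: polys_induct)
  case (Const c)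
  then show ?case using linepoly_const[of 0 c] by auto
next
  case (Var i)
  then show ?case using assms(2) by auto
next
  case (add p q)
  then obtain D E where "linepoly D (\<lambda>v. eval_poly p (\<lambda>i. G i v))" "linepoly E (\<lambda>v. eval_poly q (\<lambda>i. G i v))" by blast
  then have "linepoly (max D E) (\<lambda>v. eval_poly p (\<lambda>i. G i v) + eval_poly q (\<lambda>i. G i v))"
    by (intro linepoly_add) (auto elim: linepoly_mono)
  then show ?case by (auto simp: eval_poly_add)
next
  case (mult p q)
  then show ?case by (auto simp: eval_poly_mult dest: linepoly_mult)
qed

lemma linepoly_eval_poly: "\<exists>D. linepoly D (eval_poly p)"
  using linepoly_eval_comp[of p UNIV "\<lambda>i v. v i"] linepoly_proj by (fastforce simp: polys_def)

text \<open>Coordinates are released from the grid one at a time: along one coordinate the function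
  is a polynomial of degree at most \<open>D\<close> with \<open>D + 1\<close> roots.\<close>

lemma linepoly_zero_on_grid:
  assumes "finite K" "linepoly D F"
    and grid: "\<And>v. v \<in> cspace K \<Longrightarrow> (\<forall>k\<in>K. v k \<in> of_nat ` {..D}) \<Longrightarrow> F v = 0"
    and v: "v \<in> cspace K"
  shows "F v = 0"
proof -
  \<comment> \<open>\<open>A\<close> holds the coordinates that are already arbitrary.\<close>
  have "\<forall>v\<in>cspace K. (\<forall>k\<in>K - A. v k \<in> of_nat ` {..D}) \<longrightarrow> F v = 0" if "finite A" "A \<subseteq> K" for A
    using that
  proof (induction A rule: finite_induct)
    case empty
    then show ?case using grid by auto
  next
    case (insert k A)
    show ?case
    proof (intro ballI impI)
      fix v assume v: "v \<in> cspace K" "\<forall>j\<in>K - insert k A. v j \<in> of_nat ` {..D}"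
      obtain p where p: "degree p \<le> D"
        "\<And>t. F (\<lambda>j. (v(k := 0)) j + t * (if j = k then 1 else 0)) = poly p t"
        using assms(2)[unfolded linepoly_def, rule_format, of "v(k := 0)" "\<lambda>j. if j = k then 1 else 0"] by blast
      have F: "F (v(k := t)) = poly p t" for t
      proof -
        have "(\<lambda>j. (v(k := 0)) j + t * (if j = k then 1 else 0)) = v(k := t)" by auto
        then show ?thesis using p(2)[of t] by simp
      qed
      have "poly p (of_nat i) = 0" if "i \<le> D" for i
      proof -
        have "F (v(k := of_nat i)) = 0"
          using insert v that by (auto simp: cspace_def)
        then show ?thesis using F by simp
      qed
      then have sub: "of_nat ` {..D} \<subseteq> {t. poly p t = 0}" by auto
      have "p = 0"
      proof (rule ccontr)
        assume "p \<noteq> 0"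
        then have "card (of_nat ` {..D} :: complex set) \<le> card {t. poly p t = 0}"
          using sub by (intro card_mono poly_roots_finite)
        also have "\<dots> \<le> degree p" using \<open>p \<noteq> 0\<close> by (rule card_poly_roots_bound)
        finally have "card (of_nat ` {..D} :: complex set) \<le> degree p" .
        moreover have "card (of_nat ` {..D} :: complex set) = Suc D"
          by (subst card_image) (auto simp: inj_on_def)
        ultimately show False using p(1) by simp
      qed
      then show "F v = 0" using F[of "v k"] by simp
    qed
  qed
  from this[of K] show ?thesis using assms(1) v by auto
qed

text \<open>A line joins a point that is good for the old functions to one that is good for the new
  function. Along it each of them has only finitely many zeros.\<close>

lemma linepoly_common_nonzero:
  fixes F :: "'x \<Rightarrow> ('k \<Rightarrow> complex) \<Rightarrow> complex"
  assumes "finite A" "\<And>x. x \<in> A \<Longrightarrow> linepoly (D x) (F x)"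
    and "\<And>x. x \<in> A \<Longrightarrow> \<exists>v\<in>cspace K. F x v \<noteq> 0"
  shows "\<exists>v\<in>cspace K. \<forall>x\<in>A. F x v \<noteq> 0"
  using assms
proof (induction A rule: finite_induct)
  case empty
  have "(\<lambda>_. 0) \<in> cspace K" by (auto simp: cspace_def)
  then show ?case by auto
next
  case (insert x A)
  then obtain u where u: "u \<in> cspace K" "\<forall>x\<in>A. F x u \<noteq> 0" by auto
  from insert.prems(2)[of x] obtain w where w: "w \<in> cspace K" "F x w \<noteq> 0" by auto
  define l where "l t = (\<lambda>k. u k + t * (w k - u k))" for t
  have l: "l 0 = u" "l 1 = w" "l t \<in> cspace K" for t using u w by (auto simp: l_def cspace_def)
  have fin: "finite {t. F y (l t) = 0}" if "y \<in> insert x A" for y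
  proof -
    have "linepoly (D y) (F y)" using insert.prems(1) that by blast
    from this[unfolded linepoly_def, rule_format, of u "\<lambda>k. w k - u k"]
    obtain p where p: "\<And>t. F y (l t) = poly p t"
      unfolding l_def by blast
    have "poly p 0 \<noteq> 0 \<or> poly p 1 \<noteq> 0" using that u w l p[of 0] p[of 1] by auto
    then have "p \<noteq> 0" by auto
    then show ?thesis using p by (simp add: poly_roots_finite)
  qed
  have "finite (\<Union>y\<in>insert x A. {t. F y (l t) = 0})" using fin insert(1) by blast
  then obtain t where "t \<notin> (\<Union>y\<in>insert x A. {t. F y (l t) = 0})"
    using ex_new_if_finite[OF infinite_UNIV_char_0] by blast
  then show ?case using l(3)[of t] by auto
qed

text \<open>Induction on the variables: for fixed values of the others, the sum is a polynomial in
  the new variable, so each of its coefficients vanishes.\<close>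

lemma monomial_sum_zero:
  fixes c :: "('k \<Rightarrow> nat) \<Rightarrow> complex"
  assumes "finite K"
    and "\<And>w. w \<in> cspace K \<Longrightarrow> (\<Sum>\<alpha>\<in>PiE K (\<lambda>_. {..<s}). c \<alpha> * (\<Prod>k\<in>K. w k ^ \<alpha> k)) = 0"
    and "\<alpha> \<in> PiE K (\<lambda>_. {..<s})"
  shows "c \<alpha> = 0"
  using assms
proof (induction K arbitrary: c \<alpha> rule: finite_induct)
  case empty
  from empty(1)[of "\<lambda>_. 0"] empty(2) show ?case by (auto simp: cspace_def)
next
  case (insert k K)
  let ?P = "PiE K (\<lambda>_. {..<s})"
  have inj: "inj_on (\<lambda>(y, g). g(k := y)) ({..<s} \<times> ?P)"
    using inj_combinator[OF insert(2), of "\<lambda>_. {..<s}"] .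
  have exp: "(\<Sum>\<alpha>\<in>PiE (insert k K) (\<lambda>_. {..<s}). c \<alpha> * (\<Prod>j\<in>insert k K. w j ^ \<alpha> j))
      = (\<Sum>i<s. (\<Sum>\<beta>\<in>?P. c (\<beta>(k := i)) * (\<Prod>j\<in>K. w j ^ \<beta> j)) * w k ^ i)" for w
  proof -
    have "(\<Sum>\<alpha>\<in>PiE (insert k K) (\<lambda>_. {..<s}). c \<alpha> * (\<Prod>j\<in>insert k K. w j ^ \<alpha> j))
      = (\<Sum>(i, \<beta>)\<in>{..<s} \<times> ?P. c (\<beta>(k := i)) * (\<Prod>j\<in>insert k K. w j ^ (\<beta>(k := i)) j))"
      unfolding PiE_insert_eq by (subst sum.reindex[OF inj]) (auto simp: case_prod_beta)
    also have "\<dots> = (\<Sum>(i, \<beta>)\<in>{..<s} \<times> ?P. c (\<beta>(k := i)) * (\<Prod>j\<in>K. w j ^ \<beta> j) * w k ^ i)"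
    proof (intro sum.cong refl, clarify)
      fix i \<beta>
      have "(\<Prod>j\<in>K. w j ^ (\<beta>(k := i)) j) = (\<Prod>j\<in>K. w j ^ \<beta> j)"
        using insert(2) by (intro prod.cong) auto
      then show "c (\<beta>(k := i)) * (\<Prod>j\<in>insert k K. w j ^ (\<beta>(k := i)) j)
          = c (\<beta>(k := i)) * (\<Prod>j\<in>K. w j ^ \<beta> j) * w k ^ i"
        using insert(1,2) by simp
    qed
    finally show ?thesis by (simp add: sum.cartesian_product[symmetric] sum_distrib_right)
  qed
  obtain i \<beta> where a: "\<alpha> = \<beta>(k := i)" "i < s" "\<beta> \<in> ?P"
    using insert.prems(2) by (auto simp: PiE_insert_eq)
  have "c (\<beta>(k := i)) = 0"
  proof (rule insert.IH[of "\<lambda>\<beta>. c (\<beta>(k := i))"])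
    fix w assume w: "w \<in> cspace K"
    define g where "g i = (\<Sum>\<beta>\<in>?P. c (\<beta>(k := i)) * (\<Prod>j\<in>K. w j ^ \<beta> j))" for i
    have "(\<Sum>i<s. g i * t ^ i) = 0" for t
    proof -
      have "(\<Prod>j\<in>K. (w(k := t)) j ^ \<beta> j) = (\<Prod>j\<in>K. w j ^ \<beta> j)" for \<beta>
        using insert(2) by (intro prod.cong) auto
      then have "(\<Sum>i<s. g i * t ^ i) = (\<Sum>\<alpha>\<in>PiE (insert k K) (\<lambda>_. {..<s}). c \<alpha> * (\<Prod>j\<in>insert k K. (w(k := t)) j ^ \<alpha> j))"
        unfolding exp by (simp add: g_def)
      also have "\<dots> = 0" using w by (intro insert.prems) (auto simp: cspace_def)
      finally show ?thesis .
    qed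
    then have "\<forall>t. poly (\<Sum>i<s. monom (g i) i) t = 0" by (simp add: poly_sum poly_monom)
    then have "(\<Sum>i<s. monom (g i) i) = 0" using poly_all_0_iff_0 by blast
    then have "coeff (\<Sum>i<s. monom (g i) i) i = 0" by simp
    then show "g i = 0" using a(2) by (simp add: coeff_sum)
  qed (rule a)
  then show ?case by (simp only: a)
qed

section \<open>Generic finiteness from an injective differential\<close>

lemma cspace_box:
  assumes "finite K" "\<And>k. k \<in> K \<Longrightarrow> finite (R k)"
  shows "finite {v \<in> cspace K. \<forall>k\<in>K. v k \<in> R k}" (is "finite ?B")
    and "card {v \<in> cspace K. \<forall>k\<in>K. v k \<in> R k} \<le> (\<Prod>k\<in>K. card (R k))"
proof -
  have sub: "?B \<subseteq> (\<lambda>g k. if k \<in> K then g k else 0) ` PiE K R"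
  proof
    fix v assume v: "v \<in> ?B"
    then have "v = (\<lambda>k. if k \<in> K then restrict v K k else 0)" by (auto simp: cspace_def)
    moreover have "restrict v K \<in> PiE K R" using v by auto
    ultimately show "v \<in> (\<lambda>g k. if k \<in> K then g k else 0) ` PiE K R" by blast
  qed
  have fin: "finite (PiE K R)" using assms by (intro finite_PiE) auto
  then show "finite ?B" using sub finite_surj by blast
  show "card ?B \<le> (\<Prod>k\<in>K. card (R k))"
    using surj_card_le[OF fin sub] card_PiE[OF assms(1), of R] by simp
qed

text \<open>With exponents below \<open>s\<close> there are \<open>s\<^sup>N\<^sup>+\<^sup>1\<close> unknown coefficients but, since vanishing can be tested on a grid, only
  \<open>O(s\<^sup>N)\<close> linear conditions.\<close>

lemma algebraic_dependence:
  fixes \<xi> :: "'k \<Rightarrow> ('k \<Rightarrow> complex) \<Rightarrow> complex"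
  assumes K: "finite K" and lin: "\<And>l. l \<in> K \<Longrightarrow> linepoly D (\<xi> l)"
  shows "\<exists>s c. (\<exists>i<s. \<exists>\<alpha>\<in>PiE K (\<lambda>_. {..<s}). c i \<alpha> \<noteq> 0) \<and>
    (\<forall>v\<in>cspace K. (\<Sum>i<s. \<Sum>\<alpha>\<in>PiE K (\<lambda>_. {..<s}). c i \<alpha> * (v k0 ^ i * (\<Prod>l\<in>K. \<xi> l v ^ \<alpha> l))) = 0)"
proof -
  define N where "N = card K"
  \<comment> \<open>The grid will have at most s^N (2 + N D)^N points, so it is enough that
    \<open>s\<close> exceeds the second factor.\<close>
  define s where "s = Suc ((2 + N * D) ^ N)"
  \<comment> \<open>Along a line, a term of the relation gets degree at most \<open>s\<close> from
    the power of \<open>v k0\<close> and at most \<open>N * (s * D)\<close> from the product of the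
    \<open>\<xi> l\<close>.\<close>
  define E where "E = s + N * (s * D)"
  let ?P = "PiE K (\<lambda>_. {..<s})"
  define G where "G = {v \<in> cspace K. \<forall>k\<in>K. v k \<in> (of_nat ` {..E} :: complex set)}"
  define trm where "trm i \<alpha> v = v k0 ^ i * (\<Prod>l\<in>K. \<xi> l v ^ \<alpha> l)" for i \<alpha> v
  have G: "finite G" "card G \<le> (\<Prod>k\<in>K. card (of_nat ` {..E} :: complex set))"
    unfolding G_def using cspace_box[OF K, of "\<lambda>_. of_nat ` {..E}"] by auto
  have "card (of_nat ` {..E} :: complex set) = Suc E"
    by (subst card_image) (auto simp: inj_on_def)
  then have "card G \<le> Suc E ^ N" using G(2) by (simp add: N_def)
  also have "Suc E \<le> s * (2 + N * D)" by (simp add: E_def s_def algebra_simps)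
  then have "Suc E ^ N \<le> s ^ N * (2 + N * D) ^ N"
    by (metis power_mono power_mult_distrib zero_le)
  also have "\<dots> < s ^ N * s" by (simp add: s_def)
  also have "\<dots> = card ({..<s} \<times> ?P)"
    using K by (simp add: card_cartesian_product card_PiE N_def)
  finally have card: "card G < card ({..<s} \<times> ?P)" .
  have finP: "finite ?P" using K by (intro finite_PiE) auto
  obtain c where c: "\<exists>x\<in>{..<s} \<times> ?P. c x \<noteq> 0"
    "\<forall>v\<in>G. (\<Sum>x\<in>{..<s} \<times> ?P. c x * trm (fst x) (snd x) v) = 0"
    using nontrivial_kernel[OF G(1) _ card, of "\<lambda>x. trm (fst x) (snd x)"] finP by auto
  define S where "S v = (\<Sum>i<s. \<Sum>\<alpha>\<in>?P. c (i, \<alpha>) * trm i \<alpha> v)" for v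
  have S: "S v = (\<Sum>x\<in>{..<s} \<times> ?P. c x * trm (fst x) (snd x) v)" for v
    unfolding S_def by (simp add: sum.cartesian_product case_prod_beta)
  have "linepoly E S"
    unfolding S_def
  proof (intro linepoly_sum linepoly_cmult)
    fix i \<alpha> assume i: "i \<in> {..<s}" and \<alpha>: "\<alpha> \<in> ?P"
    have "linepoly (i * 1 + (\<Sum>l\<in>K. \<alpha> l * D)) (trm i \<alpha>)"
      unfolding trm_def[abs_def]
      by (intro linepoly_mult linepoly_power linepoly_prod lin linepoly_proj)
    moreover have "(\<Sum>l\<in>K. \<alpha> l * D) \<le> (\<Sum>l\<in>K. s * D)"
      using \<alpha> by (intro sum_mono mult_le_mono1) (auto simp: PiE_def Pi_def intro: less_imp_le)
    ultimately show "linepoly E (trm i \<alpha>)"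
      using i by (elim linepoly_mono) (auto simp: E_def N_def)
  qed
  then have "S v = 0" if "v \<in> cspace K" for v
    by (rule linepoly_zero_on_grid[OF K _ _ that]) (use c(2) in \<open>auto simp: S G_def\<close>)
  then show ?thesis
    using c(1) unfolding S_def trm_def
    by (intro exI[of _ s] exI[of _ "\<lambda>i \<alpha>. c (i, \<alpha>)"]) auto
qed

text \<open>Substituting \<open>b + t w\<close> and letting \<open>t \<rightarrow> 0\<close> isolates the part of lowest degree \<open>e\<close> of the alleged relation.\<close>

lemma algebraic_independence:
  fixes \<xi> :: "'k \<Rightarrow> ('k \<Rightarrow> complex) \<Rightarrow> complex"
  assumes K: "finite K" and b: "b \<in> cspace K"
    and lim: "\<And>k w. k \<in> K \<Longrightarrow> w \<in> cspace K \<Longrightarrow> ((\<lambda>t. \<xi> k (\<lambda>l. b l + t * w l) / t) \<longlongrightarrow> w k) (at 0)"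
    and c: "\<beta> \<in> PiE K (\<lambda>_. {..<s})" "c \<beta> \<noteq> 0"
  shows "\<exists>v\<in>cspace K. (\<Sum>\<alpha>\<in>PiE K (\<lambda>_. {..<s}). c \<alpha> * (\<Prod>l\<in>K. \<xi> l v ^ \<alpha> l)) \<noteq> 0"
proof (rule ccontr)
  let ?P = "PiE K (\<lambda>_. {..<s})"
  assume "\<not> ?thesis"
  then have z: "\<And>v. v \<in> cspace K \<Longrightarrow> (\<Sum>\<alpha>\<in>?P. c \<alpha> * (\<Prod>l\<in>K. \<xi> l v ^ \<alpha> l)) = 0" by blast
  \<comment> \<open>The total degree of the lowest part of the relation.\<close>
  define e where "e = (LEAST e. \<exists>\<alpha>\<in>?P. c \<alpha> \<noteq> 0 \<and> sum \<alpha> K = e)"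
  have ex: "\<exists>e. \<exists>\<alpha>\<in>?P. c \<alpha> \<noteq> 0 \<and> sum \<alpha> K = e" using c by blast
  obtain \<gamma> where \<gamma>: "\<gamma> \<in> ?P" "c \<gamma> \<noteq> 0" "sum \<gamma> K = e"
    using LeastI_ex[OF ex] unfolding e_def by blast
  have least: "e \<le> sum \<alpha> K" if "\<alpha> \<in> ?P" "c \<alpha> \<noteq> 0" for \<alpha>
    unfolding e_def using that by (intro Least_le) auto
  define c' where "c' \<alpha> = (if sum \<alpha> K = e then c \<alpha> else 0)" for \<alpha>
  have "c' \<gamma> = 0"
  proof (rule monomial_sum_zero[OF K _ \<gamma>(1)])
    fix w assume w: "w \<in> cspace K"
    define l where "l t = (\<lambda>k. b k + t * w k)" for t
    \<comment> \<open>The relation along the line through \<open>b\<close>, divided by t^e. Each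
      \<open>\<xi> k\<close> is of order t, so only the terms of total degree \<open>e\<close>
      survive in the limit.\<close>
    define h where "h t = (\<Sum>\<alpha>\<in>?P. c \<alpha> * (t ^ (sum \<alpha> K - e) * (\<Prod>k\<in>K. (\<xi> k (l t) / t) ^ \<alpha> k)))" for t
    have "(h \<longlongrightarrow> (\<Sum>\<alpha>\<in>?P. c \<alpha> * (0 ^ (sum \<alpha> K - e) * (\<Prod>k\<in>K. w k ^ \<alpha> k)))) (at 0)"
      unfolding h_def l_def using lim w by (intro tendsto_intros) auto
    also have "(\<Sum>\<alpha>\<in>?P. c \<alpha> * (0 ^ (sum \<alpha> K - e) * (\<Prod>k\<in>K. w k ^ \<alpha> k)))
        = (\<Sum>\<alpha>\<in>?P. c' \<alpha> * (\<Prod>k\<in>K. w k ^ \<alpha> k))"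
      using least by (intro sum.cong refl) (fastforce simp: c'_def power_0_left)
    finally have lim1: "(h \<longlongrightarrow> (\<Sum>\<alpha>\<in>?P. c' \<alpha> * (\<Prod>k\<in>K. w k ^ \<alpha> k))) (at 0)" .
    have "h t = 0" if "t \<noteq> 0" for t
    proof -
      have "t ^ e * h t = (\<Sum>\<alpha>\<in>?P. c \<alpha> * (\<Prod>k\<in>K. \<xi> k (l t) ^ \<alpha> k))"
        unfolding h_def sum_distrib_left
      proof (intro sum.cong refl)
        fix \<alpha> assume "\<alpha> \<in> ?P"
        show "t ^ e * (c \<alpha> * (t ^ (sum \<alpha> K - e) * (\<Prod>k\<in>K. (\<xi> k (l t) / t) ^ \<alpha> k))) = c \<alpha> * (\<Prod>k\<in>K. \<xi> k (l t) ^ \<alpha> k)"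
        proof (cases "c \<alpha> = 0")
          case False
          then have "e \<le> sum \<alpha> K" using least \<open>\<alpha> \<in> ?P\<close> by blast
          then have "t ^ e * t ^ (sum \<alpha> K - e) = t ^ sum \<alpha> K" by (simp flip: power_add)
          moreover have "(\<Prod>k\<in>K. (\<xi> k (l t) / t) ^ \<alpha> k) * t ^ sum \<alpha> K = (\<Prod>k\<in>K. \<xi> k (l t) ^ \<alpha> k)"
            using that K by (simp add: power_divide prod_dividef power_sum[symmetric] flip: power_sum)
          ultimately show ?thesis by (metis (no_types, lifting) mult.assoc mult.commute)
        qed simp
      qed
      also have "\<dots> = 0" using b w by (intro z) (auto simp: l_def cspace_def)
      finally show ?thesis using that by simp
    qed
    then have "eventually (\<lambda>t. h t = 0) (at 0)" by (auto simp: eventually_at_filter)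
    then have "(h \<longlongrightarrow> 0) (at 0)" by (simp add: tendsto_cong)
    then show "(\<Sum>\<alpha>\<in>?P. c' \<alpha> * (\<Prod>k\<in>K. w k ^ \<alpha> k)) = 0"
      using tendsto_unique[OF _ lim1] by auto
  qed
  then show False using \<gamma> by (simp add: c'_def)
qed

text \<open>A left inverse of the Jacobian at \<open>b\<close> produces combinations of the values
  that are the identity to first order, hence algebraically independent. Every coordinate depends
  algebraically on them, so where a suitable coefficient is nonzero it has only finitely many
  candidates.\<close>

lemma generic_finite_fibres:
  fixes \<psi> :: "'x \<Rightarrow> ('k \<Rightarrow> complex) \<Rightarrow> complex"
  assumes K: "finite K" and X: "finite X"
    and lin: "\<And>x. x \<in> X \<Longrightarrow> linepoly D (\<psi> x)"
    and b: "b \<in> cspace K"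
    and der: "\<And>x w. x \<in> X \<Longrightarrow> w \<in> cspace K \<Longrightarrow>
      dlim (at 0) (\<lambda>t. t) (\<lambda>t. \<psi> x (\<lambda>k. b k + t * w k)) (\<psi> x b) (\<Sum>k\<in>K. J x k * w k)"
    and inj: "\<And>w. w \<in> cspace K \<Longrightarrow> (\<forall>x\<in>X. (\<Sum>k\<in>K. J x k * w k) = 0) \<Longrightarrow> w = (\<lambda>_. 0)"
  shows "\<exists>P\<in>polys X. (\<exists>v\<in>cspace K. eval_poly P (\<lambda>x. \<psi> x v) \<noteq> 0) \<and>
    (\<forall>z. eval_poly P z \<noteq> 0 \<longrightarrow> finite {v \<in> cspace K. \<forall>x\<in>X. \<psi> x v = z x})"
proof -
  obtain a where a: "\<forall>k\<in>K. \<forall>l\<in>K. (\<Sum>x\<in>X. a k x * J x l) = (if l = k then 1 else 0)"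
    using left_inverse_exists[OF X K inj] by blast
  \<comment> \<open>\<open>\<zeta> k\<close> acts on arbitrary values \<open>z\<close>, so the
    relations can be read over any target and not only over attained ones.\<close>
  define \<zeta> where "\<zeta> k z = (\<Sum>x\<in>X. a k x * (z x - \<psi> x b))" for k z
  define \<xi> where "\<xi> k v = \<zeta> k (\<lambda>x. \<psi> x v)" for k v
  have \<xi>lin: "linepoly D (\<xi> k)" for k
  proof -
    have "linepoly D (\<lambda>v. \<Sum>x\<in>X. a k x * (\<psi> x v + - \<psi> x b))"
      by (intro linepoly_sum linepoly_cmult linepoly_add lin linepoly_const)
    then show ?thesis by (simp add: \<xi>_def[abs_def] \<zeta>_def)
  qed
  have \<xi>lim: "((\<lambda>t. \<xi> k (\<lambda>l. b l + t * w l) / t) \<longlongrightarrow> w k) (at 0)" if k: "k \<in> K" and w: "w \<in> cspace K" for k w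
  proof -
    have "dlim (at 0) (\<lambda>t. t) (\<lambda>t. \<Sum>x\<in>X. a k x * (\<psi> x (\<lambda>l. b l + t * w l) + - \<psi> x b))
        (\<Sum>x\<in>X. a k x * (\<psi> x b + - \<psi> x b)) (\<Sum>x\<in>X. a k x * ((\<Sum>l\<in>K. J x l * w l) + 0))"
      by (intro at0.dlim_sum at0.dlim_cmult at0.dlim_add at0.dlim_const der w)
    moreover have "(\<Sum>x\<in>X. a k x * ((\<Sum>l\<in>K. J x l * w l) + 0)) = w k"
    proof -
      have "(\<Sum>x\<in>X. a k x * ((\<Sum>l\<in>K. J x l * w l) + 0)) = (\<Sum>x\<in>X. \<Sum>l\<in>K. a k x * J x l * w l)"
        by (simp add: sum_distrib_left mult.assoc)
      also have "\<dots> = (\<Sum>l\<in>K. (\<Sum>x\<in>X. a k x * J x l) * w l)"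
        by (subst sum.swap) (simp add: sum_distrib_right)
      also have "\<dots> = (\<Sum>l\<in>K. if l = k then w l else 0)"
        using a k by (intro sum.cong) auto
      finally show ?thesis using k K by simp
    qed
    ultimately show ?thesis by (simp add: dlim_def \<xi>_def \<zeta>_def)
  qed
  have "\<exists>Q. Q \<in> polys X \<and> (\<exists>v\<in>cspace K. eval_poly Q (\<lambda>x. \<psi> x v) \<noteq> 0) \<and>
      (\<forall>z. eval_poly Q z \<noteq> 0 \<longrightarrow> (\<exists>R. finite R \<and> (\<forall>v\<in>cspace K. (\<forall>x\<in>X. \<psi> x v = z x) \<longrightarrow> v k \<in> R)))" for k
  proof -
    obtain s c where sc: "(\<exists>i<s. \<exists>\<alpha>\<in>PiE K (\<lambda>_. {..<s}). c i \<alpha> \<noteq> 0) \<and>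
      (\<forall>v\<in>cspace K. (\<Sum>i<s. \<Sum>\<alpha>\<in>PiE K (\<lambda>_. {..<s}). c i \<alpha> * (v k ^ i * (\<Prod>l\<in>K. \<xi> l v ^ \<alpha> l))) = 0)"
      using algebraic_dependence[where \<xi> = \<xi> and D = D and ?k0.0 = k, OF K \<xi>lin]
      by (elim exE) (rule that)
    note nz = conjunct1[OF sc] and rel = bspec[OF conjunct2[OF sc]]
    let ?P = "PiE K (\<lambda>_. {..<s})"
    \<comment> \<open>Any coefficient that is not formally zero will do, leading or not: where it is
      nonzero, \<open>v k\<close> is a root of a nonzero polynomial.\<close>
    obtain i \<alpha> where i: "i < s" "\<alpha> \<in> ?P" "c i \<alpha> \<noteq> 0" using nz by blast
    define g where "g j z = (\<Sum>\<alpha>\<in>?P. c j \<alpha> * (\<Prod>l\<in>K. \<zeta> l z ^ \<alpha> l))" for j z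
    define Q where "Q = (\<Sum>\<alpha>\<in>?P. Const (c i \<alpha>) *
      (\<Prod>l\<in>K. (\<Sum>x\<in>X. Const (a l x) * (Var x + Const (- \<psi> x b))) ^ \<alpha> l))"
    have eQ: "eval_poly Q z = g i z" for z
      by (simp add: Q_def g_def \<zeta>_def eval_poly_sum eval_poly_mult eval_poly_prod eval_poly_power eval_poly_add)
    have "Q \<in> polys X"
      unfolding Q_def
      by (intro sum_in_polys mult_in_polys prod_in_polys power_in_polys add_in_polys Const_in_polys Var_in_polys)
    moreover have "\<exists>v\<in>cspace K. eval_poly Q (\<lambda>x. \<psi> x v) \<noteq> 0"
      unfolding eQ g_def \<xi>_def[symmetric]
      by (rule algebraic_independence[OF K b \<xi>lim i(2), of "c i"]) (use i in auto)
    moreover have "\<exists>R. finite R \<and> (\<forall>v\<in>cspace K. (\<forall>x\<in>X. \<psi> x v = z x) \<longrightarrow> v k \<in> R)"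
      if z: "eval_poly Q z \<noteq> 0" for z
    proof -
      define q where "q = (\<Sum>j<s. monom (g j z) j)"
      have "coeff q i = g i z" using i(1) by (simp add: q_def coeff_sum)
      then have q: "q \<noteq> 0" using z eQ by auto
      have "poly q (v k) = 0" if v: "v \<in> cspace K" "\<forall>x\<in>X. \<psi> x v = z x" for v
      proof -
        have "\<xi> l v = \<zeta> l z" for l using v(2) by (auto simp: \<xi>_def \<zeta>_def)
        then have "0 = (\<Sum>j<s. \<Sum>\<alpha>\<in>?P. c j \<alpha> * (v k ^ j * (\<Prod>l\<in>K. \<zeta> l z ^ \<alpha> l)))"
          using rel[OF v(1)] by simp
        also have "\<dots> = (\<Sum>j<s. g j z * v k ^ j)"
          by (simp add: g_def sum_distrib_left algebra_simps)
        also have "\<dots> = poly q (v k)" by (simp add: q_def poly_sum poly_monom)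
        finally show ?thesis by simp
      qed
      then show ?thesis using poly_roots_finite[OF q] by (intro exI[of _ "{t. poly q t = 0}"]) auto
    qed
    ultimately show ?thesis by blast
  qed
  then obtain Q where Q: "\<And>k. Q k \<in> polys X" "\<And>k. \<exists>v\<in>cspace K. eval_poly (Q k) (\<lambda>x. \<psi> x v) \<noteq> 0"
    "\<And>k z. eval_poly (Q k) z \<noteq> 0 \<Longrightarrow> \<exists>R. finite R \<and> (\<forall>v\<in>cspace K. (\<forall>x\<in>X. \<psi> x v = z x) \<longrightarrow> v k \<in> R)"
    by metis
  \<comment> \<open>One condition for each coordinate. Their product is nonzero somewhere on the
    image because each factor, pulled back to \<open>v\<close>, is polynomial along lines.\<close>
  define P where "P = (\<Prod>k\<in>K. Q k)"
  have "\<exists>E. linepoly E (\<lambda>v. eval_poly (Q k) (\<lambda>x. \<psi> x v))" for k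
    by (rule linepoly_eval_comp[OF Q(1)]) (use lin in blast)
  then obtain E where E: "\<And>k. linepoly (E k) (\<lambda>v. eval_poly (Q k) (\<lambda>x. \<psi> x v))" by metis
  show ?thesis
  proof (intro bexI[of _ P] conjI allI impI)
    show "P \<in> polys X" unfolding P_def by (intro prod_in_polys Q)
    obtain v where "v \<in> cspace K" "\<forall>k\<in>K. eval_poly (Q k) (\<lambda>x. \<psi> x v) \<noteq> 0"
      using linepoly_common_nonzero[where F = "\<lambda>k v. eval_poly (Q k) (\<lambda>x. \<psi> x v)", OF K E Q(2)] by blast
    then show "\<exists>v\<in>cspace K. eval_poly P (\<lambda>x. \<psi> x v) \<noteq> 0"
      using K by (auto simp: P_def eval_poly_prod)
    fix z assume "eval_poly P z \<noteq> 0"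
    then have "\<forall>k\<in>K. \<exists>R. finite R \<and> (\<forall>v\<in>cspace K. (\<forall>x\<in>X. \<psi> x v = z x) \<longrightarrow> v k \<in> R)"
      using K by (intro ballI Q(3)) (auto simp: P_def eval_poly_prod)
    then obtain R where R: "\<And>k. k \<in> K \<Longrightarrow> finite (R k)"
      "\<And>k v. k \<in> K \<Longrightarrow> v \<in> cspace K \<Longrightarrow> \<forall>x\<in>X. \<psi> x v = z x \<Longrightarrow> v k \<in> R k" by metis
    have "{v \<in> cspace K. \<forall>x\<in>X. \<psi> x v = z x} \<subseteq> {v \<in> cspace K. \<forall>k\<in>K. v k \<in> R k}" using R by auto
    then show "finite {v \<in> cspace K. \<forall>x\<in>X. \<psi> x v = z x}"
      using cspace_box(1)[OF K, of R] R(1) finite_subset by blast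
  qed
qed

section \<open>Projective points, forms and linear substitutions\<close>

lemma mem_proj_pt: "w \<in> proj_pt v \<longleftrightarrow> (\<exists>c. c \<noteq> 0 \<and> w = (\<lambda>i. c * v i))"
  by (auto simp: proj_pt_def)

lemma proj_pt_self [simp]: "v \<in> proj_pt v"
  unfolding mem_proj_pt by (intro exI[of _ 1]) auto

lemma proj_pt_eqI: "w \<in> proj_pt v \<Longrightarrow> proj_pt w = proj_pt v"
proof -
  assume "w \<in> proj_pt v"
  then obtain c where c: "c \<noteq> 0" "w = (\<lambda>i. c * v i)" by (auto simp: mem_proj_pt)
  show ?thesis
  proof (intro set_eqI iffI)
    fix u assume "u \<in> proj_pt w"
    then obtain e where "e \<noteq> 0" "u = (\<lambda>i. e * w i)" by (auto simp: mem_proj_pt)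
    then show "u \<in> proj_pt v" using c unfolding mem_proj_pt by (intro exI[of _ "e * c"]) auto
  next
    fix u assume "u \<in> proj_pt v"
    then obtain e where "e \<noteq> 0" "u = (\<lambda>i. e * v i)" by (auto simp: mem_proj_pt)
    then show "u \<in> proj_pt w" using c unfolding mem_proj_pt by (intro exI[of _ "e / c"]) auto
  qed
qed

lemma proj_pt_in_proj: "v \<in> cspace I \<Longrightarrow> v \<noteq> (\<lambda>_. 0) \<Longrightarrow> proj_pt v \<in> proj I"
  by (auto simp: proj_def)

lemma proj_memD:
  assumes "P \<in> proj I" "v \<in> P"
  shows "v \<in> cspace I" "v \<noteq> (\<lambda>_. 0)" "P = proj_pt v"
proof -
  obtain u where u: "u \<in> cspace I" "u \<noteq> (\<lambda>_. 0)" "P = proj_pt u" using assms(1) by (auto simp: proj_def)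
  then obtain c where c: "c \<noteq> 0" "v = (\<lambda>i. c * u i)" using assms(2) by (auto simp: mem_proj_pt)
  show "v \<in> cspace I" "v \<noteq> (\<lambda>_. 0)" using c u by (auto simp: cspace_def fun_eq_iff)
  show "P = proj_pt v" using proj_pt_eqI u assms(2) by metis
qed

lemma coords_mem: "P \<in> proj I \<Longrightarrow> coords P \<in> P"
  unfolding coords_def proj_def by (metis imageE proj_pt_self someI)

text \<open>Homogeneity makes the condition independent of the representative.\<close>

lemma principal_open_iff:
  assumes "F \<in> forms I d" "u \<in> cspace I" "u \<noteq> (\<lambda>_. 0)"
  shows "proj_pt u \<in> principal_open I F \<longleftrightarrow> eval_poly F u \<noteq> 0"
proof -
  have "proj_pt u \<in> principal_open I F \<longleftrightarrow> (\<forall>c. c \<noteq> 0 \<longrightarrow> eval_poly F (\<lambda>i. c * u i) \<noteq> 0)"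
    using proj_pt_in_proj[OF assms(2,3)] unfolding principal_open_def proj_pt_def by blast
  then show ?thesis
    by (simp add: eval_forms_scale[OF assms(1)]) (metis one_neq_zero)
qed

lemma Sing_iff:
  assumes "F \<in> forms I d" "u \<in> cspace I" "u \<noteq> (\<lambda>_. 0)"
  shows "proj_pt u \<in> Sing I F \<longleftrightarrow> eval_poly F u = 0 \<and> (\<forall>i\<in>I. eval_poly (pd i F) u = 0)"
proof -
  have "eval_poly (pd i F) (\<lambda>j. c * u j) = c ^ (d - 1) * eval_poly (pd i F) u" for i c
    by (rule eval_forms_scale[OF pd_in_forms[OF assms(1)]])
  moreover have "proj_pt u \<in> Sing I F \<longleftrightarrow> (\<forall>c. c \<noteq> 0 \<longrightarrow> eval_poly F (\<lambda>i. c * u i) = 0 \<and> (\<forall>i\<in>I. eval_poly (pd i F) (\<lambda>i. c * u i) = 0))"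
    using proj_pt_in_proj[OF assms(2,3)] unfolding Sing_def proj_pt_def by blast
  ultimately show ?thesis
    by (simp add: eval_forms_scale[OF assms(1)]) (metis power_one mult_1 one_neq_zero)
qed

lemma Sing_empty_iff:
  assumes "F \<in> forms I d"
  shows "Sing I F = {} \<longleftrightarrow> (\<forall>u\<in>cspace I. eval_poly F u = 0 \<and> (\<forall>i\<in>I. eval_poly (pd i F) u = 0) \<longrightarrow> u = (\<lambda>_. 0))"
proof
  assume "Sing I F = {}"
  then show "\<forall>u\<in>cspace I. eval_poly F u = 0 \<and> (\<forall>i\<in>I. eval_poly (pd i F) u = 0) \<longrightarrow> u = (\<lambda>_. 0)"
    using Sing_iff[OF assms] by blast
next
  assume *: "\<forall>u\<in>cspace I. eval_poly F u = 0 \<and> (\<forall>i\<in>I. eval_poly (pd i F) u = 0) \<longrightarrow> u = (\<lambda>_. 0)"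
  show "Sing I F = {}"
  proof (rule ccontr)
    assume "Sing I F \<noteq> {}"
    then obtain P where P: "P \<in> Sing I F" by blast
    then have "P \<in> proj I" by (auto simp: Sing_def)
    then obtain u where "u \<in> cspace I" "u \<noteq> (\<lambda>_. 0)" "P = proj_pt u" by (auto simp: proj_def)
    then show False using Sing_iff[OF assms] P * by blast
  qed
qed

lemma hyperplane_cone_iff:
  "v \<in> hyperplane_cone I (proj_pt l) \<longleftrightarrow> v \<in> cspace I \<and> (\<Sum>i\<in>I. l i * v i) = 0"
proof -
  have "(\<Sum>i\<in>I. c * l i * v i) = c * (\<Sum>i\<in>I. l i * v i)" for c
    by (simp add: sum_distrib_left mult.assoc)
  moreover have "v \<in> hyperplane_cone I (proj_pt l) \<longleftrightarrow> v \<in> cspace I \<and> (\<forall>c. c \<noteq> 0 \<longrightarrow> (\<Sum>i\<in>I. c * l i * v i) = 0)"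
    by (simp add: hyperplane_cone_def proj_pt_def) blast
  ultimately show ?thesis by simp (metis mult_1 one_neq_zero)
qed

text \<open>Linear forms with the same kernel are proportional, by duality with a single
  row.\<close>

lemma hyperplane_cone_inj:
  assumes I: "finite I" and "H \<in> proj I" "H' \<in> proj I" "hyperplane_cone I H = hyperplane_cone I H'"
  shows "H = H'"
proof -
  obtain l l' where l: "l \<in> cspace I" "l \<noteq> (\<lambda>_. 0)" "H = proj_pt l"
    and l': "l' \<in> cspace I" "l' \<noteq> (\<lambda>_. 0)" "H' = proj_pt l'"
    using assms by (auto simp: proj_def)
  have "\<exists>a. \<forall>j\<in>I. l' j = (\<Sum>i\<in>{()}. a i * l j)"
  proof (rule functional_in_row_span)
    fix w assume "w \<in> cspace I" "\<forall>i\<in>{()}. (\<Sum>j\<in>I. l j * w j) = 0"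
    then have "w \<in> hyperplane_cone I H'" using assms(4) l by (simp add: hyperplane_cone_iff flip: assms(4))
    then show "(\<Sum>j\<in>I. l' j * w j) = 0" using l' by (simp add: hyperplane_cone_iff)
  qed (use I in auto)
  then obtain a where "\<forall>j\<in>I. l' j = a * l j" by auto
  then have "l' = (\<lambda>j. a * l j)" using l l' by (auto simp: cspace_def fun_eq_iff)
  moreover from this have "a \<noteq> 0" using l' by auto
  ultimately have "l' \<in> proj_pt l" by (auto simp: mem_proj_pt)
  then show ?thesis using l l' proj_pt_eqI by metis
qed

section \<open>The graded ring of forms\<close>

lemma monomials_add:
  assumes "a \<in> monomials I d" "b \<in> monomials I e"
  shows "a + b \<in> monomials I (d + e)"
proof -
  let ?K = "keys a \<union> keys b"
  have k: "keys (a + b) \<subseteq> ?K" by (rule Poly_Mapping.keys_add)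
  have "(\<Sum>i\<in>keys (a + b). lookup (a + b) i) = (\<Sum>i\<in>?K. lookup (a + b) i)"
    using k by (intro sum.mono_neutral_left) (auto simp: in_keys_iff)
  also have "\<dots> = (\<Sum>i\<in>?K. lookup a i) + (\<Sum>i\<in>?K. lookup b i)"
    by (simp add: lookup_add sum.distrib)
  also have "(\<Sum>i\<in>?K. lookup a i) = (\<Sum>i\<in>keys a. lookup a i)"
    by (intro sum.mono_neutral_right) (auto simp: in_keys_iff)
  also have "(\<Sum>i\<in>?K. lookup b i) = (\<Sum>i\<in>keys b. lookup b i)"
    by (intro sum.mono_neutral_right) (auto simp: in_keys_iff)
  finally show ?thesis using assms k by (auto simp: monomials_def)
qed

lemma forms_mult: "p \<in> forms I d \<Longrightarrow> q \<in> forms I e \<Longrightarrow> p * q \<in> forms I (d + e)"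
  unfolding forms_def using keys_mult[of p q] monomials_add[of _ I d _ e] by blast

lemma forms_add: "p \<in> forms I d \<Longrightarrow> q \<in> forms I d \<Longrightarrow> p + q \<in> forms I d"
  unfolding forms_def using Poly_Mapping.keys_add[of p q] by blast

lemma forms_0 [simp]: "0 \<in> forms I d"
  by (simp add: forms_def)

lemma Const_in_forms: "Const c \<in> forms I 0"
  by (auto simp: forms_def Const_def monomials_def)

lemma one_in_forms: "1 \<in> forms I 0"
  using Const_in_forms[of 1] by (simp add: Const_def)

lemma Var_in_forms: "i \<in> I \<Longrightarrow> Var i \<in> forms I 1"
  by (auto simp: forms_def Var_def monomials_def)

lemma forms_sum: "(\<And>x. x \<in> A \<Longrightarrow> p x \<in> forms I d) \<Longrightarrow> (\<Sum>x\<in>A. p x) \<in> forms I d"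
  by (induction A rule: infinite_finite_induct) (auto simp: forms_add)

lemma forms_cmult: "p \<in> forms I d \<Longrightarrow> Const c * p \<in> forms I d"
  using forms_mult[OF Const_in_forms] by fastforce

lemma forms_power: "p \<in> forms I d \<Longrightarrow> p ^ k \<in> forms I (k * d)"
  by (induction k) (auto simp: one_in_forms forms_mult)

lemma forms_prod: "(\<And>x. x \<in> A \<Longrightarrow> p x \<in> forms I (d x)) \<Longrightarrow> (\<Prod>x\<in>A. p x) \<in> forms I (\<Sum>x\<in>A. d x)"
  by (induction A rule: infinite_finite_induct) (auto simp: one_in_forms forms_mult)

lemma subst_in_forms:
  assumes "p \<in> forms I d" "\<And>i. i \<in> I \<Longrightarrow> \<sigma> i \<in> forms J 1"
  shows "subst_poly \<sigma> p \<in> forms J d"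
  unfolding subst_poly_def
proof (intro forms_sum forms_cmult)
  fix m assume "m \<in> keys p"
  then have m: "m \<in> monomials I d" using assms by (auto simp: forms_def)
  have "(\<Prod>i\<in>keys m. \<sigma> i ^ lookup m i) \<in> forms J (\<Sum>i\<in>keys m. lookup m i * 1)"
    using m assms(2) by (intro forms_prod forms_power) (auto simp: monomials_def)
  then show "(\<Prod>i\<in>keys m. \<sigma> i ^ lookup m i) \<in> forms J d"
    using m by (simp add: monomials_def)
qed

section \<open>Pulling forms back along matrices\<close>

lemma pullback_in_forms: "f \<in> forms I d \<Longrightarrow> pullback_form m A f \<in> forms {..m} d"
  unfolding pullback_form_def
  by (rule subst_in_forms) (auto intro!: forms_sum forms_cmult Var_in_forms[simplified])

lemma eval_pullback: "eval_poly (pullback_form m A f) x = eval_poly f (lin_map m A x)"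
  by (simp add: pullback_form_def eval_subst_poly lin_map_def eval_poly_sum eval_poly_mult)

lemma lin_map_linear: "lin_map m A (\<lambda>k. a k + t * b k) i = lin_map m A a i + t * lin_map m A b i"
  by (simp add: lin_map_def algebra_simps sum.distrib sum_distrib_left)

lemma lin_map_scale: "lin_map m A (\<lambda>k. t * b k) = (\<lambda>i. t * lin_map m A b i)"
  by (simp add: lin_map_def algebra_simps sum_distrib_left)

lemma lin_map_zero [simp]: "lin_map m A (\<lambda>_. 0) = (\<lambda>_. 0)"
  by (simp add: lin_map_def)

lemma lin_map_unit: "k \<le> m \<Longrightarrow> lin_map m A (\<lambda>i. if i = k then 1 else 0) j = A j k"
  by (simp add: lin_map_def if_distrib cong: if_cong)

text \<open>Moving \<open>x\<close> in direction \<open>k\<close> moves its image along column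
  \<open>k\<close> of \<open>A\<close>; the derivative is then read off by
  \<open>eval_pd_unique\<close>.\<close>

lemma eval_pd_pullback:
  assumes "f \<in> polys {..n}" "k \<le> m"
  shows "eval_poly (pd k (pullback_form m A f)) x = (\<Sum>i\<le>n. eval_poly (pd i f) (lin_map m A x) * A i k)"
proof (rule eval_pd_unique[of "{..m}"])
  show "pullback_form m A f \<in> polys {..m}"
    unfolding pullback_form_def using assms(1)
    by (rule subst_in_polys) (auto intro!: sum_in_polys mult_in_polys Var_in_polys)
  have "lin_map m A (x(k := x k + t)) = (\<lambda>i. lin_map m A x i + t * A i k)" for t
  proof
    fix i
    have "x(k := x k + t) = (\<lambda>j. x j + t * (if j = k then 1 else 0))" by auto
    then show "lin_map m A (x(k := x k + t)) i = lin_map m A x i + t * A i k"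
      using assms(2) by (simp only: lin_map_linear lin_map_unit)
  qed
  then show "dlim (at 0) (\<lambda>t. t) (\<lambda>t. eval_poly (pullback_form m A f) (x(k := x k + t)))
      (eval_poly (pullback_form m A f) x) (\<Sum>i\<le>n. eval_poly (pd i f) (lin_map m A x) * A i k)"
    unfolding eval_pullback
    by (simp only:) (intro at0.dlim_eval_poly assms dlim_line finite_atMost)
qed (use assms in auto)

lemma sum_pd_pullback:
  assumes "f \<in> polys {..n}"
  shows "(\<Sum>k\<le>m. eval_poly (pd k (pullback_form m A f)) x * y k)
     = (\<Sum>i\<le>n. eval_poly (pd i f) (lin_map m A x) * lin_map m A y i)"
proof -
  have "(\<Sum>k\<le>m. eval_poly (pd k (pullback_form m A f)) x * y k)
      = (\<Sum>k\<le>m. \<Sum>i\<le>n. eval_poly (pd i f) (lin_map m A x) * A i k * y k)"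
    using assms by (simp add: eval_pd_pullback sum_distrib_right)
  also have "\<dots> = (\<Sum>i\<le>n. \<Sum>k\<le>m. eval_poly (pd i f) (lin_map m A x) * A i k * y k)" by (rule sum.swap)
  finally show ?thesis by (simp add: lin_map_def sum_distrib_left mult.assoc)
qed

lemma eval_pd_pd_pullback:
  assumes "f \<in> polys {..n}" "j \<le> m" "k \<le> m"
  shows "eval_poly (pd k (pd j (pullback_form m A f))) x
     = (\<Sum>i\<le>n. (\<Sum>l\<le>n. eval_poly (pd l (pd i f)) (lin_map m A x) * A l k) * A i j)"
proof (rule eval_pd_unique[of "{..m}"])
  have "pullback_form m A f \<in> polys {..m}"
    unfolding pullback_form_def using assms(1)
    by (rule subst_in_polys) (auto intro!: sum_in_polys mult_in_polys Var_in_polys)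
  then show "pd j (pullback_form m A f) \<in> polys {..m}" by (rule pd_in_polys)
  have l: "lin_map m A (x(k := x k + t)) = (\<lambda>i. lin_map m A x i + t * A i k)" for t
  proof
    fix i
    have "x(k := x k + t) = (\<lambda>j. x j + t * (if j = k then 1 else 0))" by auto
    then show "lin_map m A (x(k := x k + t)) i = lin_map m A x i + t * A i k"
      using assms(3) by (simp only: lin_map_linear lin_map_unit)
  qed
  have "dlim (at 0) (\<lambda>t. t) (\<lambda>t. \<Sum>i\<le>n. A i j * eval_poly (pd i f) (\<lambda>l. lin_map m A x l + t * A l k))
      (\<Sum>i\<le>n. A i j * eval_poly (pd i f) (lin_map m A x))
      (\<Sum>i\<le>n. A i j * (\<Sum>l\<le>n. eval_poly (pd l (pd i f)) (lin_map m A x) * A l k))"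
    by (intro at0.dlim_sum at0.dlim_cmult at0.dlim_eval_poly assms dlim_line finite_atMost pd_in_polys)
  then show "dlim (at 0) (\<lambda>t. t) (\<lambda>t. eval_poly (pd j (pullback_form m A f)) (x(k := x k + t)))
      (eval_poly (pd j (pullback_form m A f)) x)
      (\<Sum>i\<le>n. (\<Sum>l\<le>n. eval_poly (pd l (pd i f)) (lin_map m A x) * A l k) * A i j)"
    using assms by (simp add: eval_pd_pullback l mult.commute)
qed (use assms in auto)

text \<open>The equation is solved for a coordinate \<open>c\<close> with nonzero coefficient, and
  the other coordinates are free parameters. Hence the choice in \<open>hyperplane_section\<close>
  is a genuine identification.\<close>

lemma hyperplane_iso_exists:
  assumes "H \<in> proj {..Suc m}"
  shows "\<exists>A. hyperplane_iso (Suc m) H A"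
proof -
  obtain l where l: "l \<in> cspace {..Suc m}" "l \<noteq> (\<lambda>_. 0)" "H = proj_pt l"
    using assms by (auto simp: proj_def)
  then obtain c where c: "l c \<noteq> 0" by auto
  then have cm: "c \<le> Suc m" using l by (auto simp: cspace_def)
  \<comment> \<open>The increasing enumeration of the indices other than \<open>c\<close>.\<close>
  define \<sigma> where "\<sigma> k = (if k < c then k else Suc k)" for k
  have "{..Suc m} - {c} \<subseteq> \<sigma> ` {..m}"
  proof
    fix j assume "j \<in> {..Suc m} - {c}"
    then have "j = \<sigma> (if j < c then j else j - 1)" "(if j < c then j else j - 1) \<le> m"
      using cm by (auto simp: \<sigma>_def)
    then show "j \<in> \<sigma> ` {..m}" by blast
  qed
  then have img: "\<sigma> ` {..m} = {..Suc m} - {c}" using cm by (auto simp: \<sigma>_def)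
  have inj: "inj \<sigma>" by (auto simp: inj_def \<sigma>_def split: if_splits)
  have \<sigma>c: "\<sigma> k \<noteq> c" for k by (auto simp: \<sigma>_def)
  define A where "A j k = (if j = \<sigma> k then 1 else if j = c then - l (\<sigma> k) / l c else 0)" for j k
  have split: "(\<Sum>j\<le>Suc m. h j) = h c + (\<Sum>k\<le>m. h (\<sigma> k))" for h :: "nat \<Rightarrow> complex"
  proof -
    have "(\<Sum>j\<le>Suc m. h j) = h c + (\<Sum>j\<in>{..Suc m} - {c}. h j)" using cm by (simp add: sum.remove del: sum.atMost_Suc)
    also have "(\<Sum>j\<in>{..Suc m} - {c}. h j) = (\<Sum>k\<le>m. h (\<sigma> k))"
      unfolding img[symmetric] using inj by (subst sum.reindex) (auto intro: inj_on_subset)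
    finally show ?thesis .
  qed
  have A\<sigma>: "lin_map m A x (\<sigma> k) = x k" if "k \<le> m" for x k
  proof -
    have "A (\<sigma> k) k' * x k' = (if k' = k then x k' else 0)" for k'
      using inj \<sigma>c by (auto simp: A_def inj_eq)
    then show ?thesis using that by (simp add: lin_map_def)
  qed
  have Ac: "lin_map m A x c = - (\<Sum>k\<le>m. l (\<sigma> k) * x k) / l c" for x
    using \<sigma>c[symmetric] by (simp add: lin_map_def A_def sum_divide_distrib sum_negf[symmetric] cong: sum.cong)
  have A0: "lin_map m A x j = 0" if "j > Suc m" for x j
    using that cm by (auto simp: lin_map_def A_def \<sigma>_def intro!: sum.neutral)
  define inv where "inv v k = (if k \<le> m then v (\<sigma> k) else 0 :: complex)" for v k
  have "bij_betw (lin_map m A) (cspace {..m}) (hyperplane_cone {..Suc m} H)"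
  proof (rule bij_betw_byWitness[where f' = inv])
    show "\<forall>x\<in>cspace {..m}. inv (lin_map m A x) = x"
      by (auto simp: inv_def A\<sigma> cspace_def fun_eq_iff)
    show "lin_map m A ` cspace {..m} \<subseteq> hyperplane_cone {..Suc m} H"
    proof
      fix y assume "y \<in> lin_map m A ` cspace {..m}"
      then obtain x where x: "y = lin_map m A x" by blast
      have "(\<Sum>i\<le>Suc m. l i * y i) = 0"
        unfolding split x using c by (simp add: Ac A\<sigma>)
      then show "y \<in> hyperplane_cone {..Suc m} H"
        unfolding l(3) hyperplane_cone_iff using A0 x by (auto simp: cspace_def)
    qed
    show "inv ` hyperplane_cone {..Suc m} H \<subseteq> cspace {..m}"
      by (auto simp: inv_def cspace_def)
    show "\<forall>y\<in>hyperplane_cone {..Suc m} H. lin_map m A (inv y) = y"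
    proof
      fix y assume "y \<in> hyperplane_cone {..Suc m} H"
      then have y: "y \<in> cspace {..Suc m}" "(\<Sum>i\<le>Suc m. l i * y i) = 0"
        unfolding l(3) hyperplane_cone_iff by auto
      have "lin_map m A (inv y) j = y j" for j
      proof -
        consider "j = c" | k where "k \<le> m" "j = \<sigma> k" | "j > Suc m"
          using img by (metis DiffI atMost_iff imageE not_less singletonD)
        then show ?thesis
        proof cases
          case 1
          have "(\<Sum>k\<le>m. l (\<sigma> k) * inv y k) = (\<Sum>k\<le>m. l (\<sigma> k) * y (\<sigma> k))"
            by (intro sum.cong) (auto simp: inv_def)
          also have "\<dots> = - (l c * y c)" using y(2) unfolding split by (simp add: add_eq_0_iff2)
          finally show ?thesis using 1 c by (simp add: Ac)
        next
          case 2
          then show ?thesis by (simp add: A\<sigma> inv_def)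
        next
          case 3
          then show ?thesis using A0 y by (simp add: cspace_def)
        qed
      qed
      then show "lin_map m A (inv y) = y" by auto
    qed
  qed
  then show ?thesis by (auto simp: hyperplane_iso_def)
qed

text \<open>Preimages under \<open>A\<close> of the images of the unit vectors are taken as the
  columns of \<open>M\<close>.\<close>

lemma factor_through:
  assumes A: "lin_map m A ` cspace {..m} = V"
    and B: "\<And>x. x \<in> cspace {..m} \<Longrightarrow> lin_map m B x \<in> V"
  shows "\<exists>M. (\<forall>x. lin_map m M x \<in> cspace {..m}) \<and> (\<forall>x. lin_map m B x = lin_map m A (lin_map m M x))"
proof -
  have "\<forall>k\<le>m. \<exists>y\<in>cspace {..m}. lin_map m A y = lin_map m B (\<lambda>i. if i = k then 1 else 0)"
  proof (intro allI impI)
    fix k assume "k \<le> m"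
    then have "(\<lambda>i. if i = k then 1 else 0) \<in> cspace {..m}" by (auto simp: cspace_def)
    then show "\<exists>y\<in>cspace {..m}. lin_map m A y = lin_map m B (\<lambda>i. if i = k then 1 else 0)"
      using B[of "\<lambda>i. if i = k then 1 else 0"] unfolding A[symmetric] image_iff by fastforce
  qed
  then obtain y where y: "\<And>k. k \<le> m \<Longrightarrow> y k \<in> cspace {..m}"
    "\<And>k. k \<le> m \<Longrightarrow> lin_map m A (y k) = lin_map m B (\<lambda>i. if i = k then 1 else 0)" by metis
  define M where "M j k = y k j" for j k
  have "lin_map m M x \<in> cspace {..m}" for x
    using y(1) by (auto simp: cspace_def lin_map_def M_def intro!: sum.neutral)
  moreover have "lin_map m B x j = lin_map m A (lin_map m M x) j" for x j
  proof -
    have "lin_map m A (lin_map m M x) j = (\<Sum>i\<le>m. \<Sum>k\<le>m. A j i * (y k i * x k))"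
      by (simp add: lin_map_def M_def sum_distrib_left)
    also have "\<dots> = (\<Sum>k\<le>m. \<Sum>i\<le>m. A j i * (y k i * x k))" by (rule sum.swap)
    also have "\<dots> = (\<Sum>k\<le>m. lin_map m A (y k) j * x k)"
      by (simp add: lin_map_def sum_distrib_right mult.assoc)
    also have "\<dots> = (\<Sum>k\<le>m. B j k * x k)"
      by (intro sum.cong) (auto simp: y(2) lin_map_unit)
    finally show ?thesis by (simp add: lin_map_def)
  qed
  ultimately show ?thesis by (intro exI[of _ M]) auto
qed

text \<open>The \<open>m + 1\<close> columns together with \<open>y\<close> are linearly dependent,
  and injectivity forces \<open>y\<close> to occur in the dependency.\<close>

lemma injective_imp_bij:
  assumes M: "\<And>x. x \<in> cspace {..m} \<Longrightarrow> lin_map m M x \<in> cspace {..m}"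
    and inj: "\<And>x. x \<in> cspace {..m} \<Longrightarrow> lin_map m M x = (\<lambda>_. 0) \<Longrightarrow> x = (\<lambda>_. 0)"
  shows "bij_betw (lin_map m M) (cspace {..m}) (cspace {..m})"
  unfolding bij_betw_def
proof
  show "inj_on (lin_map m M) (cspace {..m})"
  proof (rule inj_onI)
    fix x y assume x: "x \<in> cspace {..m}" "y \<in> cspace {..m}" "lin_map m M x = lin_map m M y"
    have "lin_map m M (\<lambda>k. x k + (-1) * y k) = (\<lambda>_. 0)"
      unfolding fun_eq_iff lin_map_linear x(3) by simp
    moreover have "(\<lambda>k. x k + (-1) * y k) \<in> cspace {..m}" using x(1,2) by (auto simp: cspace_def)
    ultimately have "(\<lambda>k. x k + (-1) * y k) = (\<lambda>_. 0)" using inj by blast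
    then show "x = y" by (auto simp: fun_eq_iff)
  qed
  have "y \<in> lin_map m M ` cspace {..m}" if y: "y \<in> cspace {..m}" for y
  proof -
    define u where "u i j = (if i \<le> m then M j i else y j)" for i j
    obtain c where c: "\<exists>i\<in>{..Suc m}. c i \<noteq> 0" "\<forall>j\<in>{..m}. (\<Sum>i\<le>Suc m. c i * u i j) = 0"
      using nontrivial_kernel[of "{..m}" "{..Suc m}" u] by auto
    define x where "x i = (if i \<le> m then c i else 0)" for i
    have x: "x \<in> cspace {..m}" by (auto simp: x_def cspace_def)
    have eq: "lin_map m M x j + c (Suc m) * y j = 0" for j
    proof (cases "j \<le> m")
      case True
      have "(\<Sum>i\<le>m. c i * u i j) = lin_map m M x j"
        unfolding lin_map_def by (intro sum.cong) (auto simp: u_def x_def)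
      moreover have "(\<Sum>i\<le>m. c i * u i j) + c (Suc m) * u (Suc m) j = 0" using c(2) True by simp
      ultimately show ?thesis by (simp add: u_def)
    next
      case False
      then show ?thesis using y M[OF x] by (auto simp: cspace_def)
    qed
    have nz: "c (Suc m) \<noteq> 0"
    proof
      assume 0: "c (Suc m) = 0"
      then have "lin_map m M x = (\<lambda>_. 0)" using eq by auto
      then have "x = (\<lambda>_. 0)" using inj x by blast
      then have "c i = 0" if "i \<le> Suc m" for i
        using that 0 by (cases "i = Suc m") (auto simp: x_def fun_eq_iff split: if_splits)
      then show False using c(1) by auto
    qed
    have "lin_map m M (\<lambda>i. (- 1 / c (Suc m)) * x i) = y"
      unfolding lin_map_scale using eq nz by (auto simp: fun_eq_iff field_simps add_eq_0_iff)
    moreover have "(\<lambda>i. (- 1 / c (Suc m)) * x i) \<in> cspace {..m}" using x by (auto simp: cspace_def)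
    ultimately show ?thesis by blast
  qed
  then show "lin_map m M ` cspace {..m} = cspace {..m}" using M by blast
qed

text \<open>The hypothesis reads \<open>c \<beta> + a \<beta> + \<beta> a = 0\<close> with \<open>a\<close> diagonal; multiply by \<open>\<beta>\<^sup>-\<^sup>1\<close> and take the trace.\<close>

lemma trace_identity:
  fixes \<beta> :: "'i \<Rightarrow> 'i \<Rightarrow> complex"
  assumes T: "finite T" and sym: "\<And>j k. \<beta> j k = \<beta> k j"
    and nd: "\<And>w. w \<in> cspace T \<Longrightarrow> (\<forall>i\<in>T. (\<Sum>j\<in>T. \<beta> i j * w j) = 0) \<Longrightarrow> w = (\<lambda>_. 0)"
    and rel: "\<And>j k. j \<in> T \<Longrightarrow> k \<in> T \<Longrightarrow> (c + a j + a k) * \<beta> j k = 0"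
  shows "of_nat (card T) * c + 2 * (\<Sum>j\<in>T. a j) = 0"
proof -
  obtain \<gamma> where "\<forall>k\<in>T. \<forall>l\<in>T. (\<Sum>i\<in>T. \<gamma> k i * \<beta> i l) = (if l = k then 1 else 0)"
    using left_inverse_exists[OF T T nd] by blast
  then have \<gamma>: "(\<Sum>i\<in>T. \<gamma> k i * \<beta> i l) = (if l = k then 1 else 0)" if "k \<in> T" "l \<in> T" for k l
    using that by blast
  \<comment> \<open>The inverse of a symmetric matrix is symmetric; the double sum is evaluated from
    both sides.\<close>
  have \<gamma>sym: "\<gamma> k j = \<gamma> j k" if "k \<in> T" "j \<in> T" for k j
  proof -
    have "(\<Sum>l\<in>T. \<gamma> k l * (\<Sum>i\<in>T. \<gamma> j i * \<beta> i l)) = (\<Sum>l\<in>T. if l = j then \<gamma> k l else 0)"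
      using \<gamma> that by (intro sum.cong) auto
    then have 1: "(\<Sum>l\<in>T. \<gamma> k l * (\<Sum>i\<in>T. \<gamma> j i * \<beta> i l)) = \<gamma> k j" using that T by simp
    have "(\<Sum>l\<in>T. \<gamma> k l * (\<Sum>i\<in>T. \<gamma> j i * \<beta> i l)) = (\<Sum>l\<in>T. \<Sum>i\<in>T. \<gamma> j i * (\<gamma> k l * \<beta> l i))"
      using sym by (simp add: sum_distrib_left algebra_simps)
    also have "\<dots> = (\<Sum>i\<in>T. \<Sum>l\<in>T. \<gamma> j i * (\<gamma> k l * \<beta> l i))" by (rule sum.swap)
    also have "\<dots> = (\<Sum>i\<in>T. if i = k then \<gamma> j i else 0)"
      unfolding sum_distrib_left[symmetric] using \<gamma> that by (intro sum.cong) auto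
    also have "\<dots> = \<gamma> j k" using that T by simp
    finally show ?thesis using 1 by simp
  qed
  have A: "(\<Sum>k\<in>T. \<gamma> k j * \<beta> j k) = 1" if "j \<in> T" for j
  proof -
    have "(\<Sum>k\<in>T. \<gamma> k j * \<beta> j k) = (\<Sum>k\<in>T. \<gamma> j k * \<beta> k j)"
      using \<gamma>sym sym that by (intro sum.cong) auto
    then show ?thesis using \<gamma> that by simp
  qed
  have B: "(\<Sum>j\<in>T. \<gamma> k j * \<beta> j k) = 1" if "k \<in> T" for k using \<gamma> that by simp
  \<comment> \<open>The trace of \<open>\<gamma>\<close> times the relation: \<open>c\<close>
    contributes once for every index, and \<open>a j\<close> and \<open>a k\<close> each contribute
    the sum of all \<open>a\<close>.\<close>
  have "0 = (\<Sum>k\<in>T. \<Sum>j\<in>T. \<gamma> k j * ((c + a j + a k) * \<beta> j k))"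
    using rel by (intro sum.neutral[symmetric] ballI sum.neutral) (simp add: mult_eq_0_iff)
  also have "\<dots> = (\<Sum>k\<in>T. \<Sum>j\<in>T. a j * (\<gamma> k j * \<beta> j k)) + (\<Sum>k\<in>T. (c + a k) * (\<Sum>j\<in>T. \<gamma> k j * \<beta> j k))"
    by (simp add: sum_distrib_left sum.distrib[symmetric] algebra_simps)
  also have "(\<Sum>k\<in>T. \<Sum>j\<in>T. a j * (\<gamma> k j * \<beta> j k)) = (\<Sum>j\<in>T. a j * (\<Sum>k\<in>T. \<gamma> k j * \<beta> j k))"
    by (subst sum.swap) (simp add: sum_distrib_left)
  finally have "0 = (\<Sum>j\<in>T. a j * (\<Sum>k\<in>T. \<gamma> k j * \<beta> j k)) + (\<Sum>k\<in>T. (c + a k) * (\<Sum>j\<in>T. \<gamma> k j * \<beta> j k))" .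
  then show ?thesis by (simp add: A B sum.distrib add.commute)
qed

section \<open>Infinitesimal rigidity at a nodal section\<close>

lemma euler_pd:
  assumes "finite I" "p \<in> forms I d"
  shows "(\<Sum>i\<in>I. eval_poly (pd i (pd j p)) v * v i) = of_nat (d - 1) * eval_poly (pd j p) v"
  using euler[OF assms(1) pd_in_forms[OF assms(2)]] .

lemma eval_local_eq:
  "eval_poly (local_eq F P) v = eval_poly F (v(chart P := 1))"
proof -
  have "(\<lambda>i. eval_poly (if i = chart P then 1 else Var i) v) = v(chart P := 1)" by auto
  then show ?thesis by (simp add: local_eq_def eval_subst_poly)
qed

lemma local_eq_in_polys: "F \<in> polys I \<Longrightarrow> local_eq F P \<in> polys I"
  unfolding local_eq_def by (rule subst_in_polys) (auto intro: Var_in_polys)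

lemma dlim_coord: "dlim (at 0) (\<lambda>t. t) (\<lambda>t. (x(j := x j + t)) i) (x i) (if i = j then 1 else 0)"
  using dlim_line[of "x i" "if i = j then 1 else 0"] by (cases "i = j") (auto simp: at0.dlim_const)

lemma dlim_eval_pd:
  assumes "finite I" "p \<in> polys I" "j \<in> I"
  shows "dlim (at 0) (\<lambda>t. t) (\<lambda>t. eval_poly p (x(j := x j + t))) (eval_poly p x) (eval_poly (pd j p) x)"
proof -
  have "dlim (at 0) (\<lambda>t. t) (\<lambda>t. eval_poly p (\<lambda>i. (x(j := x j + t)) i)) (eval_poly p x)
      (\<Sum>i\<in>I. eval_poly (pd i p) x * (if i = j then 1 else 0))"
    by (rule at0.dlim_eval_poly[OF assms(1,2)]) (rule dlim_coord)
  moreover have "(\<Sum>i\<in>I. eval_poly (pd i p) x * (if i = j then 1 else 0)) = eval_poly (pd j p) x"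
    using assms by (simp add: if_distrib[of "\<lambda>z. _ * z"] cong: if_cong)
  ultimately show ?thesis by (simp only:)
qed

lemma eval_pd_local_eq:
  assumes "finite I" "F \<in> polys I" "j \<in> I" "j \<noteq> chart P"
  shows "eval_poly (pd j (local_eq F P)) v = eval_poly (pd j F) (v(chart P := 1))"
proof (rule eval_pd_unique[OF assms(1) local_eq_in_polys[OF assms(2)] assms(3)])
  have "(v(j := v j + t))(chart P := 1) = (v(chart P := 1))(j := (v(chart P := 1)) j + t)" for t
    using assms(4) by auto
  then show "dlim (at 0) (\<lambda>t. t) (\<lambda>t. eval_poly (local_eq F P) (v(j := v j + t))) (eval_poly (local_eq F P) v)
     (eval_poly (pd j F) (v(chart P := 1)))"
    unfolding eval_local_eq using dlim_eval_pd[OF assms(1-3), where x = "v(chart P := 1)"] by (simp only:)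
qed

text \<open>Setting the chart variable to 1 commutes with derivatives in the other variables, so the
  local Hessian in \<open>node\<close> is a block of the homogeneous one.\<close>

lemma eval_pd_pd_local_eq:
  assumes "finite I" "F \<in> polys I" "j \<in> I" "j \<noteq> chart P" "k \<in> I" "k \<noteq> chart P"
  shows "eval_poly (pd j (pd k (local_eq F P))) v = eval_poly (pd j (pd k F)) (v(chart P := 1))"
proof (rule eval_pd_unique[OF assms(1) pd_in_polys[OF local_eq_in_polys[OF assms(2)]] assms(3)])
  have "(v(j := v j + t))(chart P := 1) = (v(chart P := 1))(j := (v(chart P := 1)) j + t)" for t
    using assms(4) by auto
  then show "dlim (at 0) (\<lambda>t. t) (\<lambda>t. eval_poly (pd k (local_eq F P)) (v(j := v j + t))) (eval_poly (pd k (local_eq F P)) v)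
     (eval_poly (pd j (pd k F)) (v(chart P := 1)))"
    unfolding eval_pd_local_eq[OF assms(1,2,5,6)]
    using dlim_eval_pd[OF assms(1) pd_in_polys[OF assms(2)] assms(3), where x = "v(chart P := 1)"] by (simp only:)
qed

text \<open>The representative whose chart coordinate is 1. Nodes are handled through this vector
  below.\<close>

lemma chart_pt_props:
  assumes "P \<in> proj I"
  shows "chart_pt P \<in> cspace I" "chart_pt P (chart P) = 1" "chart P \<in> I" "P = proj_pt (chart_pt P)"
    "chart_pt P \<noteq> (\<lambda>_. 0)"
proof -
  note c = proj_memD[OF assms coords_mem[OF assms]]
  have "\<exists>i. coords P i \<noteq> 0" using c(2) by auto
  then have nz: "coords P (chart P) \<noteq> 0" unfolding chart_def by (rule LeastI_ex)
  then show "chart P \<in> I" using c(1) by (auto simp: cspace_def)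
  show "chart_pt P (chart P) = 1" using nz by (simp add: chart_pt_def)
  then show "chart_pt P \<noteq> (\<lambda>_. 0)" by auto
  show "chart_pt P \<in> cspace I" using c(1) by (auto simp: chart_pt_def cspace_def)
  have "chart_pt P \<in> proj_pt (coords P)"
    unfolding mem_proj_pt using nz by (intro exI[of _ "1 / coords P (chart P)"]) (auto simp: chart_pt_def)
  then show "P = proj_pt (chart_pt P)" using c(3) proj_pt_eqI by metis
qed

text \<open>Here \<open>m\<close> stands for n - 1, which avoids truncated subtraction, and
  \<open>B\<close> may be any parametrisation of the hyperplane with equation
  \<open>l\<close>.\<close>

locale nodal_section =
  fixes m d :: nat and f :: "nat mpoly" and l :: "nat \<Rightarrow> complex" and B :: "nat \<Rightarrow> nat \<Rightarrow> complex"
  assumes f: "f \<in> forms {..Suc m} d" and d: "d \<ge> 3"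
    and l: "l \<in> cspace {..Suc m}" "l \<noteq> (\<lambda>_. 0)"
    and B: "bij_betw (lin_map m B) (cspace {..m}) (hyperplane_cone {..Suc m} (proj_pt l))"
    and disj: "hyperplane {..Suc m} (proj_pt l) \<inter> Sing {..Suc m} f = {}"
    and nodes: "has_exactly_nodes (Suc m) {..m} (pullback_form m B f)"
    and glp: "general_linear_position {..m} (Sing {..m} (pullback_form m B f))"
begin

abbreviation g where "g \<equiv> pullback_form m B f"
abbreviation S where "S \<equiv> Sing {..m} g"

lemma f_polys: "f \<in> polys {..Suc m}" using f forms_subset_polys by blast
lemma g_forms: "g \<in> forms {..m} d" using f by (rule pullback_in_forms)
lemma g_polys: "g \<in> polys {..m}" using g_forms forms_subset_polys by blast

lemma finite_S: "finite S" and card_S: "card S = Suc m"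
  using nodes by (auto simp: has_exactly_nodes_def)

lemma S_proj: "P \<in> S \<Longrightarrow> P \<in> proj {..m}" by (simp add: Sing_def)

lemma S_sing:
  assumes "P \<in> S"
  shows "eval_poly g (chart_pt P) = 0" "j \<le> m \<Longrightarrow> eval_poly (pd j g) (chart_pt P) = 0"
  using Sing_iff[OF g_forms chart_pt_props(1,5)[OF S_proj[OF assms]]] assms
    chart_pt_props(4)[OF S_proj[OF assms]] by auto

text \<open>At a singular point, Euler's identity for the first derivatives puts the point itself
  into the kernel of the homogeneous Hessian. Nondegeneracy in the chart leaves nothing
  else.\<close>

lemma hessian_kernel:
  assumes P: "P \<in> S" and w: "w \<in> cspace {..m}"
    and ker: "\<And>j. j \<le> m \<Longrightarrow> (\<Sum>k\<le>m. eval_poly (pd j (pd k g)) (chart_pt P) * w k) = 0"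
  shows "w = (\<lambda>k. w (chart P) * chart_pt P k)"
proof -
  let ?p = "chart_pt P" and ?c = "chart P"
  note p = chart_pt_props[OF S_proj[OF P]]
  \<comment> \<open>Subtracting a multiple of the node clears the chart coordinate, so that the
    condition in \<open>node\<close> applies.\<close>
  define u where "u k = w k - w ?c * ?p k" for k
  have u: "u \<in> cspace (chart_vars {..m} P)"
    using w p by (auto simp: cspace_def chart_vars_def u_def)
  have uc: "u ?c = 0" using p by (simp add: u_def)
  have H: "(\<Sum>k\<le>m. eval_poly (pd j (pd k g)) ?p * u k) = 0" if "j \<le> m" for j
  proof -
    have "(\<Sum>k\<le>m. eval_poly (pd k (pd j g)) ?p * ?p k) = 0"
      using euler_pd[OF _ g_forms, of j ?p] S_sing(2)[OF P that] by simp
    then have 0: "(\<Sum>k\<le>m. eval_poly (pd j (pd k g)) ?p * ?p k) = 0" by (simp only: pd_commute[of j])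
    have "(\<Sum>k\<le>m. eval_poly (pd j (pd k g)) ?p * u k)
        = (\<Sum>k\<le>m. eval_poly (pd j (pd k g)) ?p * w k) - w ?c * (\<Sum>k\<le>m. eval_poly (pd j (pd k g)) ?p * ?p k)"
      unfolding u_def sum_distrib_left sum_subtractf[symmetric] by (intro sum.cong refl) (simp add: algebra_simps)
    then show ?thesis using ker[OF that] 0 by simp
  qed
  have loc: "?p(?c := 1) = ?p" using p(2) by auto
  have "u = (\<lambda>_. 0)"
  proof -
    have "\<forall>j\<in>chart_vars {..m} P. (\<Sum>k\<in>chart_vars {..m} P. eval_poly (pd j (pd k (local_eq g P))) ?p * u k) = 0"
    proof
      fix j assume j: "j \<in> chart_vars {..m} P"
      have "(\<Sum>k\<in>chart_vars {..m} P. eval_poly (pd j (pd k (local_eq g P))) ?p * u k)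
          = (\<Sum>k\<in>chart_vars {..m} P. eval_poly (pd j (pd k g)) ?p * u k)"
      proof (intro sum.cong refl arg_cong2[of _ _ _ _ "(*)"])
        fix k assume "k \<in> chart_vars {..m} P"
        then show "eval_poly (pd j (pd k (local_eq g P))) ?p = eval_poly (pd j (pd k g)) ?p"
          using eval_pd_pd_local_eq[OF finite_atMost g_polys, of j P k ?p] j unfolding loc chart_vars_def by blast
      qed
      also have "\<dots> = (\<Sum>k\<le>m. eval_poly (pd j (pd k g)) ?p * u k)"
        using uc by (intro sum.mono_neutral_left) (auto simp: chart_vars_def)
      also have "\<dots> = 0" using H j by (auto simp: chart_vars_def)
      finally show "(\<Sum>k\<in>chart_vars {..m} P. eval_poly (pd j (pd k (local_eq g P))) ?p * u k) = 0" .
    qed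
    moreover have "node {..m} g P" using nodes P by (auto simp: has_exactly_nodes_def)
    ultimately show ?thesis using u by (auto simp: node_def)
  qed
  then have "u k = 0" for k by simp
  then have "w k = w ?c * ?p k" for k unfolding u_def eq_iff_diff_eq_0[of "w k"] .
  then show ?thesis by (rule ext)
qed

lemma image_in_cone:
  "x \<in> cspace {..m} \<Longrightarrow> lin_map m B x \<in> cspace {..Suc m} \<and> (\<Sum>i\<le>Suc m. l i * lin_map m B x i) = 0"
  using bij_betwE[OF B] by (auto simp: hyperplane_cone_iff)

lemma B_injective: "x \<in> cspace {..m} \<Longrightarrow> lin_map m B x = (\<lambda>_. 0) \<Longrightarrow> x = (\<lambda>_. 0)"
  by (rule inj_onD[OF bij_betw_imp_inj_on[OF B]]) (auto simp: cspace_def)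

text \<open>The gradient annihilates the image of \<open>B\<close>, hence is proportional to
  \<open>l\<close>. The factor is nonzero because the node lies on the hyperplane, which misses the
  singular points of X.\<close>

lemma gradient_at_node:
  assumes P: "P \<in> S"
  shows "\<exists>\<mu>. \<mu> \<noteq> 0 \<and> (\<forall>i\<le>Suc m. eval_poly (pd i f) (lin_map m B (chart_pt P)) = \<mu> * l i)"
proof -
  let ?p = "chart_pt P" and ?z = "lin_map m B (chart_pt P)"
  note p = chart_pt_props[OF S_proj[OF P]]
  have "\<exists>a. \<forall>j\<in>{..Suc m}. eval_poly (pd j f) ?z = (\<Sum>i\<in>{()}. a i * l j)"
  proof (rule functional_in_row_span)
    fix w assume "w \<in> cspace {..Suc m}" "\<forall>i\<in>{()}. (\<Sum>j\<le>Suc m. l j * w j) = 0"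
    then have "w \<in> hyperplane_cone {..Suc m} (proj_pt l)" by (simp add: hyperplane_cone_iff)
    then obtain x where x: "x \<in> cspace {..m}" "w = lin_map m B x"
      using bij_betw_imp_surj_on[OF B] by blast
    have "(\<Sum>j\<le>Suc m. eval_poly (pd j f) ?z * w j) = (\<Sum>k\<le>m. eval_poly (pd k g) ?p * x k)"
      unfolding x sum_pd_pullback[OF f_polys] ..
    also have "\<dots> = 0" using S_sing[OF P] by simp
    finally show "(\<Sum>j\<le>Suc m. eval_poly (pd j f) ?z * w j) = 0" .
  qed auto
  then obtain \<mu> where \<mu>: "\<forall>i\<le>Suc m. eval_poly (pd i f) ?z = \<mu> * l i" by auto
  have z: "?z \<in> cspace {..Suc m}" "?z \<noteq> (\<lambda>_. 0)"
    using image_in_cone[OF p(1)] B_injective[OF p(1)] p(5) by auto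
  have "proj_pt ?z \<in> hyperplane {..Suc m} (proj_pt l)"
  proof -
    have "w \<in> hyperplane_cone {..Suc m} (proj_pt l)" if w: "w \<in> proj_pt ?z" for w
    proof -
      obtain c where c: "w = (\<lambda>i. c * ?z i)" using w unfolding mem_proj_pt by blast
      have "w = lin_map m B (\<lambda>k. c * ?p k)" unfolding c lin_map_scale ..
      moreover have "(\<lambda>k. c * ?p k) \<in> cspace {..m}" using p(1) by (auto simp: cspace_def)
      ultimately show ?thesis using bij_betwE[OF B] by auto
    qed
    then show ?thesis using z by (auto simp: hyperplane_def intro: proj_pt_in_proj)
  qed
  then have "proj_pt ?z \<notin> Sing {..Suc m} f" using disj by blast
  then have "\<exists>i\<le>Suc m. eval_poly (pd i f) ?z \<noteq> 0"
    using Sing_iff[OF f z] S_sing(1)[OF P] by (auto simp: eval_pullback)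
  then show ?thesis using \<mu> by (intro exI[of _ \<mu>]) auto
qed

text \<open>General linear position in the form used below: linear forms can be tested on the
  nodes.\<close>

lemma nodes_span:
  assumes y: "y \<in> cspace {..m}" and 0: "\<And>P. P \<in> S \<Longrightarrow> (\<Sum>j\<le>m. y j * chart_pt P j) = 0"
  shows "y = (\<lambda>_. 0)"
proof (rule ccontr)
  assume nz: "y \<noteq> (\<lambda>_. 0)"
  have "S \<subseteq> hyperplane {..m} (proj_pt y)"
  proof
    fix P assume P: "P \<in> S"
    note p = chart_pt_props[OF S_proj[OF P]]
    have "w \<in> hyperplane_cone {..m} (proj_pt y)" if w: "w \<in> P" for w
    proof -
      obtain c where c: "w = (\<lambda>i. c * chart_pt P i)" using w p(4) by (metis mem_proj_pt)
      have "(\<Sum>j\<le>m. y j * w j) = c * (\<Sum>j\<le>m. y j * chart_pt P j)"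
        by (simp add: c sum_distrib_left mult.left_commute)
      then show ?thesis using 0[OF P] proj_memD(1)[OF S_proj[OF P] w] by (simp add: hyperplane_cone_iff)
    qed
    then show "P \<in> hyperplane {..m} (proj_pt y)" using S_proj[OF P] by (auto simp: hyperplane_def)
  qed
  then show False using glp proj_pt_in_proj[OF y nz] by (auto simp: general_linear_position_def)
qed

text \<open>The differential of B -> f(Bx) at the nodal section has no kernel. Entries of
  \<open>C\<close> outside the block are set to zero because f(Bx) does not see them. At the
  excluded value m (d - 2) = 2 the trace equations are singular.\<close>

lemma infinitesimally_injective:
  assumes m: "m \<ge> 2" "m * (d - 2) \<noteq> 2"
    and C0: "\<And>i k. i > Suc m \<or> k > m \<Longrightarrow> C i k = 0"
    and C: "\<And>x. x \<in> cspace {..m} \<Longrightarrow> (\<Sum>i\<le>Suc m. eval_poly (pd i f) (lin_map m B x) * lin_map m C x i) = 0"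
  shows "C i k = 0"
proof -
  let ?V = "cspace {..m}"
  define p where "p P = chart_pt P" for P
  have p: "p P \<in> ?V" if "P \<in> S" for P using chart_pt_props(1)[OF S_proj[OF that]] by (simp add: p_def)
  \<comment> \<open>The coefficients of the linear form l(Cx). It vanishes exactly when
    \<open>C\<close> maps into the hyperplane.\<close>
  define y where "y k = (if k \<le> m then \<Sum>i\<le>Suc m. l i * C i k else 0)" for k
  have lC: "(\<Sum>i\<le>Suc m. l i * lin_map m C x i) = (\<Sum>k\<le>m. y k * x k)" for x
  proof -
    have "(\<Sum>i\<le>Suc m. l i * lin_map m C x i) = (\<Sum>i\<le>Suc m. \<Sum>k\<le>m. l i * C i k * x k)"
      by (simp add: lin_map_def sum_distrib_left mult.assoc del: sum.atMost_Suc)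
    also have "\<dots> = (\<Sum>k\<le>m. \<Sum>i\<le>Suc m. l i * C i k * x k)" by (rule sum.swap)
    also have "\<dots> = (\<Sum>k\<le>m. y k * x k)"
      unfolding y_def by (intro sum.cong refl) (simp add: sum_distrib_right del: sum.atMost_Suc)
    finally show ?thesis .
  qed
  have "y = (\<lambda>_. 0)"
  proof (rule nodes_span)
    show "y \<in> ?V" by (auto simp: y_def cspace_def)
    fix P assume P: "P \<in> S"
    obtain \<mu> where \<mu>: "\<mu> \<noteq> 0" "\<forall>i\<le>Suc m. eval_poly (pd i f) (lin_map m B (chart_pt P)) = \<mu> * l i"
      using gradient_at_node[OF P] by blast
    have "0 = (\<Sum>i\<le>Suc m. (\<mu> * l i) * lin_map m C (chart_pt P) i)"
      using C[OF p[OF P]] \<mu> by (simp add: p_def)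
    also have "\<dots> = \<mu> * (\<Sum>i\<le>Suc m. l i * lin_map m C (chart_pt P) i)"
      by (simp add: sum_distrib_left mult.assoc del: sum.atMost_Suc)
    finally show "(\<Sum>j\<le>m. y j * chart_pt P j) = 0" using \<mu>(1) lC by simp
  qed
  then have "lin_map m C x \<in> hyperplane_cone {..Suc m} (proj_pt l)" for x
    using lC[of x] C0 by (auto simp: hyperplane_cone_iff cspace_def lin_map_def intro!: sum.neutral)
  then obtain A where A: "\<And>x. lin_map m A x \<in> ?V" "\<And>x. lin_map m C x = lin_map m B (lin_map m A x)"
    using factor_through[OF bij_betw_imp_surj_on[OF B], of C] by blast
  define G where "G = (\<lambda>j. pd j g)"
  define G2 where "G2 = (\<lambda>j k. pd k (pd j g))"
  define G3 where "G3 = (\<lambda>j k l. pd l (pd k (pd j g)))"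
  let ?A = "lin_map m A"
  \<comment> \<open>\<open>A\<close> is an infinitesimal symmetry of \<open>g\<close>. This identity
    is now differentiated twice, in free directions.\<close>
  have E0: "(\<Sum>j\<le>m. eval_poly (G j) x * ?A x j) = 0" if "x \<in> ?V" for x
    unfolding G_def sum_pd_pullback[OF f_polys] using C[OF that] A(2) by simp
  have dA: "dlim (at 0) (\<lambda>t. t) (\<lambda>t. ?A (\<lambda>k. x k + t * z k) j) (?A x j) (?A z j)" for x z j
    unfolding lin_map_linear by (rule dlim_line)
  have dG: "dlim (at 0) (\<lambda>t. t) (\<lambda>t. eval_poly q (\<lambda>k. x k + t * z k)) (eval_poly q x) (\<Sum>k\<le>m. eval_poly (pd k q) x * z k)"
    if "q \<in> polys {..m}" for q x z
    by (intro at0.dlim_eval_poly that dlim_line finite_atMost)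
  note pol = g_polys pd_in_polys[OF g_polys] pd_in_polys[OF pd_in_polys[OF g_polys]]
  \<comment> \<open>At a node the gradient term drops out, and the Hessian pairs Ax with z to
    0.\<close>
  have E1: "(\<Sum>j\<le>m. (\<Sum>k\<le>m. eval_poly (G2 j k) x * z k) * ?A x j + eval_poly (G j) x * ?A z j) = 0"
    if x: "x \<in> ?V" and z: "z \<in> ?V" for x z
  proof -
    have "dlim (at 0) (\<lambda>t. t) (\<lambda>t. \<Sum>j\<le>m. eval_poly (G j) (\<lambda>k. x k + t * z k) * ?A (\<lambda>k. x k + t * z k) j)
        (\<Sum>j\<le>m. eval_poly (G j) x * ?A x j)
        (\<Sum>j\<le>m. (\<Sum>k\<le>m. eval_poly (G2 j k) x * z k) * ?A x j + eval_poly (G j) x * ?A z j)"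
      unfolding G_def G2_def by (intro at0.dlim_sum at0.dlim_mult dA dG pol)
    moreover have "(\<Sum>j\<le>m. eval_poly (G j) (\<lambda>k. x k + t * z k) * ?A (\<lambda>k. x k + t * z k) j) = 0" for t
      using x z by (intro E0) (auto simp: cspace_def)
    ultimately have "dlim (at 0) (\<lambda>t. t) (\<lambda>_. 0) 0 (\<Sum>j\<le>m. (\<Sum>k\<le>m. eval_poly (G2 j k) x * z k) * ?A x j + eval_poly (G j) x * ?A z j)"
      using E0[OF x] by simp
    then show ?thesis using at0.dlim_unique[OF _ at0.dlim_const[of 0]] by simp
  qed
  \<comment> \<open>With a node for \<open>x\<close> and nodes for both directions, this becomes the
    scaling relation \<open>rel\<close>.\<close>
  have E2: "(\<Sum>j\<le>m. ((\<Sum>k\<le>m. (\<Sum>i\<le>m. eval_poly (G3 j k i) x * z i) * y k) * ?A x j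
        + (\<Sum>k\<le>m. eval_poly (G2 j k) x * y k) * ?A z j) + (\<Sum>k\<le>m. eval_poly (G2 j k) x * z k) * ?A y j) = 0"
    if x: "x \<in> ?V" and z: "z \<in> ?V" and y: "y \<in> ?V" for x y z
  proof -
    let ?x = "\<lambda>t k. x k + t * z k"
    have "dlim (at 0) (\<lambda>t. t) (\<lambda>t. \<Sum>j\<le>m. (\<Sum>k\<le>m. eval_poly (G2 j k) (?x t) * y k) * ?A (?x t) j + eval_poly (G j) (?x t) * ?A y j)
        (\<Sum>j\<le>m. (\<Sum>k\<le>m. eval_poly (G2 j k) x * y k) * ?A x j + eval_poly (G j) x * ?A y j)
        (\<Sum>j\<le>m. ((\<Sum>k\<le>m. (\<Sum>i\<le>m. eval_poly (G3 j k i) x * z i) * y k + eval_poly (G2 j k) x * 0) * ?A x j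
        + (\<Sum>k\<le>m. eval_poly (G2 j k) x * y k) * ?A z j) + ((\<Sum>k\<le>m. eval_poly (G2 j k) x * z k) * ?A y j + eval_poly (G j) x * 0))"
      unfolding G_def G2_def G3_def by (intro at0.dlim_sum at0.dlim_add at0.dlim_mult dA dG pol at0.dlim_const)
    moreover have "(\<Sum>j\<le>m. (\<Sum>k\<le>m. eval_poly (G2 j k) (?x t) * y k) * ?A (?x t) j + eval_poly (G j) (?x t) * ?A y j) = 0" for t
      using x z by (intro E1 y) (auto simp: cspace_def)
    ultimately have "dlim (at 0) (\<lambda>t. t) (\<lambda>_. 0) 0 (\<Sum>j\<le>m. ((\<Sum>k\<le>m. (\<Sum>i\<le>m. eval_poly (G3 j k i) x * z i) * y k) * ?A x j
        + (\<Sum>k\<le>m. eval_poly (G2 j k) x * y k) * ?A z j) + (\<Sum>k\<le>m. eval_poly (G2 j k) x * z k) * ?A y j)"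
      using E1[OF x y] by simp
    then show ?thesis using at0.dlim_unique[OF _ at0.dlim_const[of 0]] by simp
  qed
  define H where "H P u v = (\<Sum>j\<le>m. \<Sum>k\<le>m. eval_poly (G2 j k) (p P) * u j * v k)" for P u v
  have Hsym: "H P u v = H P v u" for P u v
    unfolding H_def by (subst sum.swap) (simp add: G2_def pd_commute mult.assoc mult.commute[of "u _"])
  \<comment> \<open>The nodes span, so a vector orthogonal to all of them lies in the kernel of the
    Hessian at \<open>P\<close>, which is the line through \<open>P\<close>.\<close>
  have Hker: "u = (\<lambda>k. u (chart P) * p P k)"
    if P: "P \<in> S" and u: "u \<in> ?V" and z: "\<And>Q. Q \<in> S \<Longrightarrow> H P (p Q) u = 0" for P u
    unfolding p_def
  proof (rule hessian_kernel[OF P u])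
    define q where "q j = (if j \<le> m then \<Sum>k\<le>m. eval_poly (G2 j k) (p P) * u k else 0)" for j
    have "q = (\<lambda>_. 0)"
    proof (rule nodes_span)
      show "q \<in> ?V" by (auto simp: q_def cspace_def)
      fix Q assume Q: "Q \<in> S"
      have "(\<Sum>j\<le>m. q j * chart_pt Q j) = H P (p Q) u"
        unfolding H_def by (intro sum.cong refl) (simp add: q_def p_def sum_distrib_left sum_distrib_right mult_ac)
      then show "(\<Sum>j\<le>m. q j * chart_pt Q j) = 0" using z[OF Q] by simp
    qed
    then have q: "q j = 0" for j by simp
    fix j assume "j \<le> m"
    then show "(\<Sum>k\<le>m. eval_poly (pd j (pd k g)) (chart_pt P) * u k) = 0"
      using q[of j] by (simp add: q_def G2_def p_def pd_commute[of j])
  qed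
  have Hp: "H P u (p P) = 0" if P: "P \<in> S" for P u
  proof -
    have "(\<Sum>k\<le>m. eval_poly (G2 j k) (p P) * p P k) = 0" if "j \<le> m" for j
      using euler_pd[OF _ g_forms, of j "p P"] S_sing(2)[OF P that] by (simp add: G2_def p_def)
    then have "(\<Sum>k\<le>m. eval_poly (G2 j k) (p P) * u j * p P k) = 0" if "j \<le> m" for j
      using that by (simp add: mult.commute[of _ "u j"] mult.assoc flip: sum_distrib_left)
    then show ?thesis by (simp add: H_def)
  qed
  \<comment> \<open>The eigenvalue is read off in the chart coordinate, where the node has entry
    1.\<close>
  define a where "a P = ?A (p P) (chart P)" for P
  have eig: "?A (p P) = (\<lambda>k. a P * p P k)" if P: "P \<in> S" for P
    unfolding a_def
  proof (rule Hker[OF P A(1)])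
    fix Q assume Q: "Q \<in> S"
    have "H P (p Q) (?A (p P)) = H P (?A (p P)) (p Q)" by (rule Hsym)
    also have "\<dots> = (\<Sum>j\<le>m. (\<Sum>k\<le>m. eval_poly (G2 j k) (p P) * p Q k) * ?A (p P) j + eval_poly (G j) (p P) * ?A (p Q) j)"
      unfolding H_def using S_sing(2)[OF P]
      by (intro sum.cong refl) (simp add: G_def p_def sum_distrib_left sum_distrib_right mult_ac)
    also have "\<dots> = 0" by (rule E1[OF p[OF P] p[OF Q]])
    finally show "H P (p Q) (?A (p P)) = 0" .
  qed
  have rel: "(of_nat (d - 2) * a P + a Q + a R) * H P (p Q) (p R) = 0"
    if P: "P \<in> S" and Q: "Q \<in> S" and R: "R \<in> S" for P Q R
  proof -
    \<comment> \<open>The second derivatives are forms of degree d - 2, so Euler's identity turns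
      the third derivative contracted with the node into a multiple of the Hessian.\<close>
    have third: "(\<Sum>j\<le>m. (\<Sum>k\<le>m. (\<Sum>i\<le>m. eval_poly (G3 j k i) (p P) * p R i) * p Q k) * ?A (p P) j)
        = of_nat (d - 2) * a P * H P (p Q) (p R)"
    proof -
      have "(\<Sum>j\<le>m. (\<Sum>k\<le>m. (\<Sum>i\<le>m. eval_poly (G3 j k i) (p P) * p R i) * p Q k) * ?A (p P) j)
          = (\<Sum>j\<le>m. \<Sum>k\<le>m. \<Sum>i\<le>m. eval_poly (G3 j k i) (p P) * p P j * (a P * p Q k * p R i))"
        unfolding eig[OF P] sum_distrib_right by (simp add: mult_ac)
      also have "\<dots> = (\<Sum>k\<le>m. \<Sum>j\<le>m. \<Sum>i\<le>m. eval_poly (G3 j k i) (p P) * p P j * (a P * p Q k * p R i))"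
        by (rule sum.swap)
      also have "\<dots> = (\<Sum>k\<le>m. \<Sum>i\<le>m. \<Sum>j\<le>m. eval_poly (G3 j k i) (p P) * p P j * (a P * p Q k * p R i))"
        by (intro sum.cong refl sum.swap)
      also have "\<dots> = (\<Sum>k\<le>m. \<Sum>i\<le>m. (\<Sum>j\<le>m. eval_poly (G3 j k i) (p P) * p P j) * (a P * p Q k * p R i))"
        by (simp add: sum_distrib_right)
      also have "\<dots> = (\<Sum>k\<le>m. \<Sum>i\<le>m. (of_nat (d - 2) * eval_poly (G2 k i) (p P)) * (a P * p Q k * p R i))"
      proof (intro sum.cong refl arg_cong2[of _ _ _ _ "(*)"])
        fix k i
        have "G3 j k i = pd j (pd i (pd k g))" for j
          unfolding G3_def by (metis pd_commute)
        then show "(\<Sum>j\<le>m. eval_poly (G3 j k i) (p P) * p P j) = of_nat (d - 2) * eval_poly (G2 k i) (p P)"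
          using euler_pd[OF finite_atMost pd_in_forms[OF g_forms, of k], of i "p P"]
          by (simp add: G2_def numeral_2_eq_2)
      qed
      also have "\<dots> = of_nat (d - 2) * a P * H P (p Q) (p R)"
        by (simp add: H_def sum_distrib_left mult_ac)
      finally show ?thesis .
    qed
    have snd: "(\<Sum>j\<le>m. (\<Sum>k\<le>m. eval_poly (G2 j k) (p P) * p X k) * ?A (p Y) j) = a Y * H P (p X) (p Y)"
      if "Y \<in> S" for X Y
    proof -
      have "(\<Sum>j\<le>m. (\<Sum>k\<le>m. eval_poly (G2 j k) (p P) * p X k) * ?A (p Y) j) = a Y * H P (p Y) (p X)"
        unfolding eig[OF that] H_def by (simp add: sum_distrib_left sum_distrib_right mult_ac)
      then show ?thesis using Hsym by simp
    qed
    have "of_nat (d - 2) * a P * H P (p Q) (p R) + a R * H P (p Q) (p R) + a Q * H P (p R) (p Q) = 0"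
      using E2[OF p[OF P] p[OF R] p[OF Q]] unfolding sum.distrib third snd[OF R] snd[OF Q] .
    then show ?thesis using Hsym[of P "p R"] by (simp add: algebra_simps)
  qed
  \<comment> \<open>The trace is taken over the other \<open>m\<close> nodes. Modulo
    \<open>P\<close> they form a basis, so the Hessian at \<open>P\<close> is nondegenerate on
    them.\<close>
  have tr: "of_nat m * (of_nat (d - 2) * a P) + 2 * (\<Sum>Q\<in>S - {P}. a Q) = 0" if P: "P \<in> S" for P
  proof -
    have "of_nat (card (S - {P})) * (of_nat (d - 2) * a P) + 2 * (\<Sum>Q\<in>S - {P}. a Q) = 0"
    proof (rule trace_identity[where \<beta> = "\<lambda>Q R. H P (p Q) (p R)"])
      show "finite (S - {P})" using finite_S by simp
      show "H P (p Q) (p R) = H P (p R) (p Q)" for Q R by (rule Hsym)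
      show "(of_nat (d - 2) * a P + a Q + a R) * H P (p Q) (p R) = 0" if "Q \<in> S - {P}" "R \<in> S - {P}" for Q R
        using rel that P by blast
      fix w assume w: "w \<in> cspace (S - {P})" "\<forall>Q\<in>S - {P}. (\<Sum>R\<in>S - {P}. H P (p Q) (p R) * w R) = 0"
      define W where "W k = (\<Sum>R\<in>S - {P}. w R * p R k)" for k
      have W: "W \<in> ?V" using p by (auto simp: W_def cspace_def intro!: sum.neutral)
      have HW: "H P u W = (\<Sum>R\<in>S - {P}. H P u (p R) * w R)" for u
      proof -
        have "H P u W = (\<Sum>j\<le>m. \<Sum>k\<le>m. \<Sum>R\<in>S - {P}. eval_poly (G2 j k) (p P) * u j * p R k * w R)"
          by (simp add: H_def W_def sum_distrib_left mult_ac)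
        also have "\<dots> = (\<Sum>j\<le>m. \<Sum>R\<in>S - {P}. \<Sum>k\<le>m. eval_poly (G2 j k) (p P) * u j * p R k * w R)"
          by (intro sum.cong refl sum.swap)
        also have "\<dots> = (\<Sum>R\<in>S - {P}. \<Sum>j\<le>m. \<Sum>k\<le>m. eval_poly (G2 j k) (p P) * u j * p R k * w R)"
          by (rule sum.swap)
        finally show ?thesis by (simp add: H_def sum_distrib_right)
      qed
      have Wp: "W = (\<lambda>k. W (chart P) * p P k)"
      proof (rule Hker[OF P W])
        fix Q assume Q: "Q \<in> S"
        show "H P (p Q) W = 0"
        proof (cases "Q = P")
          case True
          then show ?thesis using Hsym[of P "p P" W] Hp[OF P] by simp
        next
          case False
          then show ?thesis using HW w(2) Q by simp
        qed
      qed
      \<comment> \<open>A combination of the other nodes that is null for the Hessian is a multiple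
        of \<open>p P\<close>; moving that multiple over gives a linear relation among all
        nodes.\<close>
      define w' where "w' = w(P := - W (chart P))"
      have "w' R = 0" if "R \<in> S" for R
      proof (rule spanning_imp_independent[of S "{..m}" p w' R])
        show "card S = card {..m}" using card_S by simp
        show "y = (\<lambda>_. 0)" if "y \<in> ?V" "\<forall>P\<in>S. (\<Sum>j\<le>m. y j * p P j) = 0" for y
          using nodes_span[OF that(1)] that(2) by (simp add: p_def)
        show "\<forall>j\<in>{..m}. (\<Sum>R\<in>S. w' R * p R j) = 0"
        proof
          fix j
          have "(\<Sum>R\<in>S. w' R * p R j) = w' P * p P j + (\<Sum>R\<in>S - {P}. w' R * p R j)"
            using P finite_S by (simp add: sum.remove)
          also have "(\<Sum>R\<in>S - {P}. w' R * p R j) = W j"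
            unfolding W_def by (intro sum.cong) (auto simp: w'_def)
          also have "W j = W (chart P) * p P j" using Wp by (rule fun_cong)
          finally show "(\<Sum>R\<in>S. w' R * p R j) = 0" by (simp add: w'_def)
        qed
      qed (use finite_S that in auto)
      then have "w R = 0" if "R \<in> S - {P}" for R
        using that unfolding w'_def by (metis DiffE fun_upd_other singletonI)
      then show "w = (\<lambda>_. 0)" using w(1) by (auto simp: cspace_def)
    qed
    then show ?thesis using P finite_S card_S by simp
  qed
  \<comment> \<open>In terms of the total \<open>s\<close>, all \<open>a P\<close> satisfy the same
    equation. Summing it over the \<open>m + 1\<close> nodes shows \<open>s = 0\<close>.\<close>
  define s where "s = (\<Sum>Q\<in>S. a Q)"
  have as: "(of_nat (m * (d - 2)) - 2) * a P = - 2 * s" if "P \<in> S" for P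
  proof -
    have "s = a P + (\<Sum>Q\<in>S - {P}. a Q)" using that finite_S by (simp add: s_def sum.remove)
    then show ?thesis using tr[OF that] unfolding of_nat_mult by (simp add: algebra_simps)
  qed
  have nz: "(of_nat (m * (d - 2)) - 2 :: complex) \<noteq> 0"
  proof
    assume "(of_nat (m * (d - 2)) - 2 :: complex) = 0"
    then have "(of_nat (m * (d - 2)) :: complex) = of_nat 2" by simp
    then have "m * (d - 2) = 2" by (simp only: of_nat_eq_iff)
    then show False using m by simp
  qed
  have "s = 0"
  proof -
    have "(of_nat (m * (d - 2)) - 2) * s = (\<Sum>P\<in>S. - 2 * s)"
    proof -
      have "(of_nat (m * (d - 2)) - 2) * s = (\<Sum>P\<in>S. (of_nat (m * (d - 2)) - 2) * a P)"
        unfolding s_def by (rule sum_distrib_left)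
      also have "\<dots> = (\<Sum>P\<in>S. - 2 * s)" by (rule sum.cong[OF refl as])
      finally show ?thesis .
    qed
    also have "\<dots> = - 2 * of_nat (Suc m) * s" using card_S by (simp add: algebra_simps)
    finally have "(of_nat (m * (d - 2)) + 2 * of_nat m) * s = 0"
      unfolding of_nat_mult by (simp add: algebra_simps)
    moreover have "(of_nat (m * (d - 2)) + 2 * of_nat m :: complex) = of_nat (m * (d - 2) + 2 * m)" by simp
    then have "(of_nat (m * (d - 2)) + 2 * of_nat m :: complex) \<noteq> 0"
      using m(1) by (simp only: of_nat_eq_0_iff)
    ultimately show ?thesis by simp
  qed
  then have "a P = 0" if "P \<in> S" for P using as[OF that] nz by simp
  then have Ap: "?A (p P) = (\<lambda>_. 0)" if "P \<in> S" for P using eig[OF that] that by simp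
  have "?A x = (\<lambda>_. 0)" for x
  proof -
    have "(\<lambda>k. if k \<le> m then A j k else 0) = (\<lambda>_. 0)" for j
    proof (rule nodes_span)
      fix P assume "P \<in> S"
      then show "(\<Sum>k\<le>m. (if k \<le> m then A j k else 0) * chart_pt P k) = 0"
        using fun_cong[OF Ap, of P j] by (simp add: lin_map_def p_def)
    qed (auto simp: cspace_def)
    then have "A j k = 0" if "k \<le> m" for j k using that by (metis (full_types))
    then show ?thesis by (simp add: lin_map_def fun_eq_iff)
  qed
  then have "lin_map m C x = (\<lambda>_. 0)" for x using A(2) by simp
  then show ?thesis
    using lin_map_unit[of k m C i] C0[of i k] by (cases "k \<le> m") (auto simp: not_le)
qed

end

section \<open>Existence and openness of smooth sections\<close>

lemma tendsto_eval_poly: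
  assumes "p \<in> polys I" "\<And>i. i \<in> I \<Longrightarrow> (X i \<longlongrightarrow> x i) F"
  shows "((\<lambda>k. eval_poly p (\<lambda>i. X i k)) \<longlongrightarrow> eval_poly p x) F"
  using assms(1)
  by (induction rule: polys_induct) (auto simp: eval_poly_add eval_poly_mult assms(2) intro!: tendsto_intros)

text \<open>Bolzano-Weierstrass, one coordinate at a time.\<close>

lemma convergent_subsequence:
  fixes q :: "nat \<Rightarrow> 'j \<Rightarrow> complex"
  assumes "finite J" "\<And>j. j \<in> J \<Longrightarrow> bounded (range (\<lambda>k. q k j))"
  shows "\<exists>s l. strict_mono (s :: nat \<Rightarrow> nat) \<and> (\<forall>j\<in>J. (\<lambda>k. q (s k) j) \<longlonglongrightarrow> l j)"
  using assms
proof (induction J rule: finite_induct)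
  case empty
  then show ?case by (auto intro: strict_mono_id exI[of _ id])
next
  case (insert j J)
  then obtain s l where s: "strict_mono s" "\<forall>j\<in>J. (\<lambda>k. q (s k) j) \<longlonglongrightarrow> l j" by auto
  have "bounded (range (\<lambda>k. q (s k) j))"
    by (rule bounded_subset[of "range (\<lambda>k. q k j)"]) (use insert.prems in auto)
  then obtain x r where r: "strict_mono (r :: nat \<Rightarrow> nat)" "((\<lambda>k. q (s k) j) \<circ> r) \<longlonglongrightarrow> x"
    using bounded_imp_convergent_subsequence by blast
  have "(\<lambda>k. q ((s \<circ> r) k) i) \<longlonglongrightarrow> (l(j := x)) i" if "i \<in> insert j J" for i
  proof (cases "i = j")
    case True
    then show ?thesis using r(2) by (simp add: o_def)
  next
    case False
    then show ?thesis using s(2) that LIMSEQ_subseq_LIMSEQ[OF _ r(1), of "\<lambda>k. q (s k) i" "l i"]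
      by (simp add: o_def)
  qed
  then show ?case using strict_mono_o[OF s(1) r(1)] by blast
qed

text \<open>The equations of a singular point of the section, written out jointly in the matrix and
  the point so that limits can be taken in both at once.\<close>

definition crit :: "nat \<Rightarrow> nat \<Rightarrow> nat mpoly \<Rightarrow> (nat \<Rightarrow> nat \<Rightarrow> complex) \<Rightarrow> (nat \<Rightarrow> complex) \<Rightarrow> bool" where
  "crit n m f B x \<longleftrightarrow> eval_poly f (lin_map m B x) = 0 \<and>
     (\<forall>j\<le>m. (\<Sum>i\<le>n. eval_poly (pd i f) (lin_map m B x) * B i j) = 0)"

lemma crit_iff:
  assumes "f \<in> forms {..n} d"
  shows "crit n m f B x \<longleftrightarrow> eval_poly (pullback_form m B f) x = 0 \<and>
    (\<forall>j\<le>m. eval_poly (pd j (pullback_form m B f)) x = 0)"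
  using eval_pd_pullback[OF subsetD[OF forms_subset_polys assms]] by (auto simp: crit_def eval_pullback)

lemma crit_scale:
  assumes "f \<in> forms {..n} d" "crit n m f B x"
  shows "crit n m f B (\<lambda>k. c * x k)"
  using assms(2) unfolding crit_iff[OF assms(1)]
  by (simp add: eval_forms_scale[OF pullback_in_forms[OF assms(1)]]
      eval_forms_scale[OF pd_in_forms[OF pullback_in_forms[OF assms(1)]]])

lemma Sing_pullback_empty_iff:
  assumes "f \<in> forms {..n} d"
  shows "Sing {..m} (pullback_form m B f) = {} \<longleftrightarrow> (\<forall>x\<in>cspace {..m}. crit n m f B x \<longrightarrow> x = (\<lambda>_. 0))"
  unfolding Sing_empty_iff[OF pullback_in_forms[OF assms]] crit_iff[OF assms] by auto

text \<open>Compactness of projective space: singular vectors are rescaled to largest modulus 1, a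
  subsequence converges, and the equations pass to the limit.\<close>

lemma singular_limit:
  assumes f: "f \<in> forms {..n} d"
    and sing: "\<And>k. Sing {..m} (pullback_form m (Bs k) f) \<noteq> {}"
    and lim: "\<And>i j. (\<lambda>k. Bs k i j) \<longlonglongrightarrow> B i j"
  shows "\<exists>s q p. strict_mono (s :: nat \<Rightarrow> nat) \<and> (\<forall>k. q k \<in> cspace {..m} \<and> crit n m f (Bs (s k)) (q k)) \<and>
    (\<forall>j. (\<lambda>k. q k j) \<longlonglongrightarrow> p j) \<and> p \<in> cspace {..m} \<and> p \<noteq> (\<lambda>_. 0) \<and> crit n m f B p"
proof -
  \<comment> \<open>The lower bound on the sum is a closed condition, so it keeps the limit away
    from zero.\<close>
  have "\<exists>x\<in>cspace {..m}. crit n m f (Bs k) x \<and> (\<forall>j. norm (x j) \<le> 1) \<and> 1 \<le> (\<Sum>j\<le>m. norm (x j))" for k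
  proof -
    obtain x where x: "x \<in> cspace {..m}" "crit n m f (Bs k) x" "x \<noteq> (\<lambda>_. 0)"
      using sing[of k] Sing_pullback_empty_iff[OF f] by blast
    define M where "M = Max ((\<lambda>j. norm (x j)) ` {..m})"
    have le: "norm (x j) \<le> M" if "j \<le> m" for j unfolding M_def using that by (intro Max_ge) auto
    obtain j1 where "x j1 \<noteq> 0" using x(3) by auto
    moreover from this have "j1 \<le> m" using x(1) by (auto simp: cspace_def)
    ultimately have j1: "x j1 \<noteq> 0" "j1 \<le> m" .
    have M: "M > 0" using le[OF j1(2)] j1 by (meson less_le_trans zero_less_norm_iff)
    have "M \<in> (\<lambda>j. norm (x j)) ` {..m}" unfolding M_def by (intro Max_in) auto
    then obtain j0 where j0: "j0 \<le> m" "norm (x j0) = M" by auto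
    define y where "y j = (1 / complex_of_real M) * x j" for j
    have "crit n m f (Bs k) y" unfolding y_def by (rule crit_scale[OF f x(2)])
    moreover have "y \<in> cspace {..m}" using x(1) by (auto simp: y_def cspace_def)
    moreover have "norm (y j) \<le> 1" for j
      using le[of j] M x(1) by (cases "j \<le> m") (auto simp: y_def norm_mult norm_divide cspace_def field_simps)
    moreover have "norm (y j0) \<le> (\<Sum>j\<le>m. norm (y j))" using j0 by (intro member_le_sum) auto
    then have "1 \<le> (\<Sum>j\<le>m. norm (y j))" using j0 M by (simp add: y_def norm_mult norm_divide)
    ultimately show ?thesis by blast
  qed
  then obtain q where q: "\<And>k. q k \<in> cspace {..m}" "\<And>k. crit n m f (Bs k) (q k)"
    "\<And>k j. norm (q k j) \<le> 1" "\<And>k. 1 \<le> (\<Sum>j\<le>m. norm (q k j))" by metis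
  have "bounded (range (\<lambda>k. q k j))" for j
    using q(3) by (auto intro!: boundedI)
  then obtain s l where s: "strict_mono s" "\<forall>j\<in>{..m}. (\<lambda>k. q (s k) j) \<longlonglongrightarrow> l j"
    using convergent_subsequence[of "{..m}" q] by blast
  define p where "p j = (if j \<le> m then l j else 0)" for j
  have qp: "(\<lambda>k. q (s k) j) \<longlonglongrightarrow> p j" for j
    using s(2) q(1) by (cases "j \<le> m") (auto simp: p_def cspace_def)
  have Bl: "(\<lambda>k. Bs (s k) i j) \<longlonglongrightarrow> B i j" for i j
    using LIMSEQ_subseq_LIMSEQ[OF lim s(1)] by (simp add: o_def)
  have z: "(\<lambda>k. lin_map m (Bs (s k)) (q (s k)) i) \<longlonglongrightarrow> lin_map m B p i" for i
    unfolding lin_map_def by (intro tendsto_intros Bl qp)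
  have fp: "f \<in> polys {..n}" using f forms_subset_polys by blast
  have "crit n m f B p"
    unfolding crit_def
  proof (intro conjI allI impI)
    have "(\<lambda>k. eval_poly f (lin_map m (Bs (s k)) (q (s k)))) \<longlonglongrightarrow> eval_poly f (lin_map m B p)"
      by (rule tendsto_eval_poly[OF fp]) (rule z)
    then show "eval_poly f (lin_map m B p) = 0"
      using q(2) by (simp add: crit_def LIMSEQ_const_iff)
    fix j assume j: "j \<le> m"
    have "(\<lambda>k. \<Sum>i\<le>n. eval_poly (pd i f) (lin_map m (Bs (s k)) (q (s k))) * Bs (s k) i j)
        \<longlonglongrightarrow> (\<Sum>i\<le>n. eval_poly (pd i f) (lin_map m B p) * B i j)"
      by (intro tendsto_sum tendsto_mult Bl) (rule tendsto_eval_poly[OF pd_in_polys[OF fp]], rule z)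
    then show "(\<Sum>i\<le>n. eval_poly (pd i f) (lin_map m B p) * B i j) = 0"
      using q(2) j by (simp add: crit_def LIMSEQ_const_iff)
  qed
  moreover have "p \<noteq> (\<lambda>_. 0)"
  proof
    assume "p = (\<lambda>_. 0)"
    have "(\<lambda>k. \<Sum>j\<le>m. norm (q (s k) j)) \<longlonglongrightarrow> (\<Sum>j\<le>m. norm (p j))" by (intro tendsto_intros qp)
    then have "1 \<le> (\<Sum>j\<le>m. norm (p j))" by (rule LIMSEQ_le_const) (use q(4) in blast)
    then show False using \<open>p = (\<lambda>_. 0)\<close> by simp
  qed
  moreover have "p \<in> cspace {..m}" by (auto simp: p_def cspace_def)
  ultimately show ?thesis using s(1) q(1,2) qp by (intro exI[of _ s] exI[of _ "\<lambda>k. q (s k)"] exI[of _ p]) auto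
qed

text \<open>Singular sections with parameters tending to 0 would produce, in the limit, a singular
  point of the section by \<open>B\<close>.\<close>

lemma smooth_nearby:
  assumes f: "f \<in> forms {..n} d" and smooth: "Sing {..m} (pullback_form m B f) = {}"
  shows "\<exists>e>0. \<forall>t. norm t < e \<longrightarrow> Sing {..m} (pullback_form m (\<lambda>i j. B i j + t * C i j) f) = {}"
proof (rule ccontr)
  assume neg: "\<not> ?thesis"
  have "\<forall>k. \<exists>t. norm t < inverse (real (Suc k)) \<and> Sing {..m} (pullback_form m (\<lambda>i j. B i j + t * C i j) f) \<noteq> {}"
  proof
    fix k
    have "inverse (real (Suc k)) > 0" by simp
    then show "\<exists>t. norm t < inverse (real (Suc k)) \<and> Sing {..m} (pullback_form m (\<lambda>i j. B i j + t * C i j) f) \<noteq> {}"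
      using neg by blast
  qed
  from choice[OF this] obtain t where "\<forall>k. norm (t k) < inverse (real (Suc k)) \<and>
    Sing {..m} (pullback_form m (\<lambda>i j. B i j + t k * C i j) f) \<noteq> {}" ..
  then have t: "\<And>k. norm (t k) < inverse (real (Suc k))"
    "\<And>k. Sing {..m} (pullback_form m (\<lambda>i j. B i j + t k * C i j) f) \<noteq> {}" by blast+
  have "t \<longlonglongrightarrow> 0"
    by (rule Lim_null_comparison[OF _ LIMSEQ_inverse_real_of_nat])
      (use t(1) in \<open>auto intro!: always_eventually less_imp_le\<close>)
  then have "(\<lambda>k. B i j + t k * C i j) \<longlonglongrightarrow> B i j + 0 * C i j" for i j by (intro tendsto_intros)
  then have lim: "\<And>i j. (\<lambda>k. B i j + t k * C i j) \<longlonglongrightarrow> B i j" by simp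
  then have "\<exists>p. p \<in> cspace {..m} \<and> p \<noteq> (\<lambda>_. 0) \<and> crit n m f B p"
    using singular_limit[where B = B and Bs = "\<lambda>k i j. B i j + t k * C i j", OF f t(2) lim] by blast
  then show False using smooth Sing_pullback_empty_iff[OF f] by blast
qed

section \<open>Smoothing the nodal section to first order\<close>

context nodal_section
begin

text \<open>Finitely many proper subspaces do not cover the space of linear forms, so some form is
  nonzero at every node. A single nonzero row of \<open>C\<close> makes l(Cx) equal to it.\<close>

lemma transversal_direction: "\<exists>C. \<forall>P\<in>S. (\<Sum>i\<le>Suc m. l i * lin_map m C (chart_pt P) i) \<noteq> 0"
proof -
  have "\<exists>y\<in>cspace {..m}. \<forall>P\<in>S. (\<Sum>j\<le>m. chart_pt P j * y j) \<noteq> 0"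
  proof (rule linepoly_common_nonzero[OF finite_S, of "\<lambda>_. 1"])
    show "linepoly 1 (\<lambda>y. \<Sum>j\<le>m. chart_pt P j * y j)" for P
      by (intro linepoly_sum linepoly_cmult linepoly_proj)
    fix P assume P: "P \<in> S"
    note p = chart_pt_props[OF S_proj[OF P]]
    have "(\<Sum>j\<le>m. chart_pt P j * (if j = chart P then 1 else 0)) = 1"
      using p by (simp add: if_distrib[of "\<lambda>z. _ * z"] cong: if_cong)
    moreover have "(\<lambda>j. if j = chart P then 1 else 0) \<in> cspace {..m}" using p(3) by (auto simp: cspace_def)
    ultimately show "\<exists>y\<in>cspace {..m}. (\<Sum>j\<le>m. chart_pt P j * y j) \<noteq> 0" by (intro bexI) auto
  qed
  then obtain y where y: "\<forall>P\<in>S. (\<Sum>j\<le>m. chart_pt P j * y j) \<noteq> 0" by blast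
  obtain c where c: "l c \<noteq> 0" using l(2) by auto
  then have cm: "c \<le> Suc m" using l(1) by (auto simp: cspace_def)
  define C where "C i k = (if i = c then y k / l c else 0)" for i k
  have "(\<Sum>i\<le>Suc m. l i * lin_map m C x i) = (\<Sum>j\<le>m. x j * y j)" for x
  proof -
    have "(\<Sum>i\<le>Suc m. l i * lin_map m C x i) = (\<Sum>i\<le>Suc m. if i = c then \<Sum>j\<le>m. x j * y j else 0)"
      using c by (intro sum.cong refl) (auto simp: lin_map_def C_def sum_distrib_left intro!: sum.cong)
    then show ?thesis using cm by (simp del: sum.atMost_Suc)
  qed
  then show ?thesis using y by (intro exI[of _ C]) simp
qed

text \<open>If the sections by B + T C stayed singular, their singular points would converge to a
  node. Displacement and parameter, rescaled to total size 1, have a limit (w, \<tau>).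
  Transversality gives \<tau> = 0 and the nondegenerate Hessian then gives w = 0, a
  contradiction.\<close>

lemma smooth_section_exists: "\<exists>B'. Sing {..m} (pullback_form m B' f) = {}"
proof (rule ccontr)
  assume neg: "\<not> ?thesis"
  obtain C where C: "\<And>P. P \<in> S \<Longrightarrow> (\<Sum>i\<le>Suc m. l i * lin_map m C (chart_pt P) i) \<noteq> 0"
    using transversal_direction by blast
  define T where "T k = inverse (real (Suc k))" for k
  have Tlim: "T \<longlonglongrightarrow> 0" unfolding T_def by (rule LIMSEQ_inverse_real_of_nat)
  define Bs where "Bs k i j = B i j + of_real (T k) * C i j" for k i j
  have "(\<lambda>k. Bs k i j) \<longlonglongrightarrow> B i j + of_real 0 * C i j" for i j
    unfolding Bs_def by (intro tendsto_intros Tlim)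
  then have Bl: "\<And>i j. (\<lambda>k. Bs k i j) \<longlonglongrightarrow> B i j" by simp
  obtain s q p where s: "strict_mono s" and q: "\<And>k. q k \<in> cspace {..m}" "\<And>k. crit (Suc m) m f (Bs (s k)) (q k)"
    and qp: "\<And>j. (\<lambda>k. q k j) \<longlonglongrightarrow> p j" and p: "p \<in> cspace {..m}" "p \<noteq> (\<lambda>_. 0)" "crit (Suc m) m f B p"
    using singular_limit[OF f _ Bl] neg by meson
  define P where "P = proj_pt p"
  have P: "P \<in> S" unfolding P_def Sing_iff[OF g_forms p(1,2)] using p(3) crit_iff[OF f] by auto
  define c where "c = chart P"
  define h where "h = chart_pt P"
  note hp = chart_pt_props[OF S_proj[OF P], folded h_def c_def]
  have "p \<in> proj_pt h" using hp(4) P_def by (metis proj_pt_self)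
  then obtain e where e: "e \<noteq> 0" "p = (\<lambda>i. e * h i)" unfolding mem_proj_pt by blast
  have pc: "p c = e" using e hp(2) by simp
  \<comment> \<open>Chart coordinate 1 fixes the scale of the moving point. It is reached only for
    large \<open>k\<close>; where \<open>q k c = 0\<close>, division by zero gives the zero vector,
    which still satisfies \<open>crit\<close>.\<close>
  define Q where "Q k j = (1 / q k c) * q k j" for k j
  have Qh: "(\<lambda>k. Q k j) \<longlonglongrightarrow> h j" for j
  proof -
    have "(\<lambda>k. Q k j) \<longlonglongrightarrow> (1 / p c) * p j"
      unfolding Q_def using pc e by (intro tendsto_intros qp) auto
    moreover have "(1 / p c) * p j = h j" unfolding pc using e by simp
    ultimately show ?thesis by simp
  qed
  have "eventually (\<lambda>k. q k c \<noteq> 0) sequentially"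
    using tendsto_imp_eventually_ne[OF qp] pc e by simp
  then have Qc: "eventually (\<lambda>k. Q k c = 1) sequentially"
    by eventually_elim (simp add: Q_def)
  have Qcrit: "crit (Suc m) m f (Bs (s k)) (Q k)" for k
    unfolding Q_def by (rule crit_scale[OF f q(2)])
  \<comment> \<open>The joint size of displacement and parameter; including \<open>T\<close> keeps
    it positive.\<close>
  define r where "r k = (\<Sum>j\<le>m. norm (Q k j - h j)) + T (s k)" for k
  have Tpos: "T k > 0" for k by (simp add: T_def)
  have rpos: "r k > 0" for k using Tpos[of "s k"] by (simp add: r_def add_nonneg_pos sum_nonneg)
  have Ts: "(\<lambda>k. T (s k)) \<longlonglongrightarrow> 0" using LIMSEQ_subseq_LIMSEQ[OF Tlim s] by (simp add: o_def)
  have "r \<longlonglongrightarrow> (\<Sum>j\<le>m. norm (h j - h j)) + 0" unfolding r_def by (intro tendsto_intros Qh Ts)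
  then have r0: "r \<longlonglongrightarrow> 0" by simp
  \<comment> \<open>Slot \<open>Suc m\<close> holds the parameter, so one subsequence serves
    both.\<close>
  define H where "H k j = (if j \<le> m then (Q k j - h j) / of_real (r k) else of_real (T (s k)) / of_real (r k))" for k j
  have "norm (H k j) \<le> 1" for k j
  proof (cases "j \<le> m")
    case True
    have "norm (Q k j - h j) \<le> (\<Sum>j\<le>m. norm (Q k j - h j))" using True by (intro member_le_sum) auto
    then have "norm (Q k j - h j) \<le> r k" using Tpos[of "s k"] by (simp add: r_def)
    then show ?thesis using True rpos[of k] by (simp add: H_def norm_divide)
  next
    case False
    have "T (s k) \<le> r k" by (simp add: r_def sum_nonneg)
    then show ?thesis using False rpos[of k] Tpos[of "s k"] by (simp add: H_def norm_divide)
  qed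
  then have "bounded (range (\<lambda>k. H k j))" for j by (auto intro!: boundedI)
  then obtain s' w' where s': "strict_mono s'" "\<forall>j\<in>{..Suc m}. (\<lambda>k. H (s' k) j) \<longlonglongrightarrow> w' j"
    using convergent_subsequence[of "{..Suc m}" H] by blast
  define w where "w j = (if j \<le> m then w' j else 0)" for j
  define \<tau> where "\<tau> = w' (Suc m)"
  let ?R = "\<lambda>k. complex_of_real (r (s' k))"
  interpret infinitesimal sequentially ?R
  proof
    show "eventually (\<lambda>k. ?R k \<noteq> 0) sequentially" using rpos by (auto simp: less_imp_neq[symmetric])
    have "(\<lambda>k. r (s' k)) \<longlonglongrightarrow> 0" using LIMSEQ_subseq_LIMSEQ[OF r0 s'(1)] by (simp add: o_def)
    from tendsto_of_real[OF this] show "?R \<longlonglongrightarrow> 0" by simp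
  qed
  let ?d = "dlim sequentially ?R"
  have wh: "w \<in> cspace {..m}" "h \<in> cspace {..m}" using hp(1) by (auto simp: w_def cspace_def)
  have dQ: "?d (\<lambda>k. Q (s' k) j) (h j) (w j)" if "j \<le> m" for j
    using bspec[OF s'(2), of j] that by (simp add: dlim_def H_def w_def)
  have dT: "?d (\<lambda>k. of_real (T (s (s' k)))) 0 \<tau>"
    using bspec[OF s'(2), of "Suc m"] by (simp add: dlim_def H_def \<tau>_def)
  have dB: "?d (\<lambda>k. Bs (s (s' k)) i j) (B i j) (\<tau> * C i j)" for i j
    using dlim_add[OF dlim_const[of "B i j"] dlim_mult[OF dT dlim_const[of "C i j"]]] by (simp add: Bs_def)
  define z' where "z' i = \<tau> * lin_map m C h i + lin_map m B w i" for i
  have dz: "?d (\<lambda>k. lin_map m (Bs (s (s' k))) (Q (s' k)) i) (lin_map m B h i) (z' i)" for i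
  proof -
    have "?d (\<lambda>k. \<Sum>j\<le>m. Bs (s (s' k)) i j * Q (s' k) j) (\<Sum>j\<le>m. B i j * h j) (\<Sum>j\<le>m. \<tau> * C i j * h j + B i j * w j)"
      by (intro dlim_sum dlim_mult dB dQ) simp
    moreover have "(\<Sum>j\<le>m. \<tau> * C i j * h j + B i j * w j) = z' i"
      by (simp add: z'_def lin_map_def sum.distrib sum_distrib_left mult.assoc)
    ultimately show ?thesis by (simp add: lin_map_def)
  qed
  obtain \<mu> where \<mu>: "\<mu> \<noteq> 0" "\<And>i. i \<le> Suc m \<Longrightarrow> eval_poly (pd i f) (lin_map m B h) = \<mu> * l i"
    using gradient_at_node[OF P] unfolding h_def by blast
  \<comment> \<open>First order of f(Bx) = 0: the gradient at the node is a multiple of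
    \<open>l\<close>, which kills the image of \<open>B\<close> but not the image of
    \<open>h\<close> under \<open>C\<close>.\<close>
  have \<tau>: "\<tau> = 0"
  proof -
    have "?d (\<lambda>k. eval_poly f (lin_map m (Bs (s (s' k))) (Q (s' k)))) (eval_poly f (lin_map m B h))
        (\<Sum>i\<le>Suc m. eval_poly (pd i f) (lin_map m B h) * z' i)"
      by (rule dlim_eval_poly[OF finite_atMost f_polys dz])
    moreover have "eval_poly f (lin_map m B h) = 0" using S_sing(1)[OF P] by (simp add: eval_pullback h_def)
    moreover have "eval_poly f (lin_map m (Bs (s (s' k))) (Q (s' k))) = 0" for k
      using Qcrit[of "s' k"] by (simp add: crit_def)
    ultimately have "?d (\<lambda>_. 0) 0 (\<Sum>i\<le>Suc m. eval_poly (pd i f) (lin_map m B h) * z' i)" by simp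
    then have "0 = (\<Sum>i\<le>Suc m. eval_poly (pd i f) (lin_map m B h) * z' i)"
      using dlim_unique[OF _ dlim_const[of 0]] by simp
    also have "\<dots> = (\<Sum>i\<le>Suc m. \<mu> * \<tau> * (l i * lin_map m C h i) + \<mu> * (l i * lin_map m B w i))"
      using \<mu>(2) by (intro sum.cong refl) (simp add: z'_def algebra_simps)
    also have "\<dots> = \<mu> * \<tau> * (\<Sum>i\<le>Suc m. l i * lin_map m C h i) + \<mu> * (\<Sum>i\<le>Suc m. l i * lin_map m B w i)"
      by (simp only: sum.distrib sum_distrib_left)
    finally show ?thesis using image_in_cone[OF wh(1)] \<mu>(1) C[OF P] by (simp add: h_def)
  qed
  \<comment> \<open>First order of the gradient equations, where \<open>\<tau> = 0\<close> leaves
    the Hessian of \<open>g\<close> applied to \<open>w\<close>.\<close>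
  have "w = (\<lambda>k. w (chart P) * chart_pt P k)"
  proof (rule hessian_kernel[OF P wh(1)])
    fix j assume j: "j \<le> m"
    have "?d (\<lambda>k. \<Sum>i\<le>Suc m. eval_poly (pd i f) (lin_map m (Bs (s (s' k))) (Q (s' k))) * Bs (s (s' k)) i j)
        (\<Sum>i\<le>Suc m. eval_poly (pd i f) (lin_map m B h) * B i j)
        (\<Sum>i\<le>Suc m. (\<Sum>a\<le>Suc m. eval_poly (pd a (pd i f)) (lin_map m B h) * z' a) * B i j
           + eval_poly (pd i f) (lin_map m B h) * (\<tau> * C i j))"
      by (intro dlim_sum dlim_mult dB dlim_eval_poly[OF finite_atMost pd_in_polys[OF f_polys] dz])
    moreover have "(\<Sum>i\<le>Suc m. eval_poly (pd i f) (lin_map m B h) * B i j) = 0"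
      using S_sing(2)[OF P j] eval_pd_pullback[OF f_polys j] by (simp only: h_def)
    moreover have "(\<Sum>i\<le>Suc m. eval_poly (pd i f) (lin_map m (Bs (s (s' k))) (Q (s' k))) * Bs (s (s' k)) i j) = 0" for k
      using Qcrit[of "s' k"] j unfolding crit_def by blast
    ultimately have "?d (\<lambda>_. 0) 0 (\<Sum>i\<le>Suc m. (\<Sum>a\<le>Suc m. eval_poly (pd a (pd i f)) (lin_map m B h) * z' a) * B i j
           + eval_poly (pd i f) (lin_map m B h) * (\<tau> * C i j))" by (simp only:)
    then have "0 = (\<Sum>i\<le>Suc m. (\<Sum>a\<le>Suc m. eval_poly (pd a (pd i f)) (lin_map m B h) * z' a) * B i j
           + eval_poly (pd i f) (lin_map m B h) * (\<tau> * C i j))"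
      using dlim_unique[OF _ dlim_const[of 0]] by simp
    also have "\<dots> = (\<Sum>i\<le>Suc m. (\<Sum>a\<le>Suc m. eval_poly (pd a (pd i f)) (lin_map m B h) * lin_map m B w a) * B i j)"
      by (simp add: \<tau> z'_def del: sum.atMost_Suc)
    also have "\<dots> = (\<Sum>i\<le>Suc m. \<Sum>a\<le>Suc m. \<Sum>k\<le>m. eval_poly (pd a (pd i f)) (lin_map m B h) * B a k * B i j * w k)"
      by (simp add: lin_map_def[of m B w] sum_distrib_left sum_distrib_right mult_ac del: sum.atMost_Suc)
    also have "\<dots> = (\<Sum>i\<le>Suc m. \<Sum>k\<le>m. \<Sum>a\<le>Suc m. eval_poly (pd a (pd i f)) (lin_map m B h) * B a k * B i j * w k)"
      by (intro sum.cong refl sum.swap)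
    also have "\<dots> = (\<Sum>k\<le>m. \<Sum>i\<le>Suc m. \<Sum>a\<le>Suc m. eval_poly (pd a (pd i f)) (lin_map m B h) * B a k * B i j * w k)"
      by (rule sum.swap)
    also have "\<dots> = (\<Sum>k\<le>m. eval_poly (pd k (pd j g)) h * w k)"
      using eval_pd_pd_pullback[OF f_polys j] by (intro sum.cong refl) (simp add: sum_distrib_right del: sum.atMost_Suc)
    finally show "(\<Sum>k\<le>m. eval_poly (pd j (pd k g)) (chart_pt P) * w k) = 0"
      unfolding h_def by (simp only: pd_commute[of j])
  qed
  \<comment> \<open>The chart coordinate is eventually constant, so the limit of the displacements
    has no component there.\<close>
  moreover have "w c = 0"
  proof -
    have "eventually (\<lambda>k. Q (s' k) c = 1) sequentially"
      using Qc s'(1) by (rule eventually_subseq[rotated])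
    then have "eventually (\<lambda>k. (Q (s' k) c - h c) / ?R k = 0) sequentially"
      by eventually_elim (simp add: hp(2))
    then have "((\<lambda>k. (Q (s' k) c - h c) / ?R k) \<longlonglongrightarrow> 0)" by (rule tendsto_eventually)
    then show ?thesis using dQ[of c] hp(3) LIMSEQ_unique unfolding dlim_def by auto
  qed
  ultimately have w0: "w = (\<lambda>_. 0)" by (metis c_def mult_zero_left)
  \<comment> \<open>By the choice of \<open>r\<close> the rescaled sizes add up to exactly 1, and
    this passes to the limit.\<close>
  have "(\<lambda>k. (\<Sum>j\<le>m. norm ((Q (s' k) j - h j) / ?R k)) + norm ((of_real (T (s (s' k))) - 0) / ?R k))
      \<longlonglongrightarrow> (\<Sum>j\<le>m. norm (w j)) + norm \<tau>"
    using dQ dT unfolding dlim_def by (intro tendsto_intros) auto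
  moreover have "(\<Sum>j\<le>m. norm ((Q (s' k) j - h j) / ?R k)) + norm ((of_real (T (s (s' k))) - 0) / ?R k) = 1" for k
  proof -
    have "(\<Sum>j\<le>m. norm ((Q (s' k) j - h j) / ?R k)) + norm ((of_real (T (s (s' k))) - 0) / ?R k)
        = ((\<Sum>j\<le>m. norm (Q (s' k) j - h j)) + T (s (s' k))) / r (s' k)"
      using rpos[of "s' k"] Tpos[of "s (s' k)"]
      by (simp add: norm_divide sum_divide_distrib add_divide_distrib)
    also have "\<dots> = 1" using rpos[of "s' k"] unfolding r_def[symmetric] by simp
    finally show ?thesis .
  qed
  ultimately have "(\<Sum>j\<le>m. norm (w j)) + norm \<tau> = 1" by (simp add: LIMSEQ_const_iff)
  then show False using w0 \<tau> by simp
qed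

end

section \<open>Coefficients and homogeneous parts\<close>

lemma pullback_in_polys: "f \<in> forms I d \<Longrightarrow> pullback_form m A f \<in> polys {..m}"
  using pullback_in_forms forms_subset_polys by blast

lemma finite_monomials:
  assumes "finite I"
  shows "finite (monomials I d)"
proof (rule inj_on_finite[of lookup])
  show "inj_on lookup (monomials I d)" by (auto simp: inj_on_def lookup_inject)
  show "lookup ` monomials I d \<subseteq> {v. \<forall>i. (i \<in> I \<longrightarrow> v i \<in> {..d}) \<and> (i \<notin> I \<longrightarrow> v i = 0)}"
  proof clarify
    fix m i assume m: "m \<in> monomials I d"
    have "lookup m i \<le> d"
    proof (cases "i \<in> keys m")
      case True
      then have "lookup m i \<le> (\<Sum>i\<in>keys m. lookup m i)"
        by (intro member_le_sum) auto
      then show ?thesis using m by (simp add: monomials_def)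
    qed (simp add: in_keys_iff)
    moreover have "i \<notin> I \<Longrightarrow> lookup m i = 0" using m by (auto simp: monomials_def in_keys_iff)
    ultimately show "(i \<in> I \<longrightarrow> lookup m i \<in> {..d}) \<and> (i \<notin> I \<longrightarrow> lookup m i = 0)" by simp
  qed
  show "finite {v. \<forall>i. (i \<in> I \<longrightarrow> v i \<in> {..d}) \<and> (i \<notin> I \<longrightarrow> v i = 0)}"
    using assms by (intro finite_set_of_finite_funs) auto
qed

lemma eval_forms:
  assumes "finite I" "g \<in> forms I d"
  shows "eval_poly g x = (\<Sum>\<mu>\<in>monomials I d. mon x \<mu> * lookup g \<mu>)"
  using assms by (subst eval_poly_superset[of "monomials I d"]) (auto simp: finite_monomials forms_def mult.commute)

lemma lookup_forms_cspace: "g \<in> forms I d \<Longrightarrow> lookup g \<in> cspace (monomials I d)"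
  by (auto simp: forms_def cspace_def in_keys_iff)

text \<open>A form of degree \<open>d\<close> that vanishes on the grid is zero, so evaluation on
  the grid has a left inverse, which recovers the coefficients.\<close>

lemma coefficient_interpolation:
  assumes I: "finite I"
  shows "\<exists>X a. finite X \<and>
    (\<forall>g\<in>forms I d. \<forall>\<mu>\<in>monomials I d. lookup g \<mu> = (\<Sum>x\<in>X. a \<mu> x * eval_poly g x))"
proof -
  let ?M = "monomials I d"
  define X where "X = {x \<in> cspace I. \<forall>i\<in>I. x i \<in> (of_nat ` {..d} :: complex set)}"
  have X: "finite X" unfolding X_def by (rule cspace_box) (use I in auto)
  note M = finite_monomials[OF I, of d]
  have "\<exists>a. \<forall>k\<in>?M. \<forall>l\<in>?M. (\<Sum>x\<in>X. a k x * mon x l) = (if l = k then 1 else 0)"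
  proof (rule left_inverse_exists[OF X M])
    fix w assume w: "w \<in> cspace ?M" "\<forall>x\<in>X. (\<Sum>\<mu>\<in>?M. mon x \<mu> * w \<mu>) = 0"
    define p where "p = (\<Sum>\<mu>\<in>?M. single \<mu> (w \<mu>))"
    have p: "eval_poly p x = (\<Sum>\<mu>\<in>?M. mon x \<mu> * w \<mu>)" for x
      by (simp add: p_def eval_poly_sum mult.commute)
    have l: "lookup p \<mu> = w \<mu>" for \<mu>
      using w(1) M by (auto simp: p_def lookup_sum lookup_single when_def cspace_def)
    have "p \<in> polys I"
      unfolding p_def by (intro sum_in_polys) (auto simp: polys_def monomials_def)
    have "linepoly d (\<lambda>x. mon x \<mu>)" if "\<mu> \<in> ?M" for \<mu>
    proof -
      have "linepoly (\<Sum>i\<in>keys \<mu>. lookup \<mu> i * 1) (\<lambda>x. mon x \<mu>)"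
        unfolding mon_def by (intro linepoly_prod linepoly_power linepoly_proj)
      then show ?thesis using that by (simp add: monomials_def)
    qed
    then have "linepoly d (\<lambda>x. \<Sum>\<mu>\<in>?M. w \<mu> * mon x \<mu>)" by (intro linepoly_sum linepoly_cmult)
    then have lin: "linepoly d (eval_poly p)" by (simp add: p[abs_def] mult.commute)
    have "eval_poly p x = 0" if "x \<in> cspace I" for x
      by (rule linepoly_zero_on_grid[OF I lin _ that]) (use w(2) p in \<open>auto simp: X_def\<close>)
    then have "p = 0" using polys_eqI[OF \<open>p \<in> polys I\<close> zero_in_polys] by simp
    then show "w = (\<lambda>_. 0)" using l by auto
  qed
  then obtain a where a: "\<And>k l. k \<in> ?M \<Longrightarrow> l \<in> ?M \<Longrightarrow> (\<Sum>x\<in>X. a k x * mon x l) = (if l = k then 1 else 0)" by blast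
  have "lookup g \<mu> = (\<Sum>x\<in>X. a \<mu> x * eval_poly g x)" if g: "g \<in> forms I d" and \<mu>: "\<mu> \<in> ?M" for g \<mu>
  proof -
    have "(\<Sum>x\<in>X. a \<mu> x * eval_poly g x) = (\<Sum>x\<in>X. \<Sum>\<nu>\<in>?M. a \<mu> x * mon x \<nu> * lookup g \<nu>)"
      by (simp add: eval_forms[OF I g] sum_distrib_left mult.assoc)
    also have "\<dots> = (\<Sum>\<nu>\<in>?M. (\<Sum>x\<in>X. a \<mu> x * mon x \<nu>) * lookup g \<nu>)"
      by (subst sum.swap) (simp add: sum_distrib_right)
    also have "\<dots> = (\<Sum>\<nu>\<in>?M. if \<nu> = \<mu> then lookup g \<nu> else 0)"
      using a[OF \<mu>] by (intro sum.cong) auto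
    finally show ?thesis using \<mu> M by simp
  qed
  then show ?thesis using X by blast
qed

text \<open>Principal open sets are cut out by forms, while the counting argument yields an
  inhomogeneous polynomial, so one of its homogeneous parts has to serve.\<close>

lemma homogeneous_decomposition:
  assumes "p \<in> polys I"
  shows "\<exists>N F. (\<forall>e. F e \<in> forms I e) \<and> (\<forall>v. eval_poly p v = (\<Sum>e\<le>(N::nat). eval_poly (F e) v))"
proof -
  let ?deg = "\<lambda>m :: 'a \<Rightarrow>\<^sub>0 nat. \<Sum>i\<in>keys m. lookup m i"
  let ?K = "keys p"
  define N where "N = Max (insert 0 (?deg ` ?K))"
  define F where "F e = (\<Sum>m\<in>{m\<in>?K. ?deg m = e}. single m (lookup p m))" for e
  have "F e \<in> forms I e" for e
    unfolding F_def using assms by (intro forms_sum) (auto simp: forms_def monomials_def polys_def)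
  moreover have "eval_poly p v = (\<Sum>e\<le>N. eval_poly (F e) v)" for v
  proof -
    have "(\<Sum>e\<le>N. eval_poly (F e) v) = (\<Sum>e\<le>N. \<Sum>m\<in>{m\<in>?K. ?deg m = e}. lookup p m * mon v m)"
      by (simp add: F_def eval_poly_sum)
    also have "\<dots> = (\<Sum>m\<in>?K. lookup p m * mon v m)"
      by (rule sum.group) (auto simp: N_def)
    finally show ?thesis by (simp add: eval_poly_superset[of ?K])
  qed
  ultimately show ?thesis by blast
qed

text \<open>As a function of \<open>c\<close>, the value at c u is a polynomial whose coefficient at
  \<open>e0\<close> is nonzero.\<close>

lemma nonzero_multiple:
  assumes F: "\<And>e. F e \<in> forms I e" and p: "\<And>v. eval_poly p v = (\<Sum>e\<le>N. eval_poly (F e) v)"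
    and nz: "e0 \<le> N" "eval_poly (F e0) u \<noteq> 0"
  shows "\<exists>c. c \<noteq> 0 \<and> eval_poly p (\<lambda>i. c * u i) \<noteq> 0"
proof -
  define q where "q = (\<Sum>e\<le>N. monom (eval_poly (F e) u) e)"
  have "coeff q e0 = eval_poly (F e0) u" using nz(1) by (simp add: q_def coeff_sum)
  then have "q \<noteq> 0" using nz(2) by auto
  then have "finite (insert 0 {c. poly q c = 0})" by (simp add: poly_roots_finite)
  then obtain c where "c \<notin> insert 0 {c. poly q c = 0}" using ex_new_if_finite[OF infinite_UNIV_char_0] by blast
  moreover have "eval_poly p (\<lambda>i. c * u i) = poly q c"
    unfolding p q_def poly_sum poly_monom using eval_forms_scale[OF F] by (simp add: mult.commute)
  ultimately show ?thesis by auto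
qed

section \<open>Finite fibres of the map from matrices to forms\<close>

context nodal_section
begin

text \<open>\<open>generic_finite_fibres\<close> speaks of values on a grid, whereas an open set of
  forms needs a homogeneous condition on coefficients. Passing to a homogeneous part costs a scalar,
  which a d-th root absorbs into the matrix.\<close>

lemma finite_fibre_form:
  assumes m: "m \<ge> 2" "m * (d - 2) \<noteq> 2"
  shows "\<exists>e F. F \<in> forms (monomials {..m} d) e \<and>
    (\<exists>B'. eval_poly F (lookup (pullback_form m B' f)) \<noteq> 0) \<and>
    (\<forall>g'\<in>forms {..m} d. eval_poly F (lookup g') \<noteq> 0 \<longrightarrow>
      finite {B'. (\<forall>i j. i > Suc m \<or> j > m \<longrightarrow> B' i j = 0) \<and>
        (\<forall>x\<in>cspace {..m}. eval_poly f (lin_map m B' x) = eval_poly g' x)})"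
proof -
  let ?M = "monomials {..m} d"
  define K where "K = {..Suc m} \<times> {..m}"
  define \<psi> where "\<psi> x v = eval_poly f (lin_map m (curry v) x)" for x and v :: "nat \<times> nat \<Rightarrow> complex"
  define b where "b k = (if k \<in> K then B (fst k) (snd k) else 0)" for k
  define J where "J x k = eval_poly (pd (fst k) f) (lin_map m B x) * x (snd k)" for x k
  have K: "finite K" by (simp add: K_def)
  have b: "b \<in> cspace K" by (simp add: b_def cspace_def)
  have lb: "lin_map m (curry b) x i = lin_map m B x i" if "i \<le> Suc m" for x i
    unfolding lin_map_def using that by (intro sum.cong) (auto simp: b_def K_def)
  have "\<forall>i. \<exists>D. linepoly D (eval_poly (pd i f))" using linepoly_eval_poly by blast
  then obtain Ds where Ds: "\<And>i. linepoly (Ds i) (eval_poly (pd i f))" by metis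
  \<comment> \<open>A common degree bound for the first derivatives, plus 1 for the linear factor
    coming from the direction.\<close>
  define E where "E = (\<Sum>i\<le>Suc m. Ds i) + 1"
  \<comment> \<open>The grid is fine enough that a first-order variation vanishing on
    \<open>X\<close> vanishes everywhere, as \<open>infinitesimally_injective\<close>
    requires.\<close>
  define X where "X = {x \<in> cspace {..m}. \<forall>i\<in>{..m}. x i \<in> (of_nat ` {..E} :: complex set)}"
  have X: "finite X" unfolding X_def by (rule cspace_box) auto
  obtain D where D: "linepoly D (eval_poly f)" using linepoly_eval_poly by blast
  have JW: "(\<Sum>k\<in>K. J x k * w k) = (\<Sum>i\<le>Suc m. eval_poly (pd i f) (lin_map m B x) * lin_map m (curry w) x i)" for x w
  proof -
    have "(\<Sum>k\<in>K. J x k * w k) = (\<Sum>i\<le>Suc m. \<Sum>j\<le>m. J x (i, j) * w (i, j))"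
      unfolding K_def by (simp add: sum.cartesian_product case_prod_beta)
    also have "\<dots> = (\<Sum>i\<le>Suc m. eval_poly (pd i f) (lin_map m B x) * lin_map m (curry w) x i)"
      by (intro sum.cong refl) (simp add: J_def lin_map_def[of m "curry w"] sum_distrib_left mult_ac)
    finally show ?thesis .
  qed
  have lcurry: "lin_map m (curry (\<lambda>k. v k + t * w k)) x i = lin_map m (curry v) x i + t * lin_map m (curry w) x i" for v w t x i
    by (simp add: lin_map_def sum.distrib sum_distrib_left algebra_simps)
  obtain P where P: "P \<in> polys X" "\<exists>v\<in>cspace K. eval_poly P (\<lambda>x. \<psi> x v) \<noteq> 0"
    "\<forall>z. eval_poly P z \<noteq> 0 \<longrightarrow> finite {v \<in> cspace K. \<forall>x\<in>X. \<psi> x v = z x}"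
  proof (rule bexE[OF generic_finite_fibres[where \<psi> = \<psi> and D = D and J = J, OF K X _ b]])
    show "linepoly D (\<psi> x)" for x
      unfolding \<psi>_def[abs_def] by (rule linepoly_comp_linear[OF D lcurry])
    show "dlim (at 0) (\<lambda>t. t) (\<lambda>t. \<psi> x (\<lambda>k. b k + t * w k)) (\<psi> x b) (\<Sum>k\<in>K. J x k * w k)" for x w
    proof -
      have "dlim (at 0) (\<lambda>t. t) (\<lambda>t. eval_poly f (\<lambda>i. lin_map m (curry b) x i + t * lin_map m (curry w) x i))
          (eval_poly f (lin_map m (curry b) x))
          (\<Sum>i\<le>Suc m. eval_poly (pd i f) (lin_map m (curry b) x) * lin_map m (curry w) x i)"
        by (rule at0.dlim_eval_poly[OF finite_atMost f_polys dlim_line])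
      moreover have "eval_poly (pd i f) (lin_map m (curry b) x) = eval_poly (pd i f) (lin_map m B x)" for i
        by (rule eval_poly_cong[OF pd_in_polys[OF f_polys]]) (simp add: lb)
      moreover have "lin_map m (curry (\<lambda>k. b k + t * w k)) x = (\<lambda>i. lin_map m (curry b) x i + t * lin_map m (curry w) x i)" for t
        by (rule ext) (rule lcurry)
      ultimately show ?thesis unfolding \<psi>_def JW by (simp only:)
    qed
    fix w assume w: "w \<in> cspace K" "\<forall>x\<in>X. (\<Sum>k\<in>K. J x k * w k) = 0"
    define \<Theta> where "\<Theta> x = (\<Sum>i\<le>Suc m. eval_poly (pd i f) (lin_map m B x) * lin_map m (curry w) x i)" for x
    have "linepoly E \<Theta>"
      unfolding \<Theta>_def[abs_def]
    proof (rule linepoly_sum)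
      fix i assume i: "i \<in> {..Suc m}"
      have "linepoly 1 (\<lambda>x. lin_map m (curry w) x i)"
        unfolding lin_map_def by (intro linepoly_sum linepoly_cmult linepoly_proj)
      then have "linepoly (Ds i + 1) (\<lambda>x. eval_poly (pd i f) (lin_map m B x) * lin_map m (curry w) x i)"
        by (intro linepoly_mult linepoly_comp_linear[OF Ds] lin_map_linear)
      moreover have "Ds i \<le> (\<Sum>i\<le>Suc m. Ds i)" using i by (intro member_le_sum) auto
      ultimately show "linepoly E (\<lambda>x. eval_poly (pd i f) (lin_map m B x) * lin_map m (curry w) x i)"
        by (elim linepoly_mono) (simp add: E_def del: sum.atMost_Suc)
    qed
    then have \<Theta>0: "\<Theta> x = 0" if "x \<in> cspace {..m}" for x
      by (rule linepoly_zero_on_grid[OF finite_atMost _ _ that]) (use w(2) in \<open>auto simp: \<Theta>_def JW X_def\<close>)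
    have "curry w i j = 0" for i j
    proof (rule infinitesimally_injective[OF m])
      show "curry w i k = 0" if "Suc m < i \<or> m < k" for i k
        using w(1) that by (auto simp: cspace_def K_def)
      show "(\<Sum>i\<le>Suc m. eval_poly (pd i f) (lin_map m B x) * lin_map m (curry w) x i) = 0" if "x \<in> cspace {..m}" for x
        using \<Theta>0[OF that] by (simp add: \<Theta>_def)
    qed
    then show "w = (\<lambda>_. 0)" by (auto simp: fun_eq_iff)
  qed (use that in blast)
  \<comment> \<open>\<open>P\<close> rewritten in the coefficients of a form, on which its values
    depend linearly.\<close>
  define P' where "P' = subst_poly (\<lambda>x. \<Sum>\<mu>\<in>?M. Const (mon x \<mu>) * Var \<mu>) P"
  have P': "P' \<in> polys ?M"
    unfolding P'_def by (rule subst_in_polys[OF P(1)]) (intro sum_in_polys mult_in_polys Const_in_polys Var_in_polys)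
  have eP': "eval_poly P' u = eval_poly P (\<lambda>x. \<Sum>\<mu>\<in>?M. mon x \<mu> * u \<mu>)" for u
    by (simp add: P'_def eval_subst_poly eval_poly_sum eval_poly_mult)
  obtain N F where F: "\<And>e. F e \<in> forms ?M e" and dec: "\<And>v. eval_poly P' v = (\<Sum>e\<le>(N::nat). eval_poly (F e) v)"
    using homogeneous_decomposition[OF P'] by blast
  obtain v where v: "v \<in> cspace K" "eval_poly P (\<lambda>x. \<psi> x v) \<noteq> 0" using P(2) by blast
  let ?gv = "pullback_form m (curry v) f"
  have "eval_poly P' (lookup ?gv) \<noteq> 0"
    using v(2) unfolding eP' eval_forms[OF finite_atMost pullback_in_forms[OF f], symmetric] eval_pullback
    by (simp add: \<psi>_def)
  then obtain e where e: "e \<le> N" "eval_poly (F e) (lookup ?gv) \<noteq> 0"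
    unfolding dec by (meson atMost_iff sum.neutral)
  have "finite {B'. (\<forall>i j. i > Suc m \<or> j > m \<longrightarrow> B' i j = 0) \<and>
        (\<forall>x\<in>cspace {..m}. eval_poly f (lin_map m B' x) = eval_poly g' x)}" (is "finite ?A")
    if g': "g' \<in> forms {..m} d" and nz: "eval_poly (F e) (lookup g') \<noteq> 0" for g'
  proof -
    obtain c where c: "c \<noteq> 0" "eval_poly P' (\<lambda>i. c * lookup g' i) \<noteq> 0"
      using nonzero_multiple[OF F dec e(1) nz] by blast
    have "(\<Sum>\<mu>\<in>?M. mon x \<mu> * (c * lookup g' \<mu>)) = c * eval_poly g' x" for x
      by (simp add: eval_forms[OF finite_atMost g'] sum_distrib_left mult_ac)
    then have "eval_poly P (\<lambda>x. c * eval_poly g' x) \<noteq> 0" using c(2) unfolding eP' by simp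
    then have fin: "finite {v \<in> cspace K. \<forall>x\<in>X. \<psi> x v = c * eval_poly g' x}" using P(3) by blast
    have "d > 0" using d by simp
    then have "d \<noteq> 0" by simp
    then obtain \<rho> where \<rho>: "\<rho> ^ d = c" using exists_complex_root[of d c] by metis
    then have \<rho>0: "\<rho> \<noteq> 0" using c(1) \<open>d > 0\<close> by auto
    \<comment> \<open>Scaling by \<open>\<rho>\<close> embeds the fibre over \<open>g'\<close> into
      the finite fibre over c g'.\<close>
    let ?h = "\<lambda>B' (k :: nat \<times> nat). \<rho> * B' (fst k) (snd k)"
    show ?thesis
    proof (rule inj_on_finite[OF _ _ fin, of ?h])
      show "inj_on ?h ?A"
      proof (rule inj_onI)
        fix B1 B2 assume "?h B1 = ?h B2"
        then have "B1 i j = B2 i j" for i j using fun_cong[of "?h B1" "?h B2" "(i, j)"] \<rho>0 by simp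
        then show "B1 = B2" by (intro ext)
      qed
      show "?h ` ?A \<subseteq> {v \<in> cspace K. \<forall>x\<in>X. \<psi> x v = c * eval_poly g' x}"
      proof (rule image_subsetI)
        fix B' assume B': "B' \<in> ?A"
        have "lin_map m (curry (?h B')) x = (\<lambda>i. \<rho> * lin_map m B' x i)" for x
          by (simp add: lin_map_def sum_distrib_left mult.assoc)
        then have "\<psi> x (?h B') = c * eval_poly f (lin_map m B' x)" for x
          unfolding \<psi>_def using eval_forms_scale[OF f] \<rho> by simp
        then show "?h B' \<in> {v \<in> cspace K. \<forall>x\<in>X. \<psi> x v = c * eval_poly g' x}"
          using B' by (auto simp: cspace_def K_def X_def)
      qed
    qed
  qed
  then show ?thesis using F e(2) by blast
qed

end

section \<open>Zariski topology and orbits\<close>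

lemma principal_open_mult: "principal_open I (F * G) = principal_open I F \<inter> principal_open I G"
  by (auto simp: principal_open_def eval_poly_mult)

text \<open>Multiplying forms intersects their principal open sets, so the generating sets already
  form a base.\<close>

lemma zariski_base:
  assumes "openin (zariski I) U" "P \<in> U"
  shows "\<exists>F e. F \<in> forms I e \<and> P \<in> principal_open I F \<and> principal_open I F \<subseteq> U"
proof -
  have "generate_topology_on {principal_open I F | F d. F \<in> forms I d} U"
    using assms(1) unfolding zariski_def openin_topology_generated_by_iff .
  then show ?thesis using assms(2)
  proof (induction arbitrary: P rule: generate_topology_on.induct)
    case Empty
    then show ?case by simp
  next
    case (Int a b)
    from Int(3)[OF IntD1[OF Int(5)]] obtain F e where "F \<in> forms I e" "P \<in> principal_open I F" "principal_open I F \<subseteq> a"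
      by blast
    moreover from Int(4)[OF IntD2[OF Int(5)]] obtain G e' where
      "G \<in> forms I e'" "P \<in> principal_open I G" "principal_open I G \<subseteq> b" by blast
    ultimately show ?case using forms_mult[of F I e G e'] principal_open_mult[of I F G] by blast
  next
    case (UN K)
    then show ?case by (meson UnionE Union_upper subset_trans)
  next
    case (Basis s)
    then show ?case by blast
  qed
qed

lemma openin_principal_open: "F \<in> forms I e \<Longrightarrow> openin (zariski I) (principal_open I F)"
  unfolding zariski_def openin_topology_generated_by_iff by (rule generate_topology_on.Basis) blast

lemma topspace_zariski: "proj I \<subseteq> topspace (zariski I)"
proof
  fix P assume "P \<in> proj I"
  then obtain v where v: "v \<in> cspace I" "v \<noteq> (\<lambda>_. 0)" "P = proj_pt v" by (auto simp: proj_def)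
  then obtain i where i: "v i \<noteq> 0" by auto
  then have "i \<in> I" using v by (auto simp: cspace_def)
  then have "P \<in> principal_open I (Var i)"
    unfolding v(3) principal_open_iff[OF Var_in_forms[OF \<open>i \<in> I\<close>] v(1,2)] using i by simp
  then show "P \<in> topspace (zariski I)"
    using openin_subset[OF openin_principal_open[OF Var_in_forms[OF \<open>i \<in> I\<close>]]] by blast
qed

lemma topspace_quotient_topology: "topspace (quotient_topology X q) = q ` topspace X"
proof
  show "topspace (quotient_topology X q) \<subseteq> q ` topspace X"
    using openin_topspace[of "quotient_topology X q"] unfolding openin_quotient_topology by blast
  have "openin (quotient_topology X q) (q ` topspace X)"
    unfolding openin_quotient_topology by (auto intro: back_subst[of "openin X", OF openin_topspace])
  then show "q ` topspace X \<subseteq> topspace (quotient_topology X q)" by (rule openin_subset)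
qed

section \<open>Points of the space of forms and their orbits\<close>

lemma lookup_Const_mult: "lookup (Const c * p) \<mu> = c * lookup p \<mu>"
proof -
  have "Const c * p = (\<Sum>m\<in>keys p. single m (c * lookup p m))"
    by (subst (1) poly_mapping_expand[of p]) (simp add: sum_distrib_left Const_def mult_single)
  then show ?thesis by (auto simp: lookup_sum lookup_single when_def in_keys_iff)
qed

lemma form_pt_eqI:
  assumes "g \<in> polys I" "g' \<in> polys I" "c \<noteq> 0"
    and "\<And>x. x \<in> cspace I \<Longrightarrow> eval_poly g' x = c * eval_poly g x"
  shows "form_pt g' = form_pt g"
proof -
  have "g' = Const c * g"
    by (rule polys_eqI[OF assms(2) mult_in_polys[OF Const_in_polys assms(1)]])
      (simp add: assms(4) eval_poly_mult)
  then have "lookup g' \<in> proj_pt (lookup g)"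
    unfolding mem_proj_pt using assms(3) by (intro exI[of _ c]) (simp add: lookup_Const_mult fun_eq_iff)
  then show ?thesis unfolding form_pt_def by (rule proj_pt_eqI)
qed

lemma form_pt_eqD:
  assumes "form_pt g' = form_pt g"
  shows "\<exists>c. c \<noteq> 0 \<and> (\<forall>x. eval_poly g' x = c * eval_poly g x)"
proof -
  have "lookup g' \<in> proj_pt (lookup g)"
    using assms unfolding form_pt_def by (metis proj_pt_self)
  then obtain c where c: "c \<noteq> 0" "lookup g' = (\<lambda>i. c * lookup g i)"
    unfolding mem_proj_pt by blast
  have "g' = Const c * g"
    by (rule poly_mapping_eqI) (simp add: lookup_Const_mult c(2))
  then show ?thesis using c(1) by (auto simp: eval_poly_mult)
qed

lemma lin_map_comp: "\<exists>N. \<forall>x. lin_map m N x = lin_map m M (lin_map m A x)"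
proof (intro exI allI ext)
  fix x j
  have "lin_map m M (lin_map m A x) j = (\<Sum>i\<le>m. \<Sum>k\<le>m. M j i * A i k * x k)"
    by (simp add: lin_map_def sum_distrib_left mult.assoc)
  also have "\<dots> = (\<Sum>k\<le>m. (\<Sum>i\<le>m. M j i * A i k) * x k)"
    by (subst sum.swap) (simp add: sum_distrib_right)
  finally show "lin_map m (\<lambda>j k. \<Sum>i\<le>m. M j i * A i k) x j = lin_map m M (lin_map m A x) j"
    by (simp add: lin_map_def)
qed

abbreviation GL :: "nat \<Rightarrow> (nat \<Rightarrow> nat \<Rightarrow> complex) \<Rightarrow> bool" where
  "GL m A \<equiv> bij_betw (lin_map m A) (cspace {..m}) (cspace {..m})"

text \<open>Representatives of one point differ by a scalar, which survives pullback unchanged, so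
  the orbit can be computed from a fixed representative.\<close>

lemma PGL_orbit_form_pt:
  assumes "g \<in> forms {..m} d"
  shows "PGL_orbit d m (form_pt g) = {form_pt (pullback_form m A g) | A. GL m A}"
proof
  show "{form_pt (pullback_form m A g) | A. GL m A} \<subseteq> PGL_orbit d m (form_pt g)"
    unfolding PGL_orbit_def using assms by blast
  show "PGL_orbit d m (form_pt g) \<subseteq> {form_pt (pullback_form m A g) | A. GL m A}"
  proof
    fix x assume "x \<in> PGL_orbit d m (form_pt g)"
    then obtain g' A where g': "x = form_pt (pullback_form m A g')" "g' \<in> forms {..m} d"
      "form_pt g' = form_pt g" "GL m A" unfolding PGL_orbit_def by blast
    obtain c where c: "c \<noteq> 0" "\<And>x. eval_poly g' x = c * eval_poly g x" using form_pt_eqD[OF g'(3)] by blast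
    have "form_pt (pullback_form m A g') = form_pt (pullback_form m A g)"
      by (rule form_pt_eqI[OF _ _ c(1), of _ "{..m}"])
        (use pullback_in_polys[OF assms] pullback_in_polys[OF g'(2)] in \<open>auto simp: eval_pullback c\<close>)
    then show "x \<in> {form_pt (pullback_form m A g) | A. GL m A}" using g' by blast
  qed
qed

lemma pullback_cong:
  assumes "f \<in> forms I d" "f' \<in> forms I' d'" "\<And>x. x \<in> cspace {..m} \<Longrightarrow> eval_poly f (lin_map m A x) = eval_poly f' (lin_map m A' x)"
  shows "pullback_form m A f = pullback_form m A' f'"
  by (rule polys_eqI[of _ "{..m}"])
    (use pullback_in_forms[OF assms(1), of m A] pullback_in_forms[OF assms(2), of m A'] forms_subset_polys
      in \<open>auto simp: eval_pullback assms(3)\<close>)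

text \<open>Both inclusions come from composition: compose with \<open>M\<close> in one direction,
  factor through the bijection \<open>M\<close> in the other.\<close>

lemma PGL_orbit_pullback:
  assumes g: "g \<in> forms {..m} d" and M: "GL m M"
  shows "PGL_orbit d m (form_pt (pullback_form m M g)) = PGL_orbit d m (form_pt g)"
  unfolding PGL_orbit_form_pt[OF g] PGL_orbit_form_pt[OF pullback_in_forms[OF g]]
proof (intro set_eqI iffI)
  fix x assume "x \<in> {form_pt (pullback_form m A (pullback_form m M g)) | A. GL m A}"
  then obtain A where A: "x = form_pt (pullback_form m A (pullback_form m M g))" "GL m A" by blast
  obtain N where N: "\<And>x. lin_map m N x = lin_map m M (lin_map m A x)" using lin_map_comp by blast
  have "GL m N" using bij_betw_trans[OF A(2) M] by (simp add: N[abs_def] o_def)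
  moreover have "pullback_form m A (pullback_form m M g) = pullback_form m N g"
    by (rule pullback_cong[OF pullback_in_forms[OF g] g]) (simp add: eval_pullback N)
  ultimately show "x \<in> {form_pt (pullback_form m A g) | A. GL m A}" using A(1) by auto
next
  fix x assume "x \<in> {form_pt (pullback_form m A g) | A. GL m A}"
  then obtain A where A: "x = form_pt (pullback_form m A g)" "GL m A" by blast
  obtain A' where A': "\<And>x. lin_map m A' x \<in> cspace {..m}" "\<And>x. lin_map m A x = lin_map m M (lin_map m A' x)"
    using factor_through[OF bij_betw_imp_surj_on[OF M], of A] bij_betwE[OF A(2)] by blast
  have "GL m A'"
  proof (rule injective_imp_bij[OF A'(1)])
    fix x assume x: "x \<in> cspace {..m}" "lin_map m A' x = (\<lambda>_. 0)"
    then have "lin_map m A x = lin_map m A (\<lambda>_. 0)" using A'(2) by simp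
    moreover have "(\<lambda>_. 0) \<in> cspace {..m}" by (simp add: cspace_def)
    ultimately show "x = (\<lambda>_. 0)" using x(1) inj_onD[OF bij_betw_imp_inj_on[OF A(2)]] by blast
  qed
  moreover have "pullback_form m A g = pullback_form m A' (pullback_form m M g)"
    by (rule pullback_cong[OF g pullback_in_forms[OF g]]) (simp add: eval_pullback A'(2))
  ultimately show "x \<in> {form_pt (pullback_form m A (pullback_form m M g)) | A. GL m A}" using A(1) by auto
qed

text \<open>A singular point u = Mx would pull back to the singular point x.\<close>

lemma smooth_if_pullback_smooth:
  assumes g: "g \<in> forms {..m} d" and M: "GL m M" and smooth: "Sing {..m} (pullback_form m M g) = {}"
  shows "Sing {..m} g = {}"
  unfolding Sing_empty_iff[OF g]
proof (intro ballI impI)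
  fix u assume u: "u \<in> cspace {..m}" "eval_poly g u = 0 \<and> (\<forall>i\<in>{..m}. eval_poly (pd i g) u = 0)"
  obtain x where x: "x \<in> cspace {..m}" "u = lin_map m M x" using u(1) bij_betw_imp_surj_on[OF M] by blast
  have "crit m m g M x" using u(2) x by (simp add: crit_def)
  then have "x = (\<lambda>_. 0)" using smooth x(1) unfolding Sing_pullback_empty_iff[OF g] by blast
  then show "u = (\<lambda>_. 0)" using x(2) by simp
qed

lemma pullback_nonzero:
  assumes g: "g \<in> forms {..m} d" "g \<noteq> 0" and M: "GL m M"
  shows "pullback_form m M g \<noteq> 0"
proof
  assume 0: "pullback_form m M g = 0"
  have "g = 0"
  proof (rule polys_eqI[of _ "{..m}"])
    fix u assume "u \<in> cspace {..m}"
    then obtain x where "u = lin_map m M x" using bij_betw_imp_surj_on[OF M] by blast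
    then show "eval_poly g u = eval_poly 0 u" using 0 by (metis eval_poly_0 eval_pullback)
  qed (use g(1) forms_subset_polys in auto)
  then show False using g(2) by simp
qed

text \<open>For the zero form every point counts as singular under \<open>Sing\<close>.\<close>

lemma smooth_imp_nonzero:
  fixes g :: "nat mpoly"
  assumes "Sing {..m} g = {}"
  shows "g \<noteq> 0"
proof
  assume "g = 0"
  let ?u = "\<lambda>i::nat. if i = 0 then 1 else 0 :: complex"
  have u: "?u \<in> cspace {..m}" "?u \<noteq> (\<lambda>_. 0)" by (auto simp: cspace_def fun_eq_iff)
  have "proj_pt ?u \<in> Sing {..m} g"
    unfolding Sing_iff[OF forms_0 u, folded \<open>g = 0\<close>] using \<open>g = 0\<close> by simp
  then show False using assms by simp
qed

text \<open>The coefficients of a pullback are linear in those of \<open>g\<close>. This is what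
  makes saturations of principal open sets open.\<close>

lemma substituted_principal_open:
  assumes F: "F \<in> forms (monomials {..m} d) e"
  shows "\<exists>F'\<in>forms (monomials {..m} d) e. \<forall>g\<in>forms {..m} d.
    eval_poly F' (lookup g) = eval_poly F (lookup (pullback_form m A g))"
proof -
  let ?M = "monomials {..m} d"
  \<comment> \<open>The matrix of pullback along \<open>A\<close> in the monomial basis.\<close>
  let ?c = "\<lambda>\<mu> \<nu>. lookup (pullback_form m A (single \<nu> 1)) \<mu>"
  define \<sigma> where "\<sigma> \<mu> = (\<Sum>\<nu>\<in>?M. Const (?c \<mu> \<nu>) * Var \<nu>)" for \<mu>
  have "subst_poly \<sigma> F \<in> forms ?M e"
    by (rule subst_in_forms[OF F]) (unfold \<sigma>_def, intro forms_sum forms_cmult Var_in_forms)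
  moreover have "eval_poly (subst_poly \<sigma> F) (lookup g) = eval_poly F (lookup (pullback_form m A g))"
    if g: "g \<in> forms {..m} d" for g
  proof -
    have single: "single \<nu> 1 \<in> forms {..m} d" if "\<nu> \<in> ?M" for \<nu>
      using that by (auto simp: forms_def)
    have "pullback_form m A g = (\<Sum>\<nu>\<in>?M. Const (lookup g \<nu>) * pullback_form m A (single \<nu> 1))"
      (is "_ = ?S")
    proof (rule polys_eqI[of _ "{..m}"])
      show "pullback_form m A g \<in> polys {..m}" using pullback_in_forms[OF g] forms_subset_polys by blast
      show "?S \<in> polys {..m}"
        using pullback_in_forms[OF single] forms_subset_polys
        by (intro sum_in_polys mult_in_polys Const_in_polys) blast
      show "eval_poly (pullback_form m A g) x = eval_poly ?S x" for x
        by (simp add: eval_poly_sum eval_poly_mult eval_pullback eval_forms[OF finite_atMost g] mult.commute)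
    qed
    then have "lookup (pullback_form m A g) = (\<lambda>\<mu>. eval_poly (\<sigma> \<mu>) (lookup g))"
      by (intro ext) (simp add: \<sigma>_def lookup_sum lookup_Const_mult eval_poly_sum eval_poly_mult mult.commute)
    then show ?thesis by (simp only: eval_subst_poly)
  qed
  ultimately show ?thesis by blast
qed

section \<open>Generic finiteness of the section map\<close>

definition section_iso :: "nat \<Rightarrow> (nat \<Rightarrow> complex) set \<Rightarrow> nat \<Rightarrow> nat \<Rightarrow> complex" where
  "section_iso m H = (SOME A. hyperplane_iso (Suc m) H A)"

lemma hyperplane_section_eq: "hyperplane_section (Suc m) f H = pullback_form m (section_iso m H) f"
  by (simp add: hyperplane_section_def section_iso_def)

lemma section_iso_bij:
  assumes "H \<in> proj {..Suc m}"
  shows "bij_betw (lin_map m (section_iso m H)) (cspace {..m}) (hyperplane_cone {..Suc m} H)"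
proof -
  have "hyperplane_iso (Suc m) H (section_iso m H)"
    unfolding section_iso_def by (rule someI_ex[OF hyperplane_iso_exists[OF assms]])
  then show ?thesis by (simp add: hyperplane_iso_def)
qed

text \<open>Entries outside this block do not affect the pullback, so fibres can only be finite among truncated matrices.\<close>

definition truncate :: "nat \<Rightarrow> (nat \<Rightarrow> nat \<Rightarrow> complex) \<Rightarrow> nat \<Rightarrow> nat \<Rightarrow> complex" where
  "truncate m B = (\<lambda>i j. if i \<le> Suc m \<and> j \<le> m then B i j else 0)"

lemma lin_map_truncate: "lin_map m (truncate m B) x i = (if i \<le> Suc m then lin_map m B x i else 0)"
  by (auto simp: lin_map_def truncate_def intro!: sum.cong)

lemma pullback_truncate:
  assumes "f \<in> forms {..Suc m} d"
  shows "pullback_form m (truncate m B) f = pullback_form m B f"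
proof (rule pullback_cong[OF assms assms])
  show "eval_poly f (lin_map m (truncate m B) x) = eval_poly f (lin_map m B x)" for x
    by (rule eval_poly_cong[OF subsetD[OF forms_subset_polys assms]]) (simp add: lin_map_truncate)
qed

text \<open>Smoothness forces \<open>B\<close> to be injective, since in degree at least 2 a kernel
  vector would be a singular point. The image is then a hyperplane, whose chosen identification
  differs from \<open>B\<close> by an invertible matrix.\<close>

lemma section_of_smooth_pullback:
  assumes f: "f \<in> forms {..Suc m} d" and d: "d \<ge> 2"
    and smooth: "Sing {..m} (pullback_form m B f) = {}"
  shows "\<exists>H M. H \<in> smooth_sections (Suc m) f \<and> GL m M \<and>
    pullback_form m B f = pullback_form m M (hyperplane_section (Suc m) f H)"
proof -
  define B' where "B' = truncate m B"
  have B'cs: "lin_map m B' x \<in> cspace {..Suc m}" for x by (auto simp: B'_def cspace_def lin_map_truncate)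
  have eq: "pullback_form m B' f = pullback_form m B f" unfolding B'_def by (rule pullback_truncate[OF f])
  have zero: "eval_poly p (\<lambda>_. 0) = 0" if "p \<in> forms I k" "k > 0" for p :: "nat mpoly" and I k
    using eval_forms_scale[OF that(1), of 0 "\<lambda>_. 0"] that(2) by (simp add: power_0_left)
  have inj: "x = (\<lambda>_. 0)" if "x \<in> cspace {..m}" "lin_map m B' x = (\<lambda>_. 0)" for x
  proof -
    have "crit (Suc m) m f B' x"
      unfolding crit_def that(2) using zero[OF f] zero[OF pd_in_forms[OF f]] d by simp
    then show ?thesis using smooth that(1) unfolding eq[symmetric] Sing_pullback_empty_iff[OF f] by blast
  qed
  \<comment> \<open>The \<open>m + 2\<close> rows lie in dimension \<open>m + 1\<close>; a
    dependency among them is an equation for the image.\<close>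
  obtain c where c: "\<exists>i\<in>{..Suc m}. c i \<noteq> 0" "\<forall>j\<in>{..m}. (\<Sum>i\<le>Suc m. c i * B' i j) = 0"
    using nontrivial_kernel[of "{..m}" "{..Suc m}" B'] by auto
  define l where "l i = (if i \<le> Suc m then c i else 0)" for i
  have l: "l \<in> cspace {..Suc m}" "l \<noteq> (\<lambda>_. 0)"
    using c(1) by (auto simp: l_def cspace_def fun_eq_iff)
  define H where "H = proj_pt l"
  have H: "H \<in> proj {..Suc m}" unfolding H_def by (rule proj_pt_in_proj[OF l])
  note iso = section_iso_bij[OF H]
  have cone: "lin_map m B' x \<in> hyperplane_cone {..Suc m} H" for x
  proof -
    have "(\<Sum>i\<le>Suc m. l i * lin_map m B' x i) = (\<Sum>i\<le>Suc m. \<Sum>j\<le>m. c i * B' i j * x j)"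
      by (intro sum.cong refl) (simp add: l_def lin_map_def sum_distrib_left mult.assoc)
    also have "\<dots> = (\<Sum>j\<le>m. (\<Sum>i\<le>Suc m. c i * B' i j) * x j)"
      by (subst sum.swap) (simp add: sum_distrib_right del: sum.atMost_Suc)
    also have "\<dots> = 0" using c(2) by simp
    finally show ?thesis using B'cs by (simp add: H_def hyperplane_cone_iff)
  qed
  obtain M where M: "\<And>x. lin_map m M x \<in> cspace {..m}"
    "\<And>x. lin_map m B' x = lin_map m (section_iso m H) (lin_map m M x)"
    using factor_through[OF bij_betw_imp_surj_on[OF iso] cone] by blast
  have GL: "GL m M"
  proof (rule injective_imp_bij[OF M(1)])
    fix x assume x: "x \<in> cspace {..m}" "lin_map m M x = (\<lambda>_. 0)"
    have "lin_map m B' x = (\<lambda>_. 0)" unfolding M(2) x(2) by (rule lin_map_zero)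
    then show "x = (\<lambda>_. 0)" by (rule inj[OF x(1)])
  qed
  let ?g = "hyperplane_section (Suc m) f H"
  have g: "?g \<in> forms {..m} d" unfolding hyperplane_section_eq by (rule pullback_in_forms[OF f])
  have pb: "pullback_form m B f = pullback_form m M ?g"
    unfolding eq[symmetric] by (rule pullback_cong[OF f g]) (simp add: M(2) hyperplane_section_eq eval_pullback)
  have "Sing {..m} ?g = {}"
    by (rule smooth_if_pullback_smooth[OF g GL]) (use smooth pb in simp)
  then have "H \<in> smooth_sections (Suc m) f" using H by (simp add: smooth_sections_def)
  then show ?thesis using GL pb by blast
qed

lemma infinite_complex_ball: "e > 0 \<Longrightarrow> infinite {t::complex. norm t < e}"
  using uncountable_ball[of e "0::complex"] by (auto simp: ball_def dest: countable_finite)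

section \<open>From matrices to the moduli space\<close>

context nodal_section
begin

abbreviation smooth_locus where
  "smooth_locus \<equiv> subtopology (zariski (monomials {..m} d)) (smooth_hypersurfaces d m)"

abbreviation sec where "sec \<equiv> hyperplane_section (Suc m) f"

lemma sec_forms: "sec H \<in> forms {..m} d"
  unfolding hyperplane_section_eq by (rule pullback_in_forms[OF f])

lemma map_eq: "hyperplane_section_map d (Suc m) f H = PGL_orbit d m (form_pt (sec H))"
  by (simp add: hyperplane_section_map_def)

lemma form_pt_in_smooth_locus:
  assumes "g' \<in> forms {..m} d" "Sing {..m} g' = {}"
  shows "form_pt g' \<in> topspace smooth_locus"
proof -
  have nz: "g' \<noteq> 0" by (rule smooth_imp_nonzero[OF assms(2)])
  then have "lookup g' \<noteq> (\<lambda>_. 0)" using lookup_inject[of g' 0] by (auto simp: zero_poly_mapping.rep_eq)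
  then have "form_pt g' \<in> proj (monomials {..m} d)"
    unfolding form_pt_def by (intro proj_pt_in_proj lookup_forms_cspace assms(1))
  then show ?thesis
    using topspace_zariski assms nz by (auto simp: smooth_hypersurfaces_def hypersurface_def)
qed

lemma form_pt_principal_open:
  assumes "F \<in> forms (monomials {..m} d) e" "g' \<in> forms {..m} d" "g' \<noteq> 0"
  shows "form_pt g' \<in> principal_open (monomials {..m} d) F \<longleftrightarrow> eval_poly F (lookup g') \<noteq> 0"
proof -
  have "lookup g' \<noteq> (\<lambda>_. 0)"
    using assms(3) lookup_inject[of g' 0] by (auto simp: zero_poly_mapping.rep_eq)
  then show ?thesis
    unfolding form_pt_def by (rule principal_open_iff[OF assms(1) lookup_forms_cspace[OF assms(2)]])
qed

text \<open>A hyperplane whose orbit contains the point of \<open>g'\<close> is the image of a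
  matrix with f(B'x) = g'(x), so finitely many matrices leave finitely many hyperplanes.\<close>

lemma finite_hyperplanes:
  assumes g': "g' \<in> forms {..m} d"
    and fin: "finite {B'. (\<forall>i j. i > Suc m \<or> j > m \<longrightarrow> B' i j = 0) \<and>
        (\<forall>x\<in>cspace {..m}. eval_poly f (lin_map m B' x) = eval_poly g' x)}" (is "finite ?A")
  shows "finite {H \<in> proj {..Suc m}. form_pt g' \<in> hyperplane_section_map d (Suc m) f H}" (is "finite ?H")
proof -
  have "hyperplane_cone {..Suc m} H \<in> (\<lambda>B'. lin_map m B' ` cspace {..m}) ` ?A" if H: "H \<in> ?H" for H
  proof -
    have Hp: "H \<in> proj {..Suc m}" using H by blast
    note iso = section_iso_bij[OF Hp]
    obtain A where A: "form_pt g' = form_pt (pullback_form m A (sec H))" "GL m A"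
      using H unfolding map_eq PGL_orbit_form_pt[OF sec_forms] by blast
    obtain c where c: "c \<noteq> 0" "\<And>x. eval_poly g' x = c * eval_poly (pullback_form m A (sec H)) x"
      using form_pt_eqD[OF A(1)] by blast
    have "d \<noteq> 0" using d by simp
    \<comment> \<open>The orbit determines \<open>g'\<close> only up to the scalar \<open>c\<close>;
      the d-th root makes the equation exact.\<close>
    then obtain \<rho> where \<rho>: "\<rho> ^ d = c" using exists_complex_root[of d c] by metis
    then have \<rho>0: "\<rho> \<noteq> 0" using c(1) \<open>d \<noteq> 0\<close> by auto
    obtain N where N: "\<And>x. lin_map m N x = lin_map m (section_iso m H) (lin_map m A x)" using lin_map_comp by blast
    define B' where "B' = truncate m (\<lambda>i j. \<rho> * N i j)"
    have scl: "(\<lambda>k. a * x k) \<in> cspace I" if "x \<in> cspace I" for a and x :: "nat \<Rightarrow> complex" and I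
      using that by (auto simp: cspace_def)
    have B': "lin_map m B' x = lin_map m (section_iso m H) (lin_map m A (\<lambda>k. \<rho> * x k))" if x: "x \<in> cspace {..m}" for x
    proof
      fix i
      have "lin_map m (section_iso m H) (lin_map m A (\<lambda>k. \<rho> * x k)) \<in> hyperplane_cone {..Suc m} H"
        using bij_betwE[OF iso] bij_betwE[OF A(2)] scl[OF x] by blast
      then have "lin_map m (section_iso m H) (lin_map m A (\<lambda>k. \<rho> * x k)) i = 0" if "i > Suc m"
        using that by (auto simp: hyperplane_cone_def cspace_def)
      moreover have "lin_map m (\<lambda>i j. \<rho> * N i j) x i = lin_map m N (\<lambda>k. \<rho> * x k) i"
        by (simp add: lin_map_def mult_ac)
      ultimately show "lin_map m B' x i = lin_map m (section_iso m H) (lin_map m A (\<lambda>k. \<rho> * x k)) i"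
        by (simp add: B'_def lin_map_truncate N)
    qed
    have "B' \<in> ?A"
    proof (intro CollectI conjI ballI)
      show "\<forall>i j. i > Suc m \<or> j > m \<longrightarrow> B' i j = 0" by (auto simp: B'_def truncate_def)
      fix x assume x: "x \<in> cspace {..m}"
      have "eval_poly f (lin_map m B' x) = eval_poly (pullback_form m A (sec H)) (\<lambda>k. \<rho> * x k)"
        unfolding B'[OF x] by (simp add: hyperplane_section_eq eval_pullback)
      then show "eval_poly f (lin_map m B' x) = eval_poly g' x"
        unfolding eval_forms_scale[OF pullback_in_forms[OF sec_forms]] c(2) \<rho> .
    qed
    moreover have "lin_map m B' ` cspace {..m} = hyperplane_cone {..Suc m} H"
    proof -
      have "cspace {..m} = (\<lambda>x k. \<rho> * x k) ` (cspace {..m} :: (nat \<Rightarrow> complex) set)"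
      proof (intro set_eqI iffI)
        fix x :: "nat \<Rightarrow> complex" assume "x \<in> cspace {..m}"
        then show "x \<in> (\<lambda>x k. \<rho> * x k) ` cspace {..m}"
          using \<rho>0 scl[of x _ "1 / \<rho>"] by (intro image_eqI[of _ _ "\<lambda>k. (1 / \<rho>) * x k"]) auto
      qed (auto intro: scl)
      then have "lin_map m A ` (\<lambda>x k. \<rho> * x k) ` cspace {..m} = cspace {..m}"
        using bij_betw_imp_surj_on[OF A(2)] by simp
      then have "(\<lambda>x. lin_map m (section_iso m H) (lin_map m A (\<lambda>k. \<rho> * x k))) ` cspace {..m} = hyperplane_cone {..Suc m} H"
        using bij_betw_imp_surj_on[OF iso] by (metis (no_types, lifting) image_cong image_image)
      then show ?thesis using B' by (simp cong: image_cong)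
    qed
    ultimately show ?thesis by blast
  qed
  then have "finite (hyperplane_cone {..Suc m} ` ?H)"
    using finite_imageI[OF fin] by (metis (no_types, lifting) finite_subset image_subsetI)
  moreover have "inj_on (hyperplane_cone {..Suc m}) ?H"
    by (rule inj_onI) (use hyperplane_cone_inj[OF finite_atMost] in blast)
  ultimately show ?thesis by (rule finite_imageD)
qed

text \<open>Coefficients are fixed combinations of values, and the values f(Bx) are polynomial along
  lines of matrices. Density will be checked with these polynomials in one variable.\<close>

lemma polynomial_along_line:
  assumes "F \<in> forms (monomials {..m} d) e"
  shows "\<exists>q. \<forall>t. eval_poly F (lookup (pullback_form m (\<lambda>i j. B1 i j + t * C i j) f)) = poly q t"
proof -
  let ?M = "monomials {..m} d"
  obtain X a where Xa: "finite X" "\<forall>g'\<in>forms {..m} d. \<forall>\<mu>\<in>?M. lookup g' \<mu> = (\<Sum>x\<in>X. a \<mu> x * eval_poly g' x)"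
    using coefficient_interpolation[OF finite_atMost, of m d] by blast
  define G where "G \<mu> v = (\<Sum>x\<in>X. a \<mu> x * eval_poly f (lin_map m (curry v) x))" for \<mu> v
  obtain D where D: "linepoly D (eval_poly f)" using linepoly_eval_poly by blast
  have "linepoly D (G \<mu>)" for \<mu>
    unfolding G_def[abs_def]
    by (intro linepoly_sum linepoly_cmult linepoly_comp_linear[OF D])
      (simp add: lin_map_def sum.distrib sum_distrib_left algebra_simps)
  then obtain E where E: "linepoly E (\<lambda>v. eval_poly F (\<lambda>\<mu>. G \<mu> v))"
    using linepoly_eval_comp[of F ?M G] assms forms_subset_polys by blast
  let ?v = "\<lambda>t k. case_prod B1 k + t * case_prod C k"
  from E obtain q where q: "\<And>t. eval_poly F (\<lambda>\<mu>. G \<mu> (?v t)) = poly q t"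
    unfolding linepoly_def by blast
  have "eval_poly F (lookup (pullback_form m (\<lambda>i j. B1 i j + t * C i j) f)) = poly q t" for t
    unfolding q[symmetric]
  proof (rule eval_poly_cong)
    show "F \<in> polys ?M" using assms forms_subset_polys by blast
    fix \<mu> assume "\<mu> \<in> ?M"
    then show "lookup (pullback_form m (\<lambda>i j. B1 i j + t * C i j) f) \<mu> = G \<mu> (?v t)"
      using Xa(2) pullback_in_forms[OF f] by (simp add: G_def eval_pullback curry_def)
  qed
  then show ?thesis by blast
qed

text \<open>\<open>V\<close> consists of the orbits in the image that meet the principal open set of
  \<open>finite_fibre_form\<close>. One such point in the orbit bounds the whole fibre, because
  every hyperplane in the fibre has that orbit.\<close>

lemma generically_finite_sections:
  assumes m: "m \<ge> 2" "m * (d - 2) \<noteq> 2"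
  shows "generically_finite (smooth_sections (Suc m) f) (moduli d m) (hyperplane_section_map d (Suc m) f)"
proof -
  let ?M = "monomials {..m} d" and ?U = "smooth_sections (Suc m) f" and ?q = "PGL_orbit d m"
  let ?\<phi> = "hyperplane_section_map d (Suc m) f"
  have d2: "d \<ge> 2" using d by simp
  have Usec: "Sing {..m} (sec H) = {}" "H \<in> proj {..Suc m}" if "H \<in> ?U" for H
    using that by (auto simp: smooth_sections_def)
  obtain e F where F: "F \<in> forms ?M e"
    and F2: "\<exists>B'. eval_poly F (lookup (pullback_form m B' f)) \<noteq> 0"
    and Ffin: "\<And>g'. g' \<in> forms {..m} d \<Longrightarrow> eval_poly F (lookup g') \<noteq> 0 \<Longrightarrow>
      finite {B'. (\<forall>i j. i > Suc m \<or> j > m \<longrightarrow> B' i j = 0) \<and>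
        (\<forall>x\<in>cspace {..m}. eval_poly f (lin_map m B' x) = eval_poly g' x)}"
    using finite_fibre_form[OF m] by blast
  have orbit_forms: "\<exists>g'\<in>forms {..m} d. g' \<noteq> 0 \<and> x = form_pt g'" if H: "H \<in> ?U" and x: "x \<in> ?\<phi> H" for x H
  proof -
    obtain A where "x = form_pt (pullback_form m A (sec H))" "GL m A"
      using x unfolding map_eq PGL_orbit_form_pt[OF sec_forms] by blast
    then show ?thesis
      using pullback_in_forms[OF sec_forms] pullback_nonzero[OF sec_forms smooth_imp_nonzero[OF Usec(1)[OF H]]] by blast
  qed
  obtain Y where Y: "Y = moduli d m" by simp
  have Yop: "openin Y T \<longleftrightarrow> T \<subseteq> ?q ` topspace smooth_locus \<and> openin smooth_locus {x \<in> topspace smooth_locus. ?q x \<in> T}" for T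
    unfolding Y moduli_def by (rule openin_quotient_topology)
  have topY: "topspace Y = ?q ` topspace smooth_locus" unfolding Y moduli_def by (rule topspace_quotient_topology)
  have sub: "?\<phi> ` ?U \<subseteq> topspace Y"
    unfolding topY map_eq using form_pt_in_smooth_locus[OF sec_forms Usec(1)] by blast
  let ?O = "principal_open ?M F"
  \<comment> \<open>The principal open set need not be invariant under the group, so
    \<open>T\<close> collects all orbits that meet it.\<close>
  define T where "T = {y \<in> ?q ` topspace smooth_locus. y \<inter> ?O \<noteq> {}}"
  define V where "V = T \<inter> ?\<phi> ` ?U"
  have openT: "openin Y T"
    unfolding Yop
  proof
    show "T \<subseteq> ?q ` topspace smooth_locus" by (auto simp: T_def)
    show "openin smooth_locus {x \<in> topspace smooth_locus. ?q x \<in> T}" (is "openin _ ?W")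
      unfolding openin_subopen[of _ ?W]
    proof
      fix x assume x: "x \<in> ?W"
      then have "x \<in> smooth_hypersurfaces d m" by simp
      then obtain g' where g': "x = form_pt g'" "g' \<in> forms {..m} d" "g' \<noteq> 0"
        by (auto simp: smooth_hypersurfaces_def hypersurface_def)
      have "?q (form_pt g') \<inter> ?O \<noteq> {}" using x unfolding T_def g'(1) by blast
      then obtain A where A: "GL m A" "form_pt (pullback_form m A g') \<in> ?O"
        unfolding PGL_orbit_form_pt[OF g'(2)] by blast
      \<comment> \<open>Translating \<open>F\<close> by the matrix \<open>A\<close> that moves
        \<open>x\<close> into the open set gives a principal neighbourhood of \<open>x\<close>
        inside the saturation.\<close>
      obtain F' where F': "F' \<in> forms ?M e"
        "\<And>g'. g' \<in> forms {..m} d \<Longrightarrow> eval_poly F' (lookup g') = eval_poly F (lookup (pullback_form m A g'))"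
        using substituted_principal_open[OF F, of A] by blast
      have iff: "form_pt h \<in> principal_open ?M F' \<longleftrightarrow> form_pt (pullback_form m A h) \<in> ?O"
        if "h \<in> forms {..m} d" "h \<noteq> 0" for h
        unfolding form_pt_principal_open[OF F'(1) that] F'(2)[OF that(1)]
          form_pt_principal_open[OF F pullback_in_forms[OF that(1)] pullback_nonzero[OF that A(1)]] ..
      show "\<exists>T. openin smooth_locus T \<and> x \<in> T \<and> T \<subseteq> ?W"
      proof (intro exI conjI)
        show "openin smooth_locus (principal_open ?M F' \<inter> smooth_hypersurfaces d m)"
          unfolding openin_subtopology using openin_principal_open[OF F'(1)] by blast
        show "x \<in> principal_open ?M F' \<inter> smooth_hypersurfaces d m"
          using A(2) iff[OF g'(2,3)] g'(1) x by auto
        show "principal_open ?M F' \<inter> smooth_hypersurfaces d m \<subseteq> ?W"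
        proof
          fix x' assume x': "x' \<in> principal_open ?M F' \<inter> smooth_hypersurfaces d m"
          then obtain h where h: "x' = form_pt h" "h \<in> forms {..m} d" "h \<noteq> 0" "Sing {..m} h = {}"
            by (auto simp: smooth_hypersurfaces_def hypersurface_def)
          have "form_pt (pullback_form m A h) \<in> ?q x' \<inter> ?O"
            using x' iff[OF h(2,3)] A(1) unfolding h(1) PGL_orbit_form_pt[OF h(2)] by blast
          then show "x' \<in> ?W" using form_pt_in_smooth_locus[OF h(2,4)] h(1) by (auto simp: T_def)
        qed
      qed
    qed
  qed
  have nonempty: "?U \<noteq> {}"
  proof -
    obtain B' where "Sing {..m} (pullback_form m B' f) = {}" using smooth_section_exists by blast
    then show ?thesis using section_of_smooth_pullback[OF f d2] by blast
  qed
  have dense: "subtopology Y (?\<phi> ` ?U) closure_of V = ?\<phi> ` ?U"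
  proof
    show "subtopology Y (?\<phi> ` ?U) closure_of V \<subseteq> ?\<phi> ` ?U"
      using closure_of_subset_topspace[of "subtopology Y (?\<phi> ` ?U)" V] by simp
    show "?\<phi> ` ?U \<subseteq> subtopology Y (?\<phi> ` ?U) closure_of V"
    proof
      fix y assume y: "y \<in> ?\<phi> ` ?U"
      then obtain H1 where H1: "H1 \<in> ?U" "y = ?\<phi> H1" by blast
      have "\<exists>z. z \<in> V \<and> z \<in> R" if R: "y \<in> R" "openin (subtopology Y (?\<phi> ` ?U)) R" for R
      proof -
        obtain T' where T': "openin Y T'" "R = T' \<inter> ?\<phi> ` ?U" using R(2) unfolding openin_subtopology by blast
        have "openin smooth_locus {x \<in> topspace smooth_locus. ?q x \<in> T'}" using T'(1) Yop by blast
        then obtain W where W: "openin (zariski ?M) W"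
          "{x \<in> topspace smooth_locus. ?q x \<in> T'} = W \<inter> smooth_hypersurfaces d m"
          unfolding openin_subtopology by blast
        let ?B1 = "section_iso m H1"
        have pb1: "pullback_form m ?B1 f = sec H1" by (simp add: hyperplane_section_eq)
        have "form_pt (sec H1) \<in> {x \<in> topspace smooth_locus. ?q x \<in> T'}"
          using form_pt_in_smooth_locus[OF sec_forms Usec(1)[OF H1(1)]] R(1) T'(2) H1(2) map_eq by auto
        then obtain F' e' where F': "F' \<in> forms ?M e'" "form_pt (sec H1) \<in> principal_open ?M F'" "principal_open ?M F' \<subseteq> W"
          using zariski_base[OF W(1)] unfolding W(2) by blast
        obtain B2 where B2: "eval_poly F (lookup (pullback_form m B2 f)) \<noteq> 0" using F2 by blast
        \<comment> \<open>At t = 0 the section is smooth and \<open>F'\<close> is nonzero; at t = 1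
          \<open>F\<close> is nonzero. A small t outside finitely many roots has all three
          properties.\<close>
        define Bt where "Bt t = (\<lambda>i j. ?B1 i j + t * (B2 i j - ?B1 i j))" for t
        have B01: "Bt 0 = ?B1" "Bt 1 = B2" by (simp_all add: Bt_def)
        obtain p p' where p: "\<And>t. eval_poly F (lookup (pullback_form m (Bt t) f)) = poly p t"
          and p': "\<And>t. eval_poly F' (lookup (pullback_form m (Bt t) f)) = poly p' t"
          using polynomial_along_line[OF F] polynomial_along_line[OF F'(1)] unfolding Bt_def by meson
        have "poly p 1 \<noteq> 0" using p[of 1] B2 B01 by simp
        moreover have "poly p' 0 \<noteq> 0"
          using p'[of 0] F'(2) form_pt_principal_open[OF F'(1) sec_forms smooth_imp_nonzero[OF Usec(1)[OF H1(1)]]] B01 pb1 by simp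
        ultimately have "p \<noteq> 0" "p' \<noteq> 0" by auto
        then have fin: "finite ({t. poly p t = 0} \<union> {t. poly p' t = 0})" by (simp add: poly_roots_finite)
        obtain \<epsilon> where \<epsilon>: "\<epsilon> > 0" "\<And>t. norm t < \<epsilon> \<Longrightarrow> Sing {..m} (pullback_form m (Bt t) f) = {}"
          using smooth_nearby[OF f, of m ?B1 "\<lambda>i j. B2 i j - ?B1 i j"] Usec(1)[OF H1(1)] unfolding Bt_def pb1 by blast
        have "\<not> {t. norm t < \<epsilon>} \<subseteq> {t. poly p t = 0} \<union> {t. poly p' t = 0}"
          using infinite_complex_ball[OF \<epsilon>(1)] fin finite_subset by blast
        then obtain t where t: "norm t < \<epsilon>" "poly p t \<noteq> 0" "poly p' t \<noteq> 0" by blast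
        let ?g = "pullback_form m (Bt t) f"
        have g: "?g \<in> forms {..m} d" by (rule pullback_in_forms[OF f])
        have sm: "Sing {..m} ?g = {}" by (rule \<epsilon>(2)[OF t(1)])
        have gnz: "?g \<noteq> 0" by (rule smooth_imp_nonzero[OF sm])
        \<comment> \<open>The perturbed matrix is traced back to an actual hyperplane, so its orbit
          lies in the image.\<close>
        obtain H M where HM: "H \<in> ?U" "GL m M" "?g = pullback_form m M (sec H)"
          using section_of_smooth_pullback[OF f d2 sm] by blast
        have orb: "?q (form_pt ?g) = ?\<phi> H"
          unfolding HM(3) map_eq by (rule PGL_orbit_pullback[OF sec_forms HM(2)])
        have "form_pt ?g \<in> W \<inter> smooth_hypersurfaces d m"
          using form_pt_principal_open[OF F'(1) g gnz] p' t(3) F'(3) form_pt_in_smooth_locus[OF g sm] by auto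
        then have 1: "?\<phi> H \<in> T'" unfolding W(2)[symmetric] orb[symmetric] by blast
        have "form_pt ?g \<in> ?O" using form_pt_principal_open[OF F g gnz] p t(2) by simp
        moreover have "form_pt ?g \<in> ?\<phi> H"
          unfolding map_eq PGL_orbit_form_pt[OF sec_forms] HM(3) using HM(2) by blast
        ultimately have "?\<phi> H \<in> T" using HM(1) sub unfolding T_def topY by blast
        then show ?thesis using 1 HM(1) unfolding V_def T'(2) by blast
      qed
      then show "y \<in> subtopology Y (?\<phi> ` ?U) closure_of V"
        unfolding in_closure_of using y sub by auto
    qed
  qed
  have fibres: "finite {x \<in> ?U. ?\<phi> x = y}" if y: "y \<in> V" for y
  proof -
    obtain H0 where H0: "H0 \<in> ?U" "y = ?\<phi> H0" using y by (auto simp: V_def)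
    obtain x where x: "x \<in> y" "x \<in> ?O" using y by (auto simp: V_def T_def)
    obtain g' where g': "g' \<in> forms {..m} d" "g' \<noteq> 0" "x = form_pt g'" using orbit_forms H0 x(1) by blast
    have "eval_poly F (lookup g') \<noteq> 0"
      using x(2) unfolding g'(3) form_pt_principal_open[OF F g'(1,2)] .
    then have "finite {H \<in> proj {..Suc m}. form_pt g' \<in> ?\<phi> H}"
      by (rule finite_hyperplanes[OF g'(1) Ffin[OF g'(1)]])
    then show ?thesis by (rule rev_finite_subset) (use x(1) g'(3) Usec(2) in auto)
  qed
  have "openin (subtopology Y (?\<phi> ` ?U)) V"
    unfolding V_def openin_subtopology using openT by blast
  then show ?thesis
    unfolding generically_finite_def Y[symmetric] using nonempty sub dense fibres by blast
qed

end

theorem corollary6p4: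
  fixes f :: "nat mpoly" and d n :: nat
  assumes "hypersurface {..n} d f"
    and "at_most_isolated_singularities {..n} f"
    and "(d = 3 \<and> n \<ge> 5) \<or> (d \<ge> 4 \<and> n \<ge> 3)"
    and "tjurina {..n} f < enat ((d - 2) * (d - 1) ^ (n - 1))"
    and "\<exists>H'\<in>proj {..n}. hyperplane {..n} H' \<inter> Sing {..n} f = {} \<and>
           has_exactly_nodes n {..n - 1} (hyperplane_section n f H') \<and>
           general_linear_position {..n - 1} (Sing {..n - 1} (hyperplane_section n f H'))"
  shows "generically_finite (smooth_sections n f) (moduli d (n - 1)) (hyperplane_section_map d n f)"
proof -
  define m where "m = n - 1"
  have n: "n = Suc m" using assms(3) by (auto simp: m_def)
  obtain H' where H': "H' \<in> proj {..Suc m}" "hyperplane {..Suc m} H' \<inter> Sing {..Suc m} f = {}"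
    "has_exactly_nodes (Suc m) {..m} (hyperplane_section (Suc m) f H')"
    "general_linear_position {..m} (Sing {..m} (hyperplane_section (Suc m) f H'))"
    using assms(5) unfolding n by auto
  obtain l where l: "l \<in> cspace {..Suc m}" "l \<noteq> (\<lambda>_. 0)" "H' = proj_pt l"
    using H'(1) by (auto simp: proj_def)
  interpret nodal_section m d f l "section_iso m H'"
    using assms(1,3) H' l section_iso_bij[OF H'(1)]
    by unfold_locales (auto simp: hypersurface_def n hyperplane_section_eq)
  have "m \<ge> 2" "m * (d - 2) \<noteq> 2"
  proof -
    show "m \<ge> 2" using assms(3) n by auto
    \<comment> \<open>Either d = 3 and m \<ge> 4, or d \<ge> 4 and m \<ge> 2.\<close>
    have "m * (d - 2) \<ge> 4"
      using assms(3) n mult_le_mono[of 2 m 2 "d - 2"] by auto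
    then show "m * (d - 2) \<noteq> 2" by simp
  qed
  then show ?thesis using generically_finite_sections by (simp add: n)
qed

end
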